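(* Let $\Gamma$ be a non elementary word hyperbolic group, $\rho:\Gamma\to G=\mathrm{PSO}(p,q)$ a $P_1^{p,q}$-Anosov representation, $o\in\mathbf{\Omega}_\rho$, $\tau\in S^o$, and let $\mathfrak{b}^+$ be a closed Weyl chamber of a maximal subalgebra $\mathfrak{b}\subset\mathfrak{p}^\tau\cap\mathfrak{q}^o$, with associated polar projection $b^\tau:G\to\mathfrak{b}^+$. Then for every $t\ge0$, $$\#\{\gamma\in\Gamma:\ |b^\tau(\rho(\gamma))|^{1/2}\le t\}<\infty .$$
   Context: Fix integers $p,q\ge1$ with $d:=p+q>2$. On $\mathbb{R}^d$ let $\langle x,y\rangle_{p,q}:=\sum_{i=1}^p x_iy_i-\sum_{i=p+1}^d x_iy_i$, with orthogonal complements denoted $\cdot^{\perp_{p,q}}$. $G:=\mathrm{PSO}(p,q)\subset\mathrm{PSL}(d,\mathbb{R})$ is the group of projectivized matrices of $\mathrm{SL}(d,\mathbb{R})$ preserving the form, with Lie algebra $\mathfrak{g}=\mathfrak{so}(p,q)$ and Killing form $\kappa(X,Y)=(d-2)\mathrm{tr}(XY)$. $\mathbb{H}^{p,q-1}:=\{o=[\hat o]\in\mathbb{P}(\mathbb{R}^d):\langle\hat o,\hat o\rangle_{p,q}<0\}$. For $o\in\mathbb{H}^{p,q-1}$ let $J^o:=\mathrm{id}_o\oplus(-\mathrm{id}_{o^{\perp_{p,q}}})$, $H^o$ the stabilizer of $o$ in $G$, and $\mathfrak{q}^o:=\{X\in\mathfrak{g}:J^oXJ^o=-X\}$. For $X\in\mathfrak{q}^o$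 put $|X|:=\frac{1}{2(d-2)}\kappa(X,X)$. $X_G$ is the space of $q$-dimensional negative definite subspaces $\tau$ of $\mathbb{R}^d$; $S^o:=\{\tau\in X_G:o\subset\tau\}$. For $\tau\in X_G$, $K^\tau$ is its stabilizer in $G$, $\langle\cdot,\cdot\rangle_\tau$ is the inner product equal to $-\langle\cdot,\cdot\rangle_{p,q}$ on $\tau$, to $\langle\cdot,\cdot\rangle_{p,q}$ on $\tau^{\perp_{p,q}}$ and making these orthogonal, and $\mathfrak{p}^\tau$ is the set of $X\in\mathfrak{g}$ symmetric for $\langle\cdot,\cdot\rangle_\tau$. For $\tau\in S^o$, a maximal subalgebra $\mathfrak{b}\subset\mathfrak{p}^\tau\cap\mathfrak{q}^o$ is abelian and one-dimensional; a closed Weyl chamber $\mathfrak{b}^+$ is a closed half-line of $\mathfrak{b}$ starting at $0$. One has $G=K^\tau\exp(\mathfrak{b}^+)H^o$ with unique $\exp(\mathfrak{b}^+)$-component, and the polar projection $b^\tau:G\to\mathfrak{b}^+$ is defined by $g\in K^\tau\exp(b^\tau(g))H^o$. Anosov representations: fix any inner product on $\mathbb{R}^d$ and let $a_1(g)\ge\dots\ge a_d(g)$ be the logarithms of the singular values of $g\in\mathrm{PSL}(d,\mathbb{R})$; let $|\cdot|_\Gamma$ be the word length for a finite symmetric generating set of $\Gamma$. $\rho:\Gamma\to\mathrm{PSL}(d,\mathbb{R})$ is projective Anosov if there are $C,\alpha>0$ with $a_1(\rho(\gamma))-a_2(\rho(\gamma))\ge\alpha|\gamma|_\Gamma-C$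 for all $\gamma$; it is $P_1^{p,q}$-Anosov if moreover $\rho(\Gamma)\subset G$. Its limit set $\Lambda_{\rho(\Gamma)}$ (contained in the set of isotropic lines) is the closure of the set of attractive fixed lines in $\mathbb{P}(\mathbb{R}^d)$ of proximal elements of $\rho(\Gamma)$, and $\mathbf{\Omega}_\rho:=\{[\hat o]\in\mathbb{H}^{p,q-1}:\langle\hat o,\hat\xi\rangle_{p,q}\ne0\ \forall[\hat\xi]\in\Lambda_{\rho(\Gamma)}\}$. *)

theory Defs
  imports
    "HOL-Analysis.Analysis"
    "HOL-Algebra.Coset"
    "HOL-Algebra.Generated_Groups"
    "HOL-Computational_Algebra.Computational_Algebra"
    "HOL-Library.Multiset"
begin

section \<open>Word hyperbolic groups\<close>

definition sym_generating_set :: "('a, 'm) monoid_scheme \<Rightarrow> 'a set \<Rightarrow> bool" where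
  "sym_generating_set \<Gamma> S \<longleftrightarrow>
     finite S \<and> S \<subseteq> carrier \<Gamma> \<and> (\<forall>s\<in>S. inv\<^bsub>\<Gamma>\<^esub> s \<in> S) \<and> generate \<Gamma> S = carrier \<Gamma>"

definition word_length :: "('a, 'm) monoid_scheme \<Rightarrow> 'a set \<Rightarrow> 'a \<Rightarrow> nat" where
  "word_length \<Gamma> S g =
     (LEAST n. \<exists>w. length w = n \<and> set w \<subseteq> S \<and> foldr (\<lambda>x y. x \<otimes>\<^bsub>\<Gamma>\<^esub> y) w \<one>\<^bsub>\<Gamma>\<^esub> = g)"

definition word_dist :: "('a, 'm) monoid_scheme \<Rightarrow> 'a set \<Rightarrow> 'a \<Rightarrow> 'a \<Rightarrow> real" where
  "word_dist \<Gamma> S x y = real (word_length \<Gamma> S (inv\<^bsub>\<Gamma>\<^esub> x \<otimes>\<^bsub>\<Gamma>\<^esub> y))"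

definition gromov_product :: "('a \<Rightarrow> 'a \<Rightarrow> real) \<Rightarrow> 'a \<Rightarrow> 'a \<Rightarrow> 'a \<Rightarrow> real" where
  "gromov_product d w x y = (d x w + d y w - d x y) / 2"

definition gromov_hyperbolic :: "'a set \<Rightarrow> ('a \<Rightarrow> 'a \<Rightarrow> real) \<Rightarrow> bool" where
  "gromov_hyperbolic M d \<longleftrightarrow> (\<exists>\<delta>\<ge>0. \<forall>w\<in>M. \<forall>x\<in>M. \<forall>y\<in>M. \<forall>z\<in>M.
     gromov_product d w x z \<ge> min (gromov_product d w x y) (gromov_product d w y z) - \<delta>)"

text \<open>Hyperbolicity does not depend on the finite generating set, so one asks for it for some set.\<close>

definition word_hyperbolic :: "('a, 'm) monoid_scheme \<Rightarrow> bool" where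
  "word_hyperbolic \<Gamma> \<longleftrightarrow> group \<Gamma> \<and>
     (\<exists>S. sym_generating_set \<Gamma> S \<and> gromov_hyperbolic (carrier \<Gamma>) (word_dist \<Gamma> S))"

text \<open>Elementary means virtually cyclic; finite groups are included, through the trivial subgroup
  generated by the neutral element.\<close>

definition non_elementary :: "('a, 'm) monoid_scheme \<Rightarrow> bool" where
  "non_elementary \<Gamma> \<longleftrightarrow>
     \<not> (\<exists>a\<in>carrier \<Gamma>. finite (rcosets\<^bsub>\<Gamma>\<^esub> (generate \<Gamma> {a})))"


section \<open>The group PSL and projective space\<close>

text \<open>Products of matrices are written with \<open>**\<close>: the operations \<open>*\<close>, \<open>1\<close> and
  \<open>^\<close> on \<^typ>\<open>real ^ 'n ^ 'n\<close> are componentwise.\<close>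

definition SL :: "(real ^ 'n ^ 'n) monoid" where
  "SL = \<lparr>carrier = {A. det A = 1}, mult = (**), one = mat 1\<rparr>"

definition SL_scalars :: "(real ^ 'n ^ 'n) set" where
  "SL_scalars = {A \<in> carrier SL. \<exists>c. A = mat c}"

definition PSL :: "(real ^ 'n ^ 'n) set monoid" where
  "PSL = SL Mod SL_scalars"

definition proj_class :: "real ^ 'n ^ 'n \<Rightarrow> (real ^ 'n ^ 'n) set" where
  "proj_class A = SL_scalars #>\<^bsub>SL\<^esub> A"

text \<open>Points of projective space are the lines through the origin, as sets of vectors.\<close>

definition proj_space :: "(real ^ 'n) set set" where
  "proj_space = {span {v} | v. v \<noteq> 0}"

text \<open>The quotient topology under \<open>v \<mapsto> span {v}\<close>.\<close>

definition proj_topology :: "(real ^ 'n) set topology" where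
  "proj_topology = topology (\<lambda>U. U \<subseteq> proj_space \<and> open {v. v \<noteq> 0 \<and> span {v} \<in> U})"

lemma openin_proj_topology:
  "openin (proj_topology :: (real ^ 'n) set topology) U \<longleftrightarrow>
     U \<subseteq> proj_space \<and> open {v. v \<noteq> 0 \<and> span {v} \<in> U}"
proof -
  have "istopology (\<lambda>U::(real ^ 'n) set set. U \<subseteq> proj_space \<and> open {v. v \<noteq> 0 \<and> span {v} \<in> U})"
    unfolding istopology_def
  proof (intro conjI allI impI)
    fix S T :: "(real ^ 'n) set set"
    assume S: "S \<subseteq> proj_space \<and> open {v. v \<noteq> 0 \<and> span {v} \<in> S}"
      and T: "T \<subseteq> proj_space \<and> open {v. v \<noteq> 0 \<and> span {v} \<in> T}"
    show "S \<inter> T \<subseteq> proj_space" using S by blast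
    have "{v. v \<noteq> 0 \<and> span {v} \<in> S \<inter> T} =
        {v. v \<noteq> 0 \<and> span {v} \<in> S} \<inter> {v. v \<noteq> 0 \<and> span {v} \<in> T}" by auto
    then show "open {v. v \<noteq> 0 \<and> span {v} \<in> S \<inter> T}" using S T by (simp add: open_Int)
  next
    fix K :: "(real ^ 'n) set set set"
    assume K: "\<forall>U\<in>K. U \<subseteq> proj_space \<and> open {v. v \<noteq> 0 \<and> span {v} \<in> U}"
    show "\<Union>K \<subseteq> proj_space" using K by blast
    have "{v. v \<noteq> 0 \<and> span {v} \<in> \<Union>K} = (\<Union>U\<in>K. {v. v \<noteq> 0 \<and> span {v} \<in> U})" by auto
    then show "open {v. v \<noteq> 0 \<and> span {v} \<in> \<Union>K}" using K by (simp add: open_UN)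
  qed
  then show ?thesis unfolding proj_topology_def by simp
qed

definition charpoly :: "real ^ 'n ^ 'n \<Rightarrow> real poly" where
  "charpoly A = det (\<chi> i j. (if i = j then [:0, 1:] else 0) - [:A $ i $ j:])"

text \<open>\<open>A\<close> is proximal with attractive fixed line \<open>l\<close>: it has a unique complex eigenvalue of maximal
  modulus, which is simple (hence real), and \<open>l\<close> is its eigenline.\<close>

definition attractive_line :: "real ^ 'n ^ 'n \<Rightarrow> (real ^ 'n) set \<Rightarrow> bool" where
  "attractive_line A l \<longleftrightarrow> (\<exists>\<mu>::real.
     Polynomial.order \<mu> (charpoly A) = 1 \<and>
     (\<forall>z::complex. poly (map_poly of_real (charpoly A)) z = 0 \<and> z \<noteq> of_real \<mu> \<longrightarrow> cmod z < \<bar>\<mu>\<bar>) \<and>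
     l = {v. A *v v = \<mu> *\<^sub>R v})"

definition limit_set :: "(real ^ 'n ^ 'n) set set \<Rightarrow> (real ^ 'n) set set" where
  "limit_set D = proj_topology closure_of {l. \<exists>g\<in>D. \<exists>A\<in>g. attractive_line A l}"


section \<open>Anosov representations\<close>

text \<open>Square roots of the eigenvalues of \<open>transpose A ** A\<close>, in decreasing order and repeated
  according to the dimension of the eigenspace; thus the inner product on the space is the standard
  one.\<close>

definition singular_values :: "real ^ 'n ^ 'n \<Rightarrow> real list" where
  "singular_values A =
     (let E = (\<lambda>s. {v. (transpose A ** A) *v v = s\<^sup>2 *\<^sub>R v})
      in rev (sorted_list_of_multiset (\<Sum>s | s \<ge> 0 \<and> E s \<noteq> {0}. replicate_mset (dim (E s)) s)))"

text \<open>The numbers \<open>a\<^sub>1 \<ge> \<dots> \<ge> a\<^sub>d\<close>; the representatives of \<open>g\<close> differ by a sign and have the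
  same singular values.\<close>

definition log_sv :: "nat \<Rightarrow> (real ^ 'n ^ 'n) set \<Rightarrow> real" where
  "log_sv i g = the_elem ((\<lambda>A. ln (singular_values A ! (i - 1))) ` g)"

definition projective_anosov ::
    "('a, 'm) monoid_scheme \<Rightarrow> ('a \<Rightarrow> (real ^ 'n ^ 'n) set) \<Rightarrow> bool" where
  "projective_anosov \<Gamma> \<rho> \<longleftrightarrow> \<rho> \<in> hom \<Gamma> PSL \<and>
     (\<exists>S. sym_generating_set \<Gamma> S \<and> (\<exists>C>0. \<exists>\<alpha>>0. \<forall>\<gamma>\<in>carrier \<Gamma>.
        log_sv 1 (\<rho> \<gamma>) - log_sv 2 (\<rho> \<gamma>) \<ge> \<alpha> * real (word_length \<Gamma> S \<gamma>) - C))"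


section \<open>The group PSO(p,q)\<close>

text \<open>The type \<open>'p + 'q\<close> indexes the coordinates: \<open>p = CARD('p)\<close> of them are positive and
  \<open>q = CARD('q)\<close> negative.\<close>

definition pq_form :: "real ^ ('p::finite + 'q::finite) \<Rightarrow> real ^ ('p + 'q) \<Rightarrow> real" where
  "pq_form x y = (\<Sum>i\<in>UNIV. x $ Inl i * y $ Inl i) - (\<Sum>j\<in>UNIV. x $ Inr j * y $ Inr j)"

definition pq_orth :: "(real ^ ('p::finite + 'q::finite)) set \<Rightarrow> (real ^ ('p + 'q)) set" where
  "pq_orth V = {x. \<forall>y\<in>V. pq_form x y = 0}"

definition PSO :: "(real ^ ('p::finite + 'q::finite) ^ ('p + 'q)) set set" where
  "PSO = proj_class ` {A \<in> carrier SL. \<forall>x y. pq_form (A *v x) (A *v y) = pq_form x y}"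

definition P1_anosov ::
    "('a, 'm) monoid_scheme \<Rightarrow> ('a \<Rightarrow> (real ^ ('p::finite + 'q::finite) ^ ('p + 'q)) set) \<Rightarrow> bool" where
  "P1_anosov \<Gamma> \<rho> \<longleftrightarrow> projective_anosov \<Gamma> \<rho> \<and> \<rho> ` carrier \<Gamma> \<subseteq> PSO"

definition so_pq :: "(real ^ ('p::finite + 'q::finite) ^ ('p + 'q)) set" where
  "so_pq = {X. \<forall>x y. pq_form (X *v x) y + pq_form x (X *v y) = 0}"

definition killing ::
    "real ^ ('p::finite + 'q::finite) ^ ('p + 'q) \<Rightarrow> real ^ ('p + 'q) ^ ('p + 'q) \<Rightarrow> real" where
  "killing X Y = (real CARD('p + 'q) - 2) * trace (X ** Y)"

text \<open>The quantity \<open>|X|\<close>, which is quadratic in \<open>X\<close>.\<close>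

definition q_size :: "real ^ ('p::finite + 'q::finite) ^ ('p + 'q) \<Rightarrow> real" where
  "q_size X = killing X X / (2 * (real CARD('p + 'q) - 2))"

definition stabilizer ::
    "(real ^ ('p::finite + 'q::finite)) set \<Rightarrow> (real ^ ('p + 'q) ^ ('p + 'q)) set set" where
  "stabilizer V = {g \<in> PSO. \<forall>A\<in>g. (*v) A ` V = V}"

definition pseudo_hyperbolic :: "(real ^ ('p::finite + 'q::finite)) set set" where
  "pseudo_hyperbolic = {l \<in> proj_space. \<forall>v\<in>l. v \<noteq> 0 \<longrightarrow> pq_form v v < 0}"

definition Omega ::
    "('a, 'm) monoid_scheme \<Rightarrow> ('a \<Rightarrow> (real ^ ('p::finite + 'q::finite) ^ ('p + 'q)) set)
      \<Rightarrow> (real ^ ('p + 'q)) set set" where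
  "Omega \<Gamma> \<rho> = {l \<in> pseudo_hyperbolic. \<forall>\<xi> \<in> limit_set (\<rho> ` carrier \<Gamma>).
     \<forall>v\<in>l. \<forall>w\<in>\<xi>. v \<noteq> 0 \<and> w \<noteq> 0 \<longrightarrow> pq_form v w \<noteq> 0}"

definition involution ::
    "(real ^ ('p::finite + 'q::finite)) set \<Rightarrow> real ^ ('p + 'q) ^ ('p + 'q)" where
  "involution l = (THE J. (\<forall>x\<in>l. J *v x = x) \<and> (\<forall>x\<in>pq_orth l. J *v x = - x))"

definition q_space ::
    "(real ^ ('p::finite + 'q::finite)) set \<Rightarrow> (real ^ ('p + 'q) ^ ('p + 'q)) set" where
  "q_space l = {X \<in> so_pq. involution l ** X ** involution l = - X}"

definition X_G :: "(real ^ ('p::finite + 'q::finite)) set set" where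
  "X_G = {\<tau>. subspace \<tau> \<and> dim \<tau> = CARD('q) \<and> (\<forall>x\<in>\<tau>. x \<noteq> 0 \<longrightarrow> pq_form x x < 0)}"

definition S_set ::
    "(real ^ ('p::finite + 'q::finite)) set \<Rightarrow> (real ^ ('p + 'q)) set set" where
  "S_set l = {\<tau> \<in> X_G. l \<subseteq> \<tau>}"

definition tau_inner ::
    "(real ^ ('p::finite + 'q::finite)) set \<Rightarrow> real ^ ('p + 'q) \<Rightarrow> real ^ ('p + 'q) \<Rightarrow> real" where
  "tau_inner \<tau> = (THE B. bilinear B \<and>
     (\<forall>x\<in>\<tau>. \<forall>y\<in>\<tau>. B x y = - pq_form x y) \<and>
     (\<forall>x\<in>pq_orth \<tau>. \<forall>y\<in>pq_orth \<tau>. B x y = pq_form x y) \<and>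
     (\<forall>x\<in>\<tau>. \<forall>y\<in>pq_orth \<tau>. B x y = 0 \<and> B y x = 0))"

definition p_space ::
    "(real ^ ('p::finite + 'q::finite)) set \<Rightarrow> (real ^ ('p + 'q) ^ ('p + 'q)) set" where
  "p_space \<tau> = {X \<in> so_pq. \<forall>x y. tau_inner \<tau> (X *v x) y = tau_inner \<tau> x (X *v y)}"


section \<open>Polar projections\<close>

definition lie_subalgebra :: "(real ^ 'n ^ 'n) set \<Rightarrow> bool" where
  "lie_subalgebra \<bb> \<longleftrightarrow> subspace \<bb> \<and> (\<forall>X\<in>\<bb>. \<forall>Y\<in>\<bb>. X ** Y - Y ** X \<in> \<bb>)"

definition maximal_subalgebra_in :: "(real ^ 'n ^ 'n) set \<Rightarrow> (real ^ 'n ^ 'n) set \<Rightarrow> bool" where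
  "maximal_subalgebra_in V \<bb> \<longleftrightarrow> lie_subalgebra \<bb> \<and> \<bb> \<subseteq> V \<and>
     (\<forall>\<cc>. lie_subalgebra \<cc> \<and> \<cc> \<subseteq> V \<and> \<bb> \<subseteq> \<cc> \<longrightarrow> \<cc> = \<bb>)"

definition closed_weyl_chamber :: "(real ^ 'n ^ 'n) set \<Rightarrow> (real ^ 'n ^ 'n) set \<Rightarrow> bool" where
  "closed_weyl_chamber \<bb> \<bb>p \<longleftrightarrow> (\<exists>X\<in>\<bb>. X \<noteq> 0 \<and> \<bb>p = {t *\<^sub>R X | t. t \<ge> 0})"

definition matrix_exp :: "real ^ 'n ^ 'n \<Rightarrow> real ^ 'n ^ 'n" where
  "matrix_exp X = (\<Sum>n. (1 / fact n) *\<^sub>R (((**) X ^^ n) (mat 1)))"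

definition polar_projection ::
    "(real ^ ('p::finite + 'q::finite)) set \<Rightarrow> (real ^ ('p + 'q)) set
      \<Rightarrow> (real ^ ('p + 'q) ^ ('p + 'q)) set
      \<Rightarrow> (real ^ ('p + 'q) ^ ('p + 'q)) set \<Rightarrow> real ^ ('p + 'q) ^ ('p + 'q)" where
  "polar_projection l \<tau> \<bb>p g = (THE X. X \<in> \<bb>p \<and>
     (\<exists>k\<in>stabilizer \<tau>. \<exists>h\<in>stabilizer l.
        g = k \<otimes>\<^bsub>PSL\<^esub> proj_class (matrix_exp X) \<otimes>\<^bsub>PSL\<^esub> h))"

end

theory Submission
  imports Defs
begin

text \<open>For \<open>g\<close> in the group, \<open>cosh (2 r)\<close> with \<open>r = |b\<^sup>\<tau>(g)|\<^sup>1\<^sup>/\<^sup>2\<close> is the value of the \<open>\<tau>\<close>-norm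
  squared at \<open>g e\<close>, where \<open>e\<close> is a unit vector of \<open>o\<close>. So the claim is that only finitely many
  \<open>\<rho>(\<gamma>) e\<close> lie in a given ball. If \<open>\<rho>(\<gamma>) e\<close> stays bounded while \<open>\<gamma>\<close> leaves every finite set, then,
  \<open>\<rho>(\<gamma>)\<close> being an isometry of the form and close to rank one after normalisation, the top left
  singular direction \<open>U\<close> of \<open>\<rho>(\<gamma>\<^sup>-\<^sup>1)\<close> becomes orthogonal to \<open>e\<close>. It remains to see that \<open>U\<close>
  accumulates on the limit set, which contradicts \<open>o \<in> \<Omega>\<close>.

  Along a geodesic word the singular directions of prefixes and suffixes converge exponentially
  fast. In every window of bounded length there is a cut at which the expanding direction of the
  suffix is uniformly transverse to the contracted hyperplane of the prefix: otherwise norms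
  of aligned dyadic blocks would lose a definite exponential factor at every scale, so that a block
  would have norm less than 1. By the pigeonhole principle two such cuts in the second half of the
  word bound a proximal factor \<open>s\<close>; if \<open>x\<close> is the prefix before it, the attractive line of
  \<open>x s x\<^sup>-\<^sup>1\<close> is exponentially close to \<open>U\<close>.\<close>

unbundle no fps_syntax

section \<open>Attractive lines\<close>

text \<open>The limit set consists of attractive lines and their limits, so a limit of singular
  directions lies in it only once proximal elements have been produced; hence the search for cuts. A
  long factor \<open>s\<close> is proximal when its expanding direction is transverse to its own
  contracted hyperplane, whereas a cut gives transversality between a prefix and a suffix. Two cuts
  whose prefixes have nearly the same contracted hyperplane turn the one into the other.

  The dyadic loss wins because a window of length \<open>2 ^ k\<close> contains
  \<open>2 ^ (k - j)\<close> blocks of length \<open>2 ^ j\<close>, each losing a factor of order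
  \<open>q ^ (2 ^ (j - 1))\<close>: every scale contributes \<open>q ^ (2 ^ (k - 1))\<close> in
  total, and \<open>k\<close> such factors beat a fixed constant to the power \<open>2 ^ k\<close>
  once \<open>k\<close> is large.

  The lower bound 1 for norms comes from the form: the inverse of an isometry is conjugate to its
  transpose by the signature matrix, hence has the same norm. For the same reason a large gap forces
  a large norm, and this makes \<open>U\<close> nearly orthogonal to \<open>e\<close>.\<close>

lemma ring_hom_det:
  fixes h :: "'a::comm_ring_1 \<Rightarrow> 'b::comm_ring_1" and M :: "'a^'n^'n"
  assumes add: "\<And>x y. h (x + y) = h x + h y" and mult: "\<And>x y. h (x * y) = h x * h y"
    and one: "h 1 = 1"
  shows "h (det M) = det (\<chi> i j. h (M $ i $ j))"
proof -
  have zero: "h 0 = 0" using add[of 0 0] by simp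
  have minus: "h (- x) = - h x" for x
    using add[of x "- x"] zero by (simp add: eq_neg_iff_add_eq_0 add.commute)
  have sum: "h (sum f A) = (\<Sum>x\<in>A. h (f x))" for f and A :: "('n \<Rightarrow> 'n) set"
    by (induction A rule: infinite_finite_induct) (simp_all add: zero add)
  have prod: "h (prod f A) = (\<Prod>x\<in>A. h (f x))" for f and A :: "'n set"
    by (induction A rule: infinite_finite_induct) (simp_all add: one mult)
  have sign: "h (of_int (sign \<pi>)) = of_int (sign \<pi>)" for \<pi> :: "'n \<Rightarrow> 'n"
    by (cases "evenperm \<pi>") (simp_all add: sign_def one minus)
  show ?thesis unfolding det_def by (simp add: sum mult sign prod)
qed

lemma mat_mult_vector: "mat c *v x = c *\<^sub>R x" for x :: "real^'n"
  by (simp add: vec_eq_iff mat_def matrix_vector_mult_def if_distrib[of "\<lambda>y. y * _"] cong: if_cong)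

lemma poly_charpoly: "poly (charpoly A) x = det (mat x - A)" for A :: "real^'n^'n"
proof -
  have "poly (charpoly A) x =
      det (\<chi> i j. poly (((\<chi> i j. (if i = j then [:0, 1:] else 0) - [:A $ i $ j:]) :: real poly^'n^'n) $ i $ j) x)"
    unfolding charpoly_def by (rule ring_hom_det[where h = "\<lambda>p. poly p x"]) simp_all
  also have "(\<chi> i j. poly (((\<chi> i j. (if i = j then [:0, 1:] else 0) - [:A $ i $ j:]) :: real poly^'n^'n) $ i $ j) x)
      = mat x - A"
    by (simp add: vec_eq_iff mat_def)
  finally show ?thesis .
qed

lemma poly_map_poly_of_real_charpoly:
  "poly (map_poly of_real (charpoly A)) z = det (mat z - (\<chi> i j. complex_of_real (A $ i $ j)))"
  for A :: "real^'n^'n"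
proof -
  let ?h = "\<lambda>p. poly (map_poly complex_of_real p) z"
  have "?h (charpoly A) =
      det (\<chi> i j. ?h (((\<chi> i j. (if i = j then [:0, 1:] else 0) - [:A $ i $ j:]) :: real poly^'n^'n) $ i $ j))"
    unfolding charpoly_def
  proof (rule ring_hom_det)
    fix p r :: "real poly"
    have "map_poly complex_of_real (p + r) = map_poly of_real p + map_poly of_real r"
      by (rule poly_eqI) (simp add: coeff_map_poly)
    then show "?h (p + r) = ?h p + ?h r" by simp
    have "map_poly complex_of_real (p * r) = map_poly of_real p * map_poly of_real r"
      by (rule poly_eqI) (simp add: coeff_map_poly coeff_mult)
    then show "?h (p * r) = ?h p * ?h r" by simp
  qed simp
  also have "(\<chi> i j. ?h (((\<chi> i j. (if i = j then [:0, 1:] else 0) - [:A $ i $ j:]) :: real poly^'n^'n) $ i $ j))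
      = mat z - (\<chi> i j. complex_of_real (A $ i $ j))"
    by (simp add: vec_eq_iff mat_def map_poly_pCons)
  finally show ?thesis .
qed

lemma det_eq_0_kernel:
  fixes A :: "'a::field^'n^'n"
  assumes "det A = 0"
  obtains x where "x \<noteq> 0" "A *v x = 0"
proof -
  have "\<not> (\<exists>B. B ** A = mat 1)"
    using assms invertible_det_nz invertible_left_inverse by blast
  then show thesis
    using that matrix_left_invertible_ker by blast
qed

text \<open>Replacing the \<open>k\<close>-th row of \<open>x - A\<close> by its combination with coefficients \<open>\<phi>\<close>, a left
  eigenvector, splits off the factor \<open>x - \<mu>\<close>; the remaining determinant does not vanish at \<open>\<mu>\<close>.\<close>

lemma order_charpoly_eq_1:
  fixes A :: "real^'n^'n"
  assumes left: "\<And>x. \<phi> \<bullet> (A *v x) = \<mu> * (\<phi> \<bullet> x)" and "\<phi> \<noteq> 0"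
    and ker: "\<And>x. \<phi> \<bullet> x = 0 \<Longrightarrow> A *v x = \<mu> *\<^sub>R x \<Longrightarrow> x = 0"
  shows "Polynomial.order \<mu> (charpoly A) = 1"
proof -
  obtain k where k: "\<phi> $ k \<noteq> 0" using \<open>\<phi> \<noteq> 0\<close> by (metis vec_eq_iff zero_index)
  define D :: "real poly" where
    "D = det (\<chi> i j. if i = k then [:\<phi> $ j:] else (if i = j then [:0, 1:] else 0) - [:A $ i $ j:])"
  have polyD: "poly D x = det (\<chi> i. if i = k then \<phi> else row i (mat x - A))" for x
  proof -
    have "poly D x = det (\<chi> i j. poly (((\<chi> i j. if i = k then [:\<phi> $ j:] else
        (if i = j then [:0, 1:] else 0) - [:A $ i $ j:]) :: real poly^'n^'n) $ i $ j) x)"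
      unfolding D_def by (rule ring_hom_det[where h = "\<lambda>p. poly p x"]) simp_all
    also have "(\<chi> i j. poly (((\<chi> i j. if i = k then [:\<phi> $ j:] else
        (if i = j then [:0, 1:] else 0) - [:A $ i $ j:]) :: real poly^'n^'n) $ i $ j) x) =
        (\<chi> i. if i = k then \<phi> else row i (mat x - A))"
      by (simp add: vec_eq_iff mat_def row_def)
    finally show ?thesis .
  qed
  have comb: "(\<Sum>i\<in>UNIV. \<phi> $ i *s row i (mat x - A)) = (x - \<mu>) *s \<phi>" for x
  proof -
    have "(\<Sum>i\<in>UNIV. \<phi> $ i *s row i (mat x - A)) $ j = ((x - \<mu>) *s \<phi>) $ j" for j
    proof -
      have "\<phi> \<bullet> (A *v axis j 1) = \<mu> * (\<phi> \<bullet> axis j 1)" by (rule left)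
      then have "(\<Sum>i\<in>UNIV. \<phi> $ i * A $ i $ j) = \<mu> * \<phi> $ j"
        by (simp add: inner_axis matrix_vector_mult_basis) (simp add: inner_vec_def column_def)
      then show ?thesis
        by (simp add: row_def mat_def right_diff_distrib sum_subtractf left_diff_distrib
            if_distrib[of "\<lambda>y. _ * y"] cong: if_cong)
    qed
    then show ?thesis by (simp add: vec_eq_iff)
  qed
  have "\<phi> $ k * poly (charpoly A) x = (x - \<mu>) * poly D x" for x
  proof -
    have "\<phi> $ k * det (mat x - A) =
        det (\<chi> i. if i = k then (\<Sum>i\<in>UNIV. \<phi> $ i *s row i (mat x - A)) else row i (mat x - A))"
      by (rule cramer_lemma_transpose[symmetric])
    also have "\<dots> = (x - \<mu>) * poly D x"
      unfolding comb polyD by (rule det_row_mul)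
    finally show ?thesis by (simp add: poly_charpoly)
  qed
  then have "poly (smult (\<phi> $ k) (charpoly A)) = poly ([:- \<mu>, 1:] * D)"
    by (auto simp: fun_eq_iff algebra_simps)
  then have eq: "smult (\<phi> $ k) (charpoly A) = [:- \<mu>, 1:] * D" by (simp only: poly_eq_poly_eq_iff)
  have D\<mu>: "poly D \<mu> \<noteq> 0"
  proof
    assume "poly D \<mu> = 0"
    then obtain y where y: "y \<noteq> 0" "(\<chi> i. if i = k then \<phi> else row i (mat \<mu> - A)) *v y = 0"
      unfolding polyD by (rule det_eq_0_kernel)
    have rows: "(if i = k then \<phi> else row i (mat \<mu> - A)) \<bullet> y = 0" for i
    proof -
      have "((\<chi> i. if i = k then \<phi> else row i (mat \<mu> - A)) *v y) $ i = 0" using y by simp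
      then show ?thesis by (simp add: matrix_vector_mul_component)
    qed
    have \<phi>y: "\<phi> \<bullet> y = 0" using rows[of k] by simp
    have other: "((mat \<mu> - A) *v y) $ i = 0" if "i \<noteq> k" for i
      using rows[of i] that by (simp add: matrix_vector_mul_component row_def inner_vec_def)
    \<comment> \<open>Row \<open>k\<close> of \<open>mat \<mu> - A\<close> was overwritten. The left
      eigenvector gives a linear relation among the original rows whose coefficient at
      \<open>k\<close> is nonzero, and this recovers the missing row.\<close>
    have "\<phi> \<bullet> ((mat \<mu> - A) *v y) = 0"
      using left[of y] \<phi>y by (simp add: matrix_vector_mult_diff_rdistrib inner_diff_right mat_mult_vector)
    moreover have "\<phi> \<bullet> ((mat \<mu> - A) *v y) = \<phi> $ k * ((mat \<mu> - A) *v y) $ k"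
      unfolding inner_vec_def by (subst sum.remove[of _ k]) (auto intro!: sum.neutral simp: other)
    ultimately have "((mat \<mu> - A) *v y) $ k = 0" using k by simp
    with other have "(mat \<mu> - A) *v y = 0" by (metis vec_eq_iff zero_index)
    then have "A *v y = \<mu> *\<^sub>R y" by (simp add: matrix_vector_mult_diff_rdistrib mat_mult_vector)
    with ker \<phi>y y show False by blast
  qed
  then have "D \<noteq> 0" by auto
  have "Polynomial.order \<mu> ([:- \<mu>, 1:] * D) = Polynomial.order \<mu> [:- \<mu>, 1:] + Polynomial.order \<mu> D"
    using \<open>D \<noteq> 0\<close> by (intro order_mult) (metis mult_eq_0_iff one_neq_zero pCons_eq_0_iff)
  also have "Polynomial.order \<mu> D = 0" using D\<mu> by (simp add: order_0I)
  also have "Polynomial.order \<mu> [:- \<mu>, 1:] = 1" using order_power_n_n[of \<mu> 1] by simp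
  finally show ?thesis using eq k order_smult by (metis add.right_neutral)
qed

text \<open>The eigenvector \<open>w\<close> and the left eigenvector \<open>\<phi>\<close> belong to \<open>\<mu>\<close>; a complex eigenvector
  \<open>a + i b\<close> in the kernel of \<open>\<phi>\<close> with eigenvalue \<open>x + i y\<close> is written through its real and
  imaginary parts.\<close>

definition dominant_eigenpair :: "real^'n^'n \<Rightarrow> real^'n \<Rightarrow> real^'n \<Rightarrow> bool" where
  "dominant_eigenpair A w \<phi> \<longleftrightarrow> \<phi> \<bullet> w \<noteq> 0 \<and> (\<exists>\<mu>. A *v w = \<mu> *\<^sub>R w \<and>
     (\<forall>x. \<phi> \<bullet> (A *v x) = \<mu> * (\<phi> \<bullet> x)) \<and>
     (\<forall>a b x y. \<phi> \<bullet> a = 0 \<longrightarrow> \<phi> \<bullet> b = 0 \<longrightarrow> A *v a = x *\<^sub>R a - y *\<^sub>R b \<longrightarrow> A *v b = x *\<^sub>R b + y *\<^sub>R a \<longrightarrow>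
        a \<noteq> 0 \<or> b \<noteq> 0 \<longrightarrow> x\<^sup>2 + y\<^sup>2 < \<mu>\<^sup>2))"

text \<open>On an eigenvector for \<open>z\<close>, the functional \<phi> is multiplied both by
  \<open>z\<close> and by \<mu>, so it vanishes unless the two agree. Every other complex
  eigenvector therefore lies in the kernel of \<phi>, where the moduli are bounded by
  assumption.\<close>

lemma attractive_line_dominant_eigenpair:
  fixes A :: "real^'n^'n"
  assumes "dominant_eigenpair A w \<phi>"
  shows "attractive_line A (span {w})"
proof -
  from assms obtain \<mu> where \<phi>w: "\<phi> \<bullet> w \<noteq> 0" and w: "A *v w = \<mu> *\<^sub>R w"
    and left: "\<And>x. \<phi> \<bullet> (A *v x) = \<mu> * (\<phi> \<bullet> x)"
    and small: "\<And>a b x y. \<lbrakk>\<phi> \<bullet> a = 0; \<phi> \<bullet> b = 0; A *v a = x *\<^sub>R a - y *\<^sub>R b; A *v b = x *\<^sub>R b + y *\<^sub>R a;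
        a \<noteq> 0 \<or> b \<noteq> 0\<rbrakk> \<Longrightarrow> x\<^sup>2 + y\<^sup>2 < \<mu>\<^sup>2"
    unfolding dominant_eigenpair_def by blast
  have ker: "x = 0" if "\<phi> \<bullet> x = 0" "A *v x = \<mu> *\<^sub>R x" for x
    using small[of x 0 \<mu> 0] that by auto
  have "Polynomial.order \<mu> (charpoly A) = 1"
    by (rule order_charpoly_eq_1[OF left _ ker]) (use \<phi>w in auto)
  moreover have "cmod z < \<bar>\<mu>\<bar>"
    if z: "poly (map_poly of_real (charpoly A)) z = 0" "z \<noteq> of_real \<mu>" for z
  proof -
    obtain c where c: "c \<noteq> 0" "(mat z - (\<chi> i j. complex_of_real (A $ i $ j))) *v c = 0"
      using z(1) unfolding poly_map_poly_of_real_charpoly by (rule det_eq_0_kernel)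
    define a b where "a = (\<chi> i. Re (c $ i))" and "b = (\<chi> i. Im (c $ i))"
    have "(\<Sum>j\<in>UNIV. complex_of_real (A $ i $ j) * c $ j) = z * c $ i" for i
    proof -
      have "((mat z - (\<chi> i j. complex_of_real (A $ i $ j))) *v c) $ i = 0" using c by simp
      then show ?thesis
        by (simp add: matrix_vector_mult_def mat_def left_diff_distrib sum_subtractf
            if_distrib[of "\<lambda>y. y * _"] cong: if_cong)
    qed
    note ev = this
    have Aa: "A *v a = Re z *\<^sub>R a - Im z *\<^sub>R b"
      using arg_cong[OF ev, of Re] by (simp add: vec_eq_iff matrix_vector_mult_def a_def b_def)
    have Ab: "A *v b = Re z *\<^sub>R b + Im z *\<^sub>R a"
      using arg_cong[OF ev, of Im] by (simp add: vec_eq_iff matrix_vector_mult_def a_def b_def)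
    have "Re z * (\<phi> \<bullet> a) - Im z * (\<phi> \<bullet> b) = \<mu> * (\<phi> \<bullet> a)"
      "Re z * (\<phi> \<bullet> b) + Im z * (\<phi> \<bullet> a) = \<mu> * (\<phi> \<bullet> b)"
      using left[of a] left[of b] by (simp_all add: Aa Ab inner_diff_right inner_add_right)
    then have "(z - of_real \<mu>) * Complex (\<phi> \<bullet> a) (\<phi> \<bullet> b) = 0"
      by (simp add: complex_eq_iff algebra_simps)
    then have "Complex (\<phi> \<bullet> a) (\<phi> \<bullet> b) = 0" using z(2) by simp
    then have "\<phi> \<bullet> a = 0" "\<phi> \<bullet> b = 0" by (simp_all add: complex_eq_iff)
    moreover have "a \<noteq> 0 \<or> b \<noteq> 0"
      using c(1) by (auto simp: a_def b_def vec_eq_iff complex_eq_iff)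
    ultimately have "(Re z)\<^sup>2 + (Im z)\<^sup>2 < \<mu>\<^sup>2" using small Aa Ab by blast
    then have "(cmod z)\<^sup>2 < \<bar>\<mu>\<bar>\<^sup>2" by (simp add: cmod_power2)
    then show ?thesis by (rule power2_less_imp_less) simp
  qed
  moreover have "span {w} = {v. A *v v = \<mu> *\<^sub>R v}"
  proof (intro equalityI subsetI CollectI)
    fix v assume "v \<in> span {w}"
    then obtain t where "v = t *\<^sub>R w" by (auto simp: span_singleton)
    then show "A *v v = \<mu> *\<^sub>R v" using w by (simp add: matrix_vector_mult_scaleR)
  next
    fix v assume "v \<in> {v. A *v v = \<mu> *\<^sub>R v}"
    then have v: "A *v v = \<mu> *\<^sub>R v" by simp
    \<comment> \<open>Subtracting the multiple of \<open>w\<close> with the same value of \<phi>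
      moves the eigenvector into the kernel of \<phi>, where \<mu> is not an eigenvalue.\<close>
    define t where "t = (\<phi> \<bullet> v) / (\<phi> \<bullet> w)"
    have "v - t *\<^sub>R w = 0"
      by (rule ker) (use \<phi>w v w in \<open>simp_all add: t_def inner_diff_right matrix_vector_mult_diff_distrib
        matrix_vector_mult_scaleR scaleR_diff_right\<close>)
    then have "v = t *\<^sub>R w" by simp
    then show "v \<in> span {w}" by (simp add: span_base span_scale)
  qed
  ultimately show ?thesis unfolding attractive_line_def by blast
qed

text \<open>The left eigenvector is moved by the transposed inverse; this keeps its pairing with the
  moved eigenvector and carries kernel to kernel, so the comparison of eigenvalues is the one for
  \<open>A\<close>.\<close>

lemma dominant_eigenpair_conj:
  fixes A P Q :: "real^'n^'n"
  assumes dom: "dominant_eigenpair A w \<phi>" and PQ: "P ** Q = mat 1" and QP: "Q ** P = mat 1"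
  shows "dominant_eigenpair (P ** A ** Q) (P *v w) (transpose Q *v \<phi>)"
proof -
  from dom obtain \<mu> where \<phi>w: "\<phi> \<bullet> w \<noteq> 0" and w: "A *v w = \<mu> *\<^sub>R w"
    and left: "\<And>x. \<phi> \<bullet> (A *v x) = \<mu> * (\<phi> \<bullet> x)"
    and small: "\<And>a b x y. \<lbrakk>\<phi> \<bullet> a = 0; \<phi> \<bullet> b = 0; A *v a = x *\<^sub>R a - y *\<^sub>R b; A *v b = x *\<^sub>R b + y *\<^sub>R a;
        a \<noteq> 0 \<or> b \<noteq> 0\<rbrakk> \<Longrightarrow> x\<^sup>2 + y\<^sup>2 < \<mu>\<^sup>2"
    unfolding dominant_eigenpair_def by blast
  have QPx: "Q *v (P *v x) = x" and PQx: "P *v (Q *v x) = x" for x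
    by (simp_all add: matrix_vector_mul_assoc PQ QP)
  have conj: "(P ** A ** Q) *v x = P *v (A *v (Q *v x))" for x
    by (simp add: matrix_vector_mul_assoc matrix_mul_assoc)
  have tr: "(transpose Q *v \<phi>) \<bullet> x = \<phi> \<bullet> (Q *v x)" for x
    by (simp add: dot_lmul_matrix[symmetric])
  show ?thesis unfolding dominant_eigenpair_def tr
  proof (intro conjI exI[of _ \<mu>] allI impI)
    show "\<phi> \<bullet> (Q *v (P *v w)) \<noteq> 0" using \<phi>w by (simp add: QPx)
    show "(P ** A ** Q) *v (P *v w) = \<mu> *\<^sub>R (P *v w)"
      by (simp add: conj QPx w matrix_vector_mult_scaleR)
    show "\<phi> \<bullet> (Q *v ((P ** A ** Q) *v x)) = \<mu> * (\<phi> \<bullet> (Q *v x))" for x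
      by (simp add: conj QPx left)
    fix a b x y
    assume h: "\<phi> \<bullet> (Q *v a) = 0" "\<phi> \<bullet> (Q *v b) = 0" "(P ** A ** Q) *v a = x *\<^sub>R a - y *\<^sub>R b"
      "(P ** A ** Q) *v b = x *\<^sub>R b + y *\<^sub>R a" "a \<noteq> 0 \<or> b \<noteq> 0"
    have "Q *v a \<noteq> 0 \<or> Q *v b \<noteq> 0" using h(5) PQx by (metis matrix_vector_mult_0_right)
    moreover have "A *v (Q *v a) = x *\<^sub>R (Q *v a) - y *\<^sub>R (Q *v b)"
      using arg_cong[OF h(3), of "(*v) Q"]
      by (simp add: conj QPx matrix_vector_mult_scaleR matrix_vector_mult_diff_distrib)
    moreover have "A *v (Q *v b) = x *\<^sub>R (Q *v b) + y *\<^sub>R (Q *v a)"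
      using arg_cong[OF h(4), of "(*v) Q"]
      by (simp add: conj QPx matrix_vector_mult_scaleR matrix_vector_right_distrib)
    ultimately show "x\<^sup>2 + y\<^sup>2 < \<mu>\<^sup>2" using small h(1,2) by blast
  qed
qed

section \<open>Eigenvectors of matrices close to rank one\<close>

lemma rank_one_approx_transpose:
  fixes A :: "real^'n^'n"
  assumes "\<And>x. norm (A *v x - (s * (v \<bullet> x)) *\<^sub>R u) \<le> e * norm x"
  shows "norm (transpose A *v y - (s * (u \<bullet> y)) *\<^sub>R v) \<le> e * norm y"
proof -
  define z where "z = transpose A *v y - (s * (u \<bullet> y)) *\<^sub>R v"
  have "norm z * norm z = z \<bullet> z" by (simp add: norm_eq_sqrt_inner)
  \<comment> \<open>The error of the transpose is the adjoint of the error of \<open>A\<close>, so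
    pairing it with itself yields the same bound.\<close>
  also have "\<dots> = (A *v z - (s * (v \<bullet> z)) *\<^sub>R u) \<bullet> y"
    unfolding z_def by (simp add: inner_diff_left inner_diff_right dot_lmul_matrix[symmetric] inner_commute
      matrix_vector_mult_diff_distrib) (simp add: algebra_simps)
  also have "\<dots> \<le> norm (A *v z - (s * (v \<bullet> z)) *\<^sub>R u) * norm y" by (rule norm_cauchy_schwarz)
  also have "\<dots> \<le> (e * norm z) * norm y" by (intro mult_right_mono assms) simp
  finally have *: "norm z * norm z \<le> (e * norm y) * norm z" by (simp add: ac_simps)
  show ?thesis
  proof (cases "z = 0")
    case True
    \<comment> \<open>The sign of \<open>e\<close> is not assumed; the approximation forces it as
      soon as there is a nonzero vector.\<close>
    have "0 \<le> e * norm v" if "norm v \<noteq> 0" for v :: "real^'n"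
      using order_trans[OF norm_ge_zero assms[of v]] .
    then have "0 \<le> e * norm y" by (cases "norm y = 0") auto
    then show ?thesis using True z_def by simp
  next
    case False
    then show ?thesis using * unfolding z_def[symmetric] by simp
  qed
qed

text \<open>A fixed point of \<open>f x = A x / (s (v . x))\<close> is an eigenvector. On the ball
  of radius \<open>4 * e / c\<close> around \<open>u\<close> one has \<open>norm x \<le> 2\<close>
  and \<open>\<bar>v \<bullet> x\<bar> \<ge> c / 2\<close>, so \<open>f x\<close> differs from
  \<open>u\<close> by at most \<open>e * 2 / (c / 2)\<close>, which is that radius; Brouwer's
  theorem applies and no contraction estimate is required.\<close>

lemma rank_one_approx_eigenvector:
  fixes A :: "real^'n^'n"
  assumes u: "norm u = 1" and v: "norm v = 1" and s: "s > 0"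
    and approx: "\<And>x. norm (A *v x - (s * (v \<bullet> x)) *\<^sub>R u) \<le> (s * e) * norm x"
    and c: "0 < c" "c \<le> \<bar>v \<bullet> u\<bar>" and e: "0 \<le> e" "e \<le> c\<^sup>2 / 16"
  obtains w where "norm (w - u) \<le> 4 * e / c" "A *v w = (s * (v \<bullet> w)) *\<^sub>R w"
proof -
  define r where "r = 4 * e / c"
  have "\<bar>v \<bullet> u\<bar> \<le> 1" using Cauchy_Schwarz_ineq2[of v u] u v by simp
  then have c1: "c \<le> 1" using c by linarith
  have r: "0 \<le> r" "r \<le> c / 4" using c e by (simp_all add: r_def field_simps power2_eq_square)
  define f where "f x = inverse (s * (v \<bullet> x)) *\<^sub>R (A *v x)" for x
  have vx: "\<bar>v \<bullet> x\<bar> \<ge> c / 2" if "x \<in> cball u r" for x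
  proof -
    have "\<bar>v \<bullet> (x - u)\<bar> \<le> r" using Cauchy_Schwarz_ineq2[of v "x - u"] that v
      by (simp add: dist_norm norm_minus_commute)
    then show ?thesis using c r by (simp add: inner_diff_right)
  qed
  have maps: "f \<in> cball u r \<rightarrow> cball u r"
  proof
    fix x assume x: "x \<in> cball u r"
    have "norm x \<le> norm u + norm (x - u)" using norm_triangle_sub[of x u] by simp
    then have nx: "norm x \<le> 2" using x r c1 u by (simp add: dist_norm norm_minus_commute)
    have pos: "\<bar>v \<bullet> x\<bar> > 0" using vx[OF x] c by linarith
    have "f x - u = inverse (s * (v \<bullet> x)) *\<^sub>R (A *v x - (s * (v \<bullet> x)) *\<^sub>R u)"
      using pos s by (simp add: f_def scaleR_diff_right field_simps)
    then have "norm (f x - u) = norm (A *v x - (s * (v \<bullet> x)) *\<^sub>R u) / (s * \<bar>v \<bullet> x\<bar>)"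
      using s by (simp add: abs_mult divide_inverse_commute)
    also have "\<dots> \<le> (s * e * norm x) / (s * \<bar>v \<bullet> x\<bar>)"
      using s pos by (intro divide_right_mono approx) simp
    also have "\<dots> = e * norm x / \<bar>v \<bullet> x\<bar>" using s by simp
    also have "\<dots> \<le> e * 2 / (c / 2)"
      using vx[OF x] c e nx by (intro frac_le mult_mono) auto
    finally show "f x \<in> cball u r" by (simp add: r_def dist_norm norm_minus_commute)
  qed
  have cont: "continuous_on (cball u r) f"
    unfolding f_def using vx s c
    by (intro continuous_intros) (force simp del: mem_cball)
  obtain w where w: "w \<in> cball u r" "f w = w"
    using brouwer[OF compact_cball convex_cball _ cont maps] r by auto
  have "s * (v \<bullet> w) \<noteq> 0" using vx[OF w(1)] c s by auto
  then have "A *v w = (s * (v \<bullet> w)) *\<^sub>R f w" by (simp add: f_def field_simps)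
  then show thesis using that w by (simp add: r_def dist_norm norm_minus_commute)
qed

text \<open>The same fixed point argument for the transpose gives a left eigenvector \<phi> within
  \<open>r\<close> of \<open>v\<close>. On its kernel \<open>\<bar>v \<bullet> y\<bar>\<close> is at
  most \<open>r * norm y\<close>, so \<open>A\<close> has norm at most \<open>s * (r + e)\<close>
  there, while the eigenvalue has modulus at least \<open>s * (c - r)\<close>.\<close>

lemma rank_one_approx_dominant:
  fixes A :: "real^'n^'n"
  assumes u: "norm u = 1" and v: "norm v = 1" and s: "s > 0"
    and approx: "\<And>x. norm (A *v x - (s * (v \<bullet> x)) *\<^sub>R u) \<le> (s * e) * norm x"
    and c: "0 < c" "c \<le> \<bar>v \<bullet> u\<bar>" and e: "0 \<le> e" "e \<le> c\<^sup>2 / 16"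
  obtains w \<phi> where "dominant_eigenpair A w \<phi>" "norm (w - u) \<le> 4 * e / c"
proof -
  define r where "r = 4 * e / c"
  have "\<bar>v \<bullet> u\<bar> \<le> 1" using Cauchy_Schwarz_ineq2[of v u] u v by simp
  then have c1: "c \<le> 1" using c by linarith
  have r: "0 \<le> r" "r \<le> c / 4" using c e by (simp_all add: r_def field_simps power2_eq_square)
  have "c\<^sup>2 \<le> c" using c c1 by (simp add: power2_eq_square mult_left_le)
  then have ec: "e \<le> c / 16" using e by simp
  obtain w where w: "norm (w - u) \<le> r" "A *v w = (s * (v \<bullet> w)) *\<^sub>R w"
    using rank_one_approx_eigenvector[OF assms] r_def by metis
  have c': "c \<le> \<bar>u \<bullet> v\<bar>" using c by (simp add: inner_commute)
  obtain \<phi> where \<phi>: "norm (\<phi> - v) \<le> r" "transpose A *v \<phi> = (s * (u \<bullet> \<phi>)) *\<^sub>R \<phi>"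
    using rank_one_approx_eigenvector[OF v u s rank_one_approx_transpose[OF approx] c(1) c' e] r_def by metis
  have left0: "\<phi> \<bullet> (A *v x) = (s * (u \<bullet> \<phi>)) * (\<phi> \<bullet> x)" for x
  proof -
    have "\<phi> \<bullet> (A *v x) = (transpose A *v \<phi>) \<bullet> x" by (simp add: dot_lmul_matrix[symmetric])
    then show ?thesis using \<phi> by simp
  qed
  have "norm w \<le> 1 + r" using norm_triangle_sub[of w u] w u by simp
  then have nw: "norm w \<le> 2" using r c1 by simp
  have "\<bar>(\<phi> - v) \<bullet> w\<bar> \<le> r * 2"
    using Cauchy_Schwarz_ineq2[of "\<phi> - v" w] \<phi>(1) nw r by (meson mult_mono norm_ge_zero order_trans)
  moreover have vw: "\<bar>v \<bullet> (w - u)\<bar> \<le> r" using Cauchy_Schwarz_ineq2[of v "w - u"] w v by simp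
  ultimately have \<phi>w: "\<phi> \<bullet> w \<noteq> 0" using c r
    by (auto simp: inner_diff_left inner_diff_right)
  define \<mu> where "\<mu> = s * (v \<bullet> w)"
  \<comment> \<open>The two fixed points come with a priori different eigenvalues; evaluating \<phi>
    at \<open>A *v w\<close> identifies them because \<open>\<phi> \<bullet> w\<close> does not
    vanish.\<close>
  have "(s * (u \<bullet> \<phi>)) * (\<phi> \<bullet> w) = \<mu> * (\<phi> \<bullet> w)" using left0[of w] w by (auto simp: \<mu>_def)
  then have left: "\<phi> \<bullet> (A *v x) = \<mu> * (\<phi> \<bullet> x)" for x using left0 \<phi>w by simp
  have \<mu>: "\<bar>\<mu>\<bar> \<ge> s * (c - r)"
  proof -
    have "\<bar>v \<bullet> w\<bar> \<ge> c - r" using vw c by (simp add: inner_diff_right)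
    then show ?thesis using s by (simp add: \<mu>_def abs_mult)
  qed
  define \<theta> where "\<theta> = s * (r + e)"
  have \<theta>0: "0 \<le> \<theta>" using s r e by (simp add: \<theta>_def)
  have \<theta>: "\<theta> < \<bar>\<mu>\<bar>"
  proof -
    have "r + e < c - r" using r ec c by linarith
    then have "\<theta> < s * (c - r)" using s by (simp add: \<theta>_def)
    with \<mu> show ?thesis by linarith
  qed
  have contr: "norm (A *v y) \<le> \<theta> * norm y" if "\<phi> \<bullet> y = 0" for y
  proof -
    have "\<bar>v \<bullet> y\<bar> = \<bar>(\<phi> - v) \<bullet> y\<bar>" using that by (simp add: inner_diff_left)
    also have "\<dots> \<le> norm (\<phi> - v) * norm y" by (rule Cauchy_Schwarz_ineq2)
    also have "\<dots> \<le> r * norm y" using \<phi> by (intro mult_right_mono) auto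
    finally have vy: "\<bar>v \<bullet> y\<bar> \<le> r * norm y" .
    have "norm (A *v y) \<le> norm ((s * (v \<bullet> y)) *\<^sub>R u) + norm (A *v y - (s * (v \<bullet> y)) *\<^sub>R u)"
      by (metis add.commute diff_add_cancel norm_triangle_ineq)
    also have "\<dots> \<le> s * (r * norm y) + s * e * norm y"
      using vy u s by (intro add_mono approx) (simp add: abs_mult)
    finally show ?thesis by (simp add: \<theta>_def algebra_simps)
  qed
  have "dominant_eigenpair A w \<phi>" unfolding dominant_eigenpair_def
  proof (intro conjI exI[of _ \<mu>] allI impI)
    show "\<phi> \<bullet> w \<noteq> 0" by (rule \<phi>w)
    show "A *v w = \<mu> *\<^sub>R w" using w by (simp add: \<mu>_def)
    show "\<phi> \<bullet> (A *v x) = \<mu> * (\<phi> \<bullet> x)" for x by (rule left)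
    fix a b x y
    assume h: "\<phi> \<bullet> a = 0" "\<phi> \<bullet> b = 0" "A *v a = x *\<^sub>R a - y *\<^sub>R b" "A *v b = x *\<^sub>R b + y *\<^sub>R a"
      "a \<noteq> 0 \<or> b \<noteq> 0"
    define N where "N = (norm a)\<^sup>2 + (norm b)\<^sup>2"
    have "N > 0" using h(5) unfolding N_def
      by (metis add_pos_nonneg add_nonneg_pos zero_le_power2 zero_less_norm_iff zero_less_power)
    \<comment> \<open>On the pair \<open>(a, b)\<close> the matrix acts as multiplication by
      \<open>x + i y\<close>: the cross terms cancel in the sum of the squared norms, whether or not
      \<open>a\<close> and \<open>b\<close> are independent.\<close>
    have "(x\<^sup>2 + y\<^sup>2) * N = (norm (A *v a))\<^sup>2 + (norm (A *v b))\<^sup>2"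
      unfolding h(3,4) N_def power2_norm_eq_inner
      by (simp add: inner_diff_left inner_diff_right inner_add_left inner_add_right inner_commute[of b a]
          power2_eq_square algebra_simps)
    also have "\<dots> \<le> (\<theta> * norm a)\<^sup>2 + (\<theta> * norm b)\<^sup>2"
      by (intro add_mono power_mono contr h) auto
    also have "\<dots> = \<theta>\<^sup>2 * N" by (simp add: N_def power_mult_distrib algebra_simps)
    finally have "x\<^sup>2 + y\<^sup>2 \<le> \<theta>\<^sup>2" using \<open>N > 0\<close> by simp
    also have "\<theta>\<^sup>2 < \<bar>\<mu>\<bar>\<^sup>2" using \<theta> \<theta>0 by (intro power_strict_mono) auto
    finally show "x\<^sup>2 + y\<^sup>2 < \<mu>\<^sup>2" by simp
  qed
  then show thesis using that w r_def by blast
qed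

section \<open>Products along words with a uniform gap\<close>

definition opn :: "real^'n^'n \<Rightarrow> real" where
  "opn A = onorm ((*v) A)"

lemma opn_bound: "norm (A *v x) \<le> opn A * norm x"
  unfolding opn_def by (rule onorm) (rule matrix_vector_mul_bounded_linear)

lemma opn_nonneg: "0 \<le> opn A"
  unfolding opn_def by (rule onorm_pos_le) (rule matrix_vector_mul_bounded_linear)

lemma opn_le: "(\<And>x. norm (A *v x) \<le> b * norm x) \<Longrightarrow> opn A \<le> b"
  unfolding opn_def by (rule onorm_le)

lemma opn_mult: "opn (A ** B) \<le> opn A * opn B"
proof (rule opn_le)
  fix x
  have "norm ((A ** B) *v x) \<le> opn A * norm (B *v x)"
    by (simp add: matrix_vector_mul_assoc[symmetric] opn_bound)
  also have "\<dots> \<le> opn A * (opn B * norm x)" by (intro mult_left_mono opn_bound opn_nonneg)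
  finally show "norm ((A ** B) *v x) \<le> opn A * opn B * norm x" by (simp add: mult.assoc)
qed

text \<open>Unit vectors stand for the lines they span, hence the minimum over both signs.\<close>

definition pdist :: "'a::real_normed_vector \<Rightarrow> 'a \<Rightarrow> real" where
  "pdist x y = min (norm (x - y)) (norm (x + y))"

lemma pdist_self [simp]: "pdist x x = 0" by (simp add: pdist_def)

lemma pdist_le: "pdist x y \<le> norm (x - y)" by (simp add: pdist_def)

lemma pdist_commute: "pdist x y = pdist y x"
  by (simp add: pdist_def norm_minus_commute add.commute)

lemma pdist_triangle: "pdist x z \<le> pdist x y + pdist y z"
proof -
  have "norm (x - z) \<le> norm (x - y) + norm (y - z)" "norm (x + z) \<le> norm (x - y) + norm (y + z)"
    "norm (x + z) \<le> norm (x + y) + norm (y - z)" "norm (x - z) \<le> norm (x + y) + norm (y + z)"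
    using norm_triangle_ineq[of "x - y" "y - z"] norm_triangle_ineq[of "x - y" "y + z"]
      norm_triangle_ineq4[of "x + y" "y - z"] norm_triangle_ineq4[of "x + y" "y + z"]
    by (simp_all add: algebra_simps)
  then show ?thesis unfolding pdist_def by linarith
qed

lemma abs_inner_pdist: "\<bar>\<bar>v \<bullet> x\<bar> - \<bar>v \<bullet> y\<bar>\<bar> \<le> norm v * pdist x y"
proof -
  have "\<bar>v \<bullet> (x - y)\<bar> \<le> norm v * norm (x - y)" "\<bar>v \<bullet> (x + y)\<bar> \<le> norm v * norm (x + y)"
    by (rule Cauchy_Schwarz_ineq2)+
  then show ?thesis unfolding pdist_def
    by (cases "norm (x - y) \<le> norm (x + y)") (auto simp: inner_diff_right inner_add_right)
qed

text \<open>Both vectors are unit, so \<open>\<bar>t\<bar>\<close> is within \<open>d\<close> of 1,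
  and replacing \<open>t\<close> by its sign costs a second \<open>d\<close>.\<close>

lemma pdist_near_multiple:
  assumes "norm u = 1" "norm u' = 1" "norm (u' - t *\<^sub>R u) \<le> d"
  shows "pdist u u' \<le> 2 * d"
proof -
  have t: "\<bar>1 - \<bar>t\<bar>\<bar> \<le> d"
    using norm_triangle_ineq3[of u' "t *\<^sub>R u"] assms by simp
  show ?thesis
  proof (cases "t \<ge> 0")
    case True
    have "norm (u' - u) \<le> norm (u' - t *\<^sub>R u) + norm ((t - 1) *\<^sub>R u)"
      using norm_triangle_ineq[of "u' - t *\<^sub>R u" "(t - 1) *\<^sub>R u"] by (simp add: algebra_simps)
    then show ?thesis using True t assms pdist_le[of u' u] by (simp add: pdist_commute)
  next
    case False
    have "norm (u' + u) \<le> norm (u' - t *\<^sub>R u) + norm ((t + 1) *\<^sub>R u)"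
      using norm_triangle_ineq[of "u' - t *\<^sub>R u" "(t + 1) *\<^sub>R u"] by (simp add: algebra_simps)
    moreover have "pdist u u' \<le> norm (u' + u)" by (simp add: pdist_def add.commute)
    ultimately show ?thesis using False t assms by simp
  qed
qed

text \<open>The error is measured relative to \<open>s\<close>. In the application \<open>s\<close>
  is the operator norm, \<open>u\<close> and \<open>v\<close> are the top left and right singular
  directions, and \<open>e\<close> bounds the ratio of the second singular value to the
  first.\<close>

definition near_rank_one :: "real^'n^'n \<Rightarrow> real \<Rightarrow> real^'n \<Rightarrow> real^'n \<Rightarrow> real \<Rightarrow> bool" where
  "near_rank_one A s u v e \<longleftrightarrow> norm u = 1 \<and> norm v = 1 \<and>
     (\<forall>x. norm (A *v x - (s * (v \<bullet> x)) *\<^sub>R u) \<le> (s * e) * norm x)"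

lemma near_rank_one_transpose:
  "near_rank_one A s u v e \<Longrightarrow> near_rank_one (transpose A) s v u e"
  unfolding near_rank_one_def using rank_one_approx_transpose by blast

text \<open>Both approximations are evaluated at \<open>v'\<close>: the product sends it close to
  \<open>s' u'\<close>, and \<open>A\<close> sends \<open>M *v v'\<close> close to a multiple of
  \<open>u\<close>. The error of \<open>A\<close> is relative to \<open>s \<le> R * s'\<close> and
  is multiplied by \<open>norm (M *v v') \<le> R\<close>, whence the square of
  \<open>R\<close>.\<close>

lemma pdist_right_factor:
  assumes A: "near_rank_one A s u v e" and B: "near_rank_one (A ** M) s' u' v' e'"
    and M: "\<And>x. norm (M *v x) \<le> R * norm x" and s: "s \<le> R * s'" "0 \<le> s" "s' > 0" and e: "0 \<le> e"
  shows "pdist u u' \<le> 2 * (R\<^sup>2 * e + e')"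
proof (rule pdist_near_multiple)
  show u: "norm u = 1" "norm u' = 1" using A B by (simp_all add: near_rank_one_def)
  have v': "norm v' = 1" using B by (simp add: near_rank_one_def)
  define t where "t = s * (v \<bullet> (M *v v'))"
  have Mv: "norm (M *v v') \<le> R" using M[of v'] v' by simp
  then have R: "0 \<le> R" using norm_ge_zero order_trans by blast
  have 1: "norm ((A ** M) *v v' - s' *\<^sub>R u') \<le> s' * e'"
    using B v' unfolding near_rank_one_def by (metis dot_square_norm mult.right_neutral one_power2)
  have "norm ((A ** M) *v v' - t *\<^sub>R u) \<le> (s * e) * norm (M *v v')"
    using A unfolding near_rank_one_def t_def by (simp add: matrix_vector_mul_assoc[symmetric])
  also have "\<dots> \<le> (s * e) * R" using Mv s e by (intro mult_left_mono) auto
  also have "\<dots> \<le> (R * s' * e) * R"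
    using s e R by (intro mult_right_mono) auto
  finally have 2: "norm ((A ** M) *v v' - t *\<^sub>R u) \<le> s' * (R\<^sup>2 * e)"
    by (simp add: power2_eq_square ac_simps)
  have "s' *\<^sub>R (u' - (t / s') *\<^sub>R u) = ((A ** M) *v v' - t *\<^sub>R u) - ((A ** M) *v v' - s' *\<^sub>R u')"
    using s by (simp add: scaleR_diff_right)
  from arg_cong[OF this, of norm] have "norm (s' *\<^sub>R (u' - (t / s') *\<^sub>R u)) \<le> s' * (R\<^sup>2 * e) + s' * e'"
    using 1 2 norm_triangle_ineq4[of "(A ** M) *v v' - t *\<^sub>R u" "(A ** M) *v v' - s' *\<^sub>R u'"] by linarith
  then have "s' * norm (u' - (t / s') *\<^sub>R u) \<le> s' * (R\<^sup>2 * e + e')"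
    using s by (simp add: distrib_left)
  then show "norm (u' - (t / s') *\<^sub>R u) \<le> R\<^sup>2 * e + e'" using s by simp
qed

lemma norm_transpose_le:
  fixes M :: "real^'n^'n"
  assumes "\<And>x. norm (M *v x) \<le> R * norm x"
  shows "norm (transpose M *v x) \<le> R * norm x"
  using rank_one_approx_transpose[of M 0 0 0 R] assms by simp

lemma pdist_left_factor:
  assumes A: "near_rank_one A s u v e" and B: "near_rank_one (M ** A) s' u' v' e'"
    and M: "\<And>x. norm (M *v x) \<le> R * norm x" and s: "s \<le> R * s'" "0 \<le> s" "s' > 0" and e: "0 \<le> e"
  shows "pdist v v' \<le> 2 * (R\<^sup>2 * e + e')"
  using pdist_right_factor[OF near_rank_one_transpose[OF A] _ norm_transpose_le[OF M] s e]
    near_rank_one_transpose[OF B] by (simp add: matrix_transpose_mul)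

text \<open>Up to \<open>e'\<close>, the image of \<open>B\<close> is the line of \<open>u'\<close>,
  and \<open>A\<close> stretches \<open>u'\<close> only by \<open>opn A\<close> times
  \<open>\<bar>v \<bullet> u'\<bar> + e\<close>. This measures what a product loses at a cut that is
  not transverse.\<close>

lemma opn_mult_near_rank_one:
  assumes A: "near_rank_one A (opn A) u v e" and B: "near_rank_one B (opn B) u' v' e'"
    and e: "0 \<le> e"
  shows "opn (A ** B) \<le> opn A * opn B * (\<bar>v \<bullet> u'\<bar> + e + e')"
proof (rule opn_le)
  fix x
  have u: "norm u = 1" "norm u' = 1" "norm v' = 1" using A B by (simp_all add: near_rank_one_def)
  define y where "y = B *v x - (opn B * (v' \<bullet> x)) *\<^sub>R u'"
  have y: "norm y \<le> opn B * e' * norm x" using B by (simp add: near_rank_one_def y_def)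
  have Bx: "B *v x = (opn B * (v' \<bullet> x)) *\<^sub>R u' + y" by (simp add: y_def)
  have "norm (A *v u' - (opn A * (v \<bullet> u')) *\<^sub>R u) \<le> opn A * e"
    using A u unfolding near_rank_one_def by (metis mult.right_neutral)
  then have "norm (A *v u') \<le> norm ((opn A * (v \<bullet> u')) *\<^sub>R u) + opn A * e"
    using norm_triangle_sub[of "A *v u'" "(opn A * (v \<bullet> u')) *\<^sub>R u"] by linarith
  then have Au': "norm (A *v u') \<le> opn A * (\<bar>v \<bullet> u'\<bar> + e)"
    using u opn_nonneg[of A] by (simp add: abs_mult distrib_left)
  have v'x: "\<bar>v' \<bullet> x\<bar> \<le> norm x" using Cauchy_Schwarz_ineq2[of v' x] u by simp
  have "norm ((A ** B) *v x) = norm ((opn B * (v' \<bullet> x)) *\<^sub>R (A *v u') + A *v y)"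
    by (simp add: matrix_vector_mul_assoc[symmetric] Bx matrix_vector_right_distrib matrix_vector_mult_scaleR)
  also have "\<dots> \<le> (opn B * \<bar>v' \<bullet> x\<bar>) * norm (A *v u') + norm (A *v y)"
    using norm_triangle_ineq[of "(opn B * (v' \<bullet> x)) *\<^sub>R (A *v u')" "A *v y"] opn_nonneg[of B]
    by (simp add: abs_mult)
  also have "\<dots> \<le> (opn B * norm x) * (opn A * (\<bar>v \<bullet> u'\<bar> + e)) + opn A * (opn B * e' * norm x)"
    using v'x Au' opn_nonneg[of A] opn_nonneg[of B] order_trans[OF opn_bound mult_left_mono[OF y]]
    by (intro add_mono mult_mono) auto
  finally show "norm ((A ** B) *v x) \<le> opn A * opn B * (\<bar>v \<bullet> u'\<bar> + e + e') * norm x"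
    by (simp add: algebra_simps)
qed

definition word_prod :: "('b \<Rightarrow> real^'n^'n) \<Rightarrow> 'b list \<Rightarrow> real^'n^'n" where
  "word_prod m w = foldr (\<lambda>s M. m s ** M) w (mat 1)"

lemma word_prod_simps [simp]:
  "word_prod m [] = mat 1" "word_prod m (s # w) = m s ** word_prod m w"
  by (simp_all add: word_prod_def)

lemma word_prod_append: "word_prod m (x @ y) = word_prod m x ** word_prod m y"
  by (induction x) (simp_all add: matrix_mul_assoc)

text \<open>An abstraction of geodesic words: \<open>good\<close> is closed under factors,
  \<open>mi\<close> gives the inverses of the letters, and \<open>U\<close>, \<open>V\<close> are
  the singular directions, meaningful up to sign. The assumption \<open>opn_ge_1\<close> is what too
  many flat cuts would violate.\<close>

locale dominated_words =
  fixes m mi :: "'b \<Rightarrow> real^'n^'n" and S :: "'b set" and good :: "'b list set"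
    and q K R :: real and U V :: "'b list \<Rightarrow> real^'n"
  assumes letters: "w \<in> good \<Longrightarrow> set w \<subseteq> S"
    and factor: "x @ y @ z \<in> good \<Longrightarrow> y \<in> good"
    and right_inverse: "s \<in> S \<Longrightarrow> m s ** mi s = mat 1" and left_inverse: "s \<in> S \<Longrightarrow> mi s ** m s = mat 1"
    and m_bound: "s \<in> S \<Longrightarrow> norm (m s *v a) \<le> R * norm a"
    and mi_bound: "s \<in> S \<Longrightarrow> norm (mi s *v a) \<le> R * norm a"
    and q: "0 < q" "q < 1" and K: "0 \<le> K" and R: "1 \<le> R"
    and gap: "w \<in> good \<Longrightarrow> near_rank_one (word_prod m w) (opn (word_prod m w)) (U w) (V w) (K * q ^ length w)"
    and opn_ge_1: "w \<in> good \<Longrightarrow> 1 \<le> opn (word_prod m w)"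
begin

abbreviation "P \<equiv> word_prod m"

lemma norm_U: "w \<in> good \<Longrightarrow> norm (U w) = 1" and norm_V: "w \<in> good \<Longrightarrow> norm (V w) = 1"
  using gap by (simp_all add: near_rank_one_def)

text \<open>\<open>C0\<close> collects the errors \<open>R\<^sup>2 * K\<close> of the shorter word
  and \<open>K\<close> of the longer one, doubled by \<open>pdist_near_multiple\<close>;
  \<open>C1\<close> is the sum of the resulting geometric series.\<close>

definition "C0 = 2 * (R\<^sup>2 + 1) * K"
definition "C1 = C0 / (1 - q)"

lemma C1_nonneg: "0 \<le> C1"
  using q K by (simp add: C1_def C0_def)

lemma prefix_good: "x @ y \<in> good \<Longrightarrow> x \<in> good" and suffix_good: "x @ y \<in> good \<Longrightarrow> y \<in> good"
  using factor[of "[]" x y] factor[of x y "[]"] by simp_all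

lemma U_step:
  assumes "x @ [s] \<in> good"
  shows "pdist (U x) (U (x @ [s])) \<le> C0 * q ^ length x"
proof -
  have x: "x \<in> good" and s: "s \<in> S" using assms prefix_good letters by fastforce+
  have eq: "P x = P (x @ [s]) ** mi s"
    using right_inverse[OF s] by (simp add: word_prod_append matrix_mul_assoc[symmetric])
  \<comment> \<open>Undoing the last letter costs at most the norm of its inverse; this supplies the
    hypothesis \<open>s \<le> R * s'\<close> of \<open>pdist_right_factor\<close>.\<close>
  have "opn (P x) \<le> opn (P (x @ [s])) * opn (mi s)" unfolding eq by (rule opn_mult)
  also have "\<dots> \<le> opn (P (x @ [s])) * R" by (intro mult_left_mono opn_nonneg opn_le mi_bound s)
  finally have le: "opn (P x) \<le> R * opn (P (x @ [s]))" by (simp add: mult.commute)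
  have "pdist (U x) (U (x @ [s])) \<le> 2 * (R\<^sup>2 * (K * q ^ length x) + K * q ^ length (x @ [s]))"
    using gap[OF assms] opn_ge_1[OF assms] K q
    by (intro pdist_right_factor[OF gap[OF x] _ m_bound[OF s] le opn_nonneg]) (simp_all add: word_prod_append)
  also have "K * q ^ length (x @ [s]) \<le> K * q ^ length x"
    using K q by (intro mult_left_mono power_decreasing) auto
  finally show ?thesis by (simp add: C0_def algebra_simps)
qed

lemma V_step:
  assumes "s # y \<in> good"
  shows "pdist (V y) (V (s # y)) \<le> C0 * q ^ length y"
proof -
  have y: "y \<in> good" and s: "s \<in> S" using assms suffix_good[of "[s]"] letters by fastforce+
  have eq: "P y = mi s ** P (s # y)"
    using left_inverse[OF s] by (simp add: matrix_mul_assoc)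
  have "opn (P y) \<le> opn (mi s) * opn (P (s # y))" unfolding eq by (rule opn_mult)
  also have "\<dots> \<le> R * opn (P (s # y))" by (intro mult_right_mono opn_nonneg opn_le mi_bound s)
  finally have le: "opn (P y) \<le> R * opn (P (s # y))" .
  have "pdist (V y) (V (s # y)) \<le> 2 * (R\<^sup>2 * (K * q ^ length y) + K * q ^ length (s # y))"
    using gap[OF assms] opn_ge_1[OF assms] K q
    by (intro pdist_left_factor[OF gap[OF y] _ m_bound[OF s] le opn_nonneg]) simp_all
  also have "K * q ^ length (s # y) \<le> K * q ^ length y"
    using K q by (intro mult_left_mono power_decreasing) auto
  finally show ?thesis by (simp add: C0_def algebra_simps)
qed

text \<open>The partial sums of the geometric series are kept exactly, as
  \<open>C1 * q ^ n * (1 - q ^ k)\<close>, so that an induction on the number of added letters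
  closes.\<close>

lemma geometric_step: "C1 * q ^ n * (1 - q ^ k) + C0 * q ^ (n + k) = C1 * q ^ n * (1 - q ^ Suc k)"
  using q by (simp add: C1_def power_add field_simps)

lemma geometric_le: "C1 * q ^ n * (1 - q ^ k) \<le> C1 * q ^ n"
  using C1_nonneg q by (simp add: mult_left_le power_le_one)

lemma U_prefix:
  assumes "x @ y \<in> good"
  shows "pdist (U x) (U (x @ y)) \<le> C1 * q ^ length x"
proof -
  have "pdist (U x) (U (x @ y)) \<le> C1 * q ^ length x * (1 - q ^ length y)"
    using assms
  proof (induction y rule: rev_induct)
    case (snoc s y)
    then have "x @ y \<in> good" using prefix_good[of "x @ y" "[s]"] by simp
    then show ?case
      using snoc.IH U_step[of "x @ y" s] snoc.prems geometric_step[of "length x" "length y"]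
        pdist_triangle[of "U x" "U (x @ y @ [s])" "U (x @ y)"] by simp
  qed simp
  then show ?thesis using geometric_le order_trans by blast
qed

lemma V_suffix:
  assumes "x @ y \<in> good"
  shows "pdist (V y) (V (x @ y)) \<le> C1 * q ^ length y"
proof -
  have "pdist (V y) (V (x @ y)) \<le> C1 * q ^ length y * (1 - q ^ length x)"
    using assms
  proof (induction x)
    case (Cons s x)
    then have "x @ y \<in> good" using suffix_good[of "[s]" "x @ y"] by simp
    then show ?case
      using Cons.IH V_step[of s "x @ y"] Cons.prems geometric_step[of "length y" "length x"]
        pdist_triangle[of "V y" "V (s # x @ y)" "V (x @ y)"] by (simp add: add.commute)
  qed simp
  then show ?thesis using geometric_le order_trans by blast
qed

section \<open>Transverse cuts\<close>

lemma abs_inner_V_U: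
  assumes "v' \<in> good" "w' \<in> good" "v \<in> good" "w \<in> good"
  shows "\<bar>V v \<bullet> U w\<bar> \<le> \<bar>V v' \<bullet> U w'\<bar> + pdist (V v) (V v') + pdist (U w) (U w')"
  using abs_inner_pdist[of "V v" "U w" "U w'"] abs_inner_pdist[of "U w'" "V v" "V v'"]
    norm_U[OF assms(2)] norm_V[OF assms(3)]
  by (simp add: inner_commute)

text \<open>One summand for the flatness of the cut, two of size \<open>C1\<close> for passing from
  the whole prefix and suffix to the two halves of a block, and two of size \<open>K\<close> for the
  rank one errors of the halves.\<close>

definition "C2 = 1 + 2 * C1 + 2 * K"

lemma C2: "1 \<le> C2" using C1_nonneg K by (simp add: C2_def)

text \<open>If no cut inside the window were transverse, the norm of an aligned block of length \<open>2 ^ j\<close>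
  would lose a factor of order \<open>q ^ (2 ^ j)\<close> against the norms of its two halves, at every scale.\<close>

lemma opn_dyadic_block:
  assumes flat: "\<And>x z. \<lbrakk>w = x @ z; p < length x; length x < p + 2 ^ k\<rbrakk> \<Longrightarrow> \<bar>V x \<bullet> U z\<bar> \<le> q ^ (2 ^ k)"
    and w: "w \<in> good"
  shows "\<lbrakk>w = x @ y @ z; length y = 2 ^ j; j \<le> k; p \<le> length x; length x + length y \<le> p + 2 ^ k\<rbrakk>
    \<Longrightarrow> (opn (P y))\<^sup>2 \<le> ((R * C2)\<^sup>2 * q ^ j) ^ (2 ^ j) / C2\<^sup>2"
proof (induction j arbitrary: x y z)
  case 0
  then obtain s where s: "y = [s]" by (metis length_0_conv length_Suc_conv One_nat_def power_0)
  then have "s \<in> S" using letters[OF w] 0 by auto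
  then have "opn (P y) \<le> R" by (intro opn_le) (simp add: s m_bound)
  then have "(opn (P y))\<^sup>2 \<le> R\<^sup>2" by (intro power_mono opn_nonneg)
  then show ?case using C2 by (simp add: power_mult_distrib)
next
  case (Suc j)
  define y1 y2 where "y1 = take (2 ^ j) y" and "y2 = drop (2 ^ j) y"
  have y: "y = y1 @ y2" and l1: "length y1 = 2 ^ j" and l2: "length y2 = 2 ^ j"
    using Suc.prems by (simp_all add: y1_def y2_def)
  have pos: "(0::nat) < 2 ^ j" by simp
  have w1: "w = x @ y1 @ (y2 @ z)" and w2: "w = (x @ y1) @ y2 @ z" using Suc.prems y by simp_all
  have good: "x @ y1 \<in> good" "y2 @ z \<in> good" "y1 \<in> good" "y2 \<in> good"
    using w prefix_good[of "x @ y1" "y2 @ z"] suffix_good[of "x @ y1" "y2 @ z"] factor[of x y1 "y2 @ z"]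
      factor[of "x @ y1" y2 z] w1 w2 by simp_all
  have IH: "(opn (P y'))\<^sup>2 \<le> ((R * C2)\<^sup>2 * q ^ j) ^ (2 ^ j) / C2\<^sup>2" if "y' = y1 \<or> y' = y2" for y'
    using that Suc.IH[OF w1] Suc.IH[OF w2] l1 l2 Suc.prems y pos by auto
  have jk: "(2::nat) ^ j \<le> 2 ^ k" using Suc.prems by (intro power_increasing) auto
  have "\<bar>V (x @ y1) \<bullet> U (y2 @ z)\<bar> \<le> q ^ (2 ^ k)"
  proof (rule flat)
    have "length y = 2 ^ j + 2 ^ j" using y l1 l2 by simp
    then show "p < length (x @ y1)" "length (x @ y1) < p + 2 ^ k"
      unfolding length_append l1 using Suc.prems(4,5) pos by linarith+
  qed (use w1 in simp)
  also have "\<dots> \<le> q ^ (2 ^ j)" by (rule power_decreasing[OF jk]) (use q in auto)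
  \<comment> \<open>Flatness is known for the cut of the whole word \<open>w\<close>. Since
    directions depend up to an exponential error only on the letters next to the cut, it passes to
    the two halves of the block.\<close>
  finally have "\<bar>V y1 \<bullet> U y2\<bar> \<le> q ^ (2 ^ j) + C1 * q ^ (2 ^ j) + C1 * q ^ (2 ^ j)"
    using abs_inner_V_U[OF good(1,2,3,4)] V_suffix[OF good(1), unfolded l1]
      U_prefix[OF good(2), unfolded l2] by linarith
  moreover have "opn (P y) \<le> opn (P y1) * opn (P y2) * (\<bar>V y1 \<bullet> U y2\<bar> + K * q ^ (2 ^ j) + K * q ^ (2 ^ j))"
    using opn_mult_near_rank_one[OF gap[OF good(3)] gap[OF good(4)]] K q l1 l2
    by (simp add: y word_prod_append)
  ultimately have "opn (P y) \<le> opn (P y1) * opn (P y2) * (C2 * q ^ (2 ^ j))"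
    by (elim order_trans) (intro mult_left_mono mult_nonneg_nonneg opn_nonneg, simp add: C2_def algebra_simps)
  then have "(opn (P y))\<^sup>2 \<le> (opn (P y1) * opn (P y2) * (C2 * q ^ (2 ^ j)))\<^sup>2"
    by (intro power_mono opn_nonneg)
  also have "\<dots> = (opn (P y1))\<^sup>2 * (opn (P y2))\<^sup>2 * (C2 * q ^ (2 ^ j))\<^sup>2"
    by (simp add: power_mult_distrib)
  also have "\<dots> \<le> (((R * C2)\<^sup>2 * q ^ j) ^ (2 ^ j) / C2\<^sup>2) * (((R * C2)\<^sup>2 * q ^ j) ^ (2 ^ j) / C2\<^sup>2) * (C2 * q ^ (2 ^ j))\<^sup>2"
    using IH q by (intro mult_right_mono mult_mono) auto
  \<comment> \<open>Squaring the norms and dividing by \<open>C2\<^sup>2\<close> makes the recursion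
    exact: the two denominators leave one after cancelling the new \<open>C2\<^sup>2\<close>, and
    the squared factor \<open>q ^ (2 ^ j)\<close> raises the exponent of \<open>q\<close> inside the
    power by one.\<close>
  also have "\<dots> = ((R * C2)\<^sup>2 * q ^ j * q) ^ (2 ^ Suc j) / C2\<^sup>2"
  proof -
    have "(a ^ n / c\<^sup>2) * (a ^ n / c\<^sup>2) * (c * q ^ n)\<^sup>2 = (a * q) ^ (2 * n) / c\<^sup>2" if "c \<noteq> 0" for a c :: real and n
      using that by (simp add: power_mult_distrib power2_eq_square mult_2 power_add)
    from this[of C2 "(R * C2)\<^sup>2 * q ^ j" "2 ^ j"] show ?thesis using C2 by simp
  qed
  finally show ?case by (simp add: mult.assoc mult.commute[of q])
qed

text \<open>The exponent \<open>k\<close> is taken so large that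
  \<open>(R * C2)\<^sup>2 * q ^ k < 1\<close>, and \<open>c = q ^ (2 ^ k)\<close>. With only flat
  cuts, the whole window would be a block of norm less than 1. Both constants are independent of the
  word and of the position of the window.\<close>

lemma transverse_cut:
  "\<exists>c>0. \<exists>k. \<forall>w\<in>good. \<forall>p. p + 2 ^ k \<le> length w \<longrightarrow>
     (\<exists>x z. w = x @ z \<and> p < length x \<and> length x < p + 2 ^ k \<and> c \<le> \<bar>V x \<bullet> U z\<bar>)"
proof -
  have RC: "(R * C2)\<^sup>2 > 0" using R C2 by simp
  obtain k where k: "q ^ k < 1 / (R * C2)\<^sup>2"
    using real_arch_pow_inv[of "1 / (R * C2)\<^sup>2" q] RC q by auto
  show ?thesis
  proof (intro exI[of _ "q ^ (2 ^ k)"] exI[of _ k] conjI ballI allI impI)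
    show "q ^ (2 ^ k) > 0" using q by simp
    fix w p assume w: "w \<in> good" and p: "p + 2 ^ k \<le> length w"
    show "\<exists>x z. w = x @ z \<and> p < length x \<and> length x < p + 2 ^ k \<and> q ^ (2 ^ k) \<le> \<bar>V x \<bullet> U z\<bar>"
    proof (rule ccontr)
      assume neg: "\<not> ?thesis"
      define y where "y = take (2 ^ k) (drop p w)"
      have wy: "w = take p w @ y @ drop (2 ^ k) (drop p w)"
        by (simp only: y_def append_take_drop_id)
      have "(opn (P y))\<^sup>2 \<le> ((R * C2)\<^sup>2 * q ^ k) ^ (2 ^ k) / C2\<^sup>2"
      proof (rule opn_dyadic_block[OF _ w wy])
        show "\<bar>V x \<bullet> U z\<bar> \<le> q ^ (2 ^ k)" if "w = x @ z" "p < length x" "length x < p + 2 ^ k" for x z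
          using neg that by force
      qed (use p in \<open>auto simp: y_def\<close>)
      also have "\<dots> \<le> ((R * C2)\<^sup>2 * q ^ k) ^ (2 ^ k)"
      proof -
        have "0 \<le> ((R * C2)\<^sup>2 * q ^ k) ^ (2 ^ k)" "1 \<le> C2\<^sup>2" using C2 q by simp_all
        then show ?thesis using frac_le[of _ _ 1 "C2\<^sup>2"] by fastforce
      qed
      also have "\<dots> < 1"
        using k RC q by (intro power_Suc_less_one[of _ "2 ^ k - 1", simplified]) (auto simp: field_simps)
      finally have "(opn (P y))\<^sup>2 < 1" .
      moreover have "1 \<le> opn (P y)" using opn_ge_1 factor w wy by metis
      ultimately show False by (simp add: power_less_one_iff)
    qed
  qed
qed

section \<open>Proximal factors by the pigeonhole principle\<close>

lemma power_small:
  assumes "0 < b"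
  shows "\<exists>n0. \<forall>n\<ge>n0. C * q ^ n \<le> b"
proof -
  have "(\<lambda>n. C * q ^ n) \<longlonglongrightarrow> C * 0"
    using q by (intro tendsto_intros LIMSEQ_power_zero) auto
  then have "\<forall>\<^sub>F n in sequentially. C * q ^ n < b"
    using order_tendstoD(2) assms by fastforce
  then show ?thesis by (auto simp: eventually_sequentially intro: less_imp_le)
qed

lemma unit_sphere_pigeonhole:
  assumes "0 < e"
  shows "\<exists>M. \<forall>f :: nat \<Rightarrow> real^'n. (\<forall>i\<le>M. norm (f i) = 1) \<longrightarrow>
    (\<exists>i j. i < j \<and> j \<le> M \<and> norm (f i - f j) \<le> e)"
proof -
  have "compact (sphere (0 :: real^'n) 1)" by simp
  then obtain N where N: "finite N" "sphere (0 :: real^'n) 1 \<subseteq> (\<Union>x\<in>N. ball x (e / 2))"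
    unfolding compact_eq_totally_bounded using assms by (meson half_gt_zero)
  \<comment> \<open>The indices \<open>0\<close> to \<open>card N\<close> are one more than the
    centres of the covering balls.\<close>
  show ?thesis
  proof (rule exI[of _ "card N"], intro allI impI)
    fix f :: "nat \<Rightarrow> real^'n" assume f: "\<forall>i\<le>card N. norm (f i) = 1"
    have "\<forall>i\<in>{..card N}. \<exists>x\<in>N. f i \<in> ball x (e / 2)" using f N(2) by fastforce
    then obtain g where g: "\<And>i. i \<le> card N \<Longrightarrow> g i \<in> N \<and> f i \<in> ball (g i) (e / 2)"
      by (metis atMost_iff)
    have "\<not> inj_on g {..card N}"
      using g N(1) card_inj_on_le[of g "{..card N}" N] by auto
    then obtain i j where ij: "i \<noteq> j" "i \<le> card N" "j \<le> card N" "g i = g j"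
      by (auto simp: inj_on_def)
    have "dist (f i) (f j) \<le> e"
      using g[OF ij(2)] g[OF ij(3)] ij(4) dist_triangle_half_r[of "g i" "f i" e "f j"] by auto
    then show "\<exists>i j. i < j \<and> j \<le> card N \<and> norm (f i - f j) \<le> e"
      using ij by (metis dist_norm dist_commute linorder_neqE_nat)
  qed
qed

text \<open>The pigeonhole is applied to the directions \<open>V\<close> of the prefixes ending at
  the cuts. If those of \<open>x\<close> and \<open>x @ s\<close> nearly agree, then
  \<open>V s\<close>, being close to the latter, is close to \<open>V x\<close>; as
  \<open>V x\<close> is transverse to \<open>U (s @ z)\<close>, which is close to
  \<open>U s\<close>, the factor \<open>s\<close> is transverse to itself. The same cut keeps
  \<open>P x\<close> from contracting the eigenvector of \<open>P s\<close>.\<close>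

lemma attractive_line_near_U:
  assumes "d > 0"
  shows "\<exists>n0. \<forall>w\<in>good. n0 \<le> length w \<longrightarrow>
    (\<exists>x s z a \<phi> b. w = x @ s @ z \<and> dominant_eigenpair (P s) a \<phi> \<and>
      norm b = 1 \<and> span {b} = span {P x *v a} \<and> pdist b (U w) \<le> d)"
proof -
  obtain c k where c: "c > 0" and cut: "\<forall>w\<in>good. \<forall>p. p + 2 ^ k \<le> length w \<longrightarrow>
       (\<exists>x z. w = x @ z \<and> p < length x \<and> length x < p + 2 ^ k \<and> c \<le> \<bar>V x \<bullet> U z\<bar>)"
    using transverse_cut by blast
  obtain M where M: "\<forall>f :: nat \<Rightarrow> real^'n. (\<forall>i\<le>M. norm (f i) = 1) \<longrightarrow>
    (\<exists>i j. i < j \<and> j \<le> M \<and> norm (f i - f j) \<le> c / 8)"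
    using unit_sphere_pigeonhole[of "c / 8"] c by auto
  obtain D1 where D1: "\<And>n. n \<ge> D1 \<Longrightarrow> C1 * q ^ n \<le> c / 8" using power_small[of "c / 8" C1] c by (metis divide_pos_pos zero_less_numeral zero_less_power)
  obtain D2 where D2: "\<And>n. n \<ge> D2 \<Longrightarrow> K * q ^ n \<le> c\<^sup>2 / 64" using power_small[of "c\<^sup>2 / 64" K] c by (metis divide_pos_pos zero_less_numeral zero_less_power)
  \<comment> \<open>The final error: \<open>8 * \<eta> / c\<close> with
    \<open>\<eta> = 2 * K * q ^ length x\<close> between the eigenline and \<open>U x\<close>, plus
    \<open>C1 * q ^ length x\<close> between \<open>U x\<close> and \<open>U w\<close>.\<close>
  obtain h1 where h1: "\<And>n. n \<ge> h1 \<Longrightarrow> (16 * K / c + C1) * q ^ n \<le> d"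
    using power_small[of d "16 * K / c + C1"] assms by (metis divide_pos_pos zero_less_numeral zero_less_power)
  obtain h2 where h2: "\<And>n. n \<ge> h2 \<Longrightarrow> (2 * K) * q ^ n \<le> c / 4"
    using power_small[of "c / 4" "2 * K"] c by (metis divide_pos_pos zero_less_numeral zero_less_power)
  \<comment> \<open>\<open>D\<close> is the length from which a factor \<open>s\<close> has small
    errors, and \<open>h\<close> does the same for the prefix \<open>x\<close>. Windows of length
    \<open>2 ^ k\<close> starting \<open>L\<close> apart leave at least \<open>D\<close> letters
    between cuts in different windows.\<close>
  define D where "D = max D1 D2"
  define h where "h = max h1 h2"
  define L where "L = 2 ^ k + D"
  show ?thesis
  proof (rule exI[of _ "h + (M + 1) * L"], intro ballI impI)
    fix w assume w: "w \<in> good" and len: "h + (M + 1) * L \<le> length w"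
    have "\<exists>x z. w = x @ z \<and> h + i * L < length x \<and> length x < h + i * L + 2 ^ k \<and> c \<le> \<bar>V x \<bullet> U z\<bar>"
      if "i \<le> M" for i
    proof (rule cut[rule_format, OF w])
      have "i * L + L \<le> (M + 1) * L" using that mult_le_mono1[of "i + 1" "M + 1" L] by simp
      moreover have "2 ^ k \<le> L" by (simp add: L_def)
      ultimately show "h + i * L + 2 ^ k \<le> length w" using len by linarith
    qed
    then have "\<forall>i\<in>{..M}. \<exists>xz. w = fst xz @ snd xz \<and> h + i * L < length (fst xz) \<and>
        length (fst xz) < h + i * L + 2 ^ k \<and> c \<le> \<bar>V (fst xz) \<bullet> U (snd xz)\<bar>" by simp
    from bchoice[OF this] obtain F where F: "\<forall>i\<in>{..M}. w = fst (F i) @ snd (F i) \<and> h + i * L < length (fst (F i)) \<and>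
        length (fst (F i)) < h + i * L + 2 ^ k \<and> c \<le> \<bar>V (fst (F i)) \<bullet> U (snd (F i))\<bar>" by blast
    define X Z where "X i = fst (F i)" and "Z i = snd (F i)" for i
    have XZ: "\<And>i. i \<le> M \<Longrightarrow> w = X i @ Z i" and
      X: "\<And>i. i \<le> M \<Longrightarrow> h + i * L < length (X i)" "\<And>i. i \<le> M \<Longrightarrow> length (X i) < h + i * L + 2 ^ k"
      and VU: "\<And>i. i \<le> M \<Longrightarrow> c \<le> \<bar>V (X i) \<bullet> U (Z i)\<bar>"
      using F unfolding X_def Z_def by blast+
    have "norm (V (X i)) = 1" if "i \<le> M" for i
      using norm_V[OF prefix_good[of "X i" "Z i"]] XZ[OF that] w by simp
    then obtain i j where ij: "i < j" "j \<le> M" and Vij: "norm (V (X i) - V (X j)) \<le> c / 8"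
      using M[rule_format, of "\<lambda>i. V (X i)"] by blast
    have "i * L + L \<le> j * L" using ij mult_le_mono1[of "i + 1" j L] by simp
    then have lij: "length (X i) + D \<le> length (X j)" using X(2)[of i] X(1)[of j] ij by (simp add: L_def)
    define x z s where "x = X i" and "z = Z j" and "s = drop (length (X i)) (X j)"
    have "X i @ Z i = X j @ Z j" using XZ[of i] XZ[of j] ij by simp
    then have "take (length (X i)) (X j) = X i" "Z i = drop (length (X i)) (X j) @ Z j"
      using lij by (simp_all add: append_eq_append_conv_if)
    then have Xj: "X j = x @ s" and Zi: "Z i = s @ z"
      using append_take_drop_id[of "length (X i)" "X j"] by (simp_all add: x_def s_def z_def)
    have ls: "D \<le> length s" using lij by (simp add: s_def)
    have lx: "h \<le> length x" using X(1)[of i] ij by (simp add: x_def)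
    have wxsz: "w = x @ s @ z" using XZ[of i] Zi ij by (simp add: x_def)
    have good: "x \<in> good" "s \<in> good" "x @ s \<in> good" "s @ z \<in> good"
      using w factor[of x s z] prefix_good[of x "s @ z"] prefix_good[of "x @ s" z] suffix_good[of x "s @ z"]
      by (simp_all add: wxsz)
    have Us: "pdist (U s) (U (s @ z)) \<le> c / 8"
      using U_prefix[OF good(4)] D1[of "length s"] ls by (simp add: D_def)
    have Vs: "pdist (V s) (V (x @ s)) \<le> c / 8"
      using V_suffix[OF good(3)] D1[of "length s"] ls by (simp add: D_def)
    have Vx: "pdist (V x) (V (x @ s)) \<le> c / 8"
      using Vij pdist_le[of "V (X i)" "V (X j)"] Xj by (simp add: x_def)
    have VxU: "c \<le> \<bar>V x \<bullet> U (s @ z)\<bar>" using VU[of i] ij by (simp add: x_def Zi)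
    \<comment> \<open>Three errors of \<open>c / 8\<close> are subtracted from \<open>c\<close>:
      \<open>U s\<close> against \<open>U (s @ z)\<close>, \<open>V s\<close> against
      \<open>V (x @ s)\<close>, and \<open>V (x @ s)\<close> against \<open>V x\<close>, the last
      one from the pigeonhole.\<close>
    have VsUs: "c / 2 \<le> \<bar>V s \<bullet> U s\<bar>"
      using abs_inner_V_U[OF good(2,2,1,4)] VxU Us Vs Vx pdist_triangle[of "V x" "V s" "V (x @ s)"]
        pdist_commute[of "U s" "U (s @ z)"]
        pdist_commute[of "V s" "V (x @ s)"] c by linarith
    have VxUs: "7 * c / 8 \<le> \<bar>V x \<bullet> U s\<bar>"
      using abs_inner_V_U[OF good(1,2,1,4)] VxU Us pdist_commute[of "U s" "U (s @ z)"] by (simp add: field_simps)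
    have Ks: "K * q ^ length s \<le> c\<^sup>2 / 64" using D2 ls by (simp add: D_def)
    \<comment> \<open>The transversality constant is now \<open>c / 2\<close>. The bound
      \<open>c\<^sup>2 / 64\<close> is \<open>(c / 2)\<^sup>2 / 16\<close>, and it also brings the
      eigenvector within \<open>c / 8\<close> of \<open>U s\<close>.\<close>
    obtain a \<phi> where dom: "dominant_eigenpair (P s) a \<phi>" and "norm (a - U s) \<le> 4 * (K * q ^ length s) / (c / 2)"
    proof (rule rank_one_approx_dominant)
      show "norm (P s *v y - (opn (P s) * (V s \<bullet> y)) *\<^sub>R U s) \<le> opn (P s) * (K * q ^ length s) * norm y" for y
        using gap[OF good(2)] by (simp add: near_rank_one_def)
      show "K * q ^ length s \<le> (c / 2)\<^sup>2 / 16" using Ks by (simp add: power_divide)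
      show "opn (P s) > 0" using opn_ge_1[OF good(2)] by simp
    qed (use VsUs c K q norm_U norm_V good in auto)
    moreover have "4 * (K * q ^ length s) / (c / 2) \<le> c / 8"
      using Ks c by (simp add: field_simps power2_eq_square)
    ultimately have aU: "norm (a - U s) \<le> c / 8" by linarith
    \<comment> \<open>The eigenvector keeps a definite component along \<open>V x\<close>, so that
      \<open>P x\<close> stretches it by an amount comparable to its norm and turns it towards
      \<open>U x\<close>.\<close>
    have "\<bar>V x \<bullet> (a - U s)\<bar> \<le> c / 8"
      using Cauchy_Schwarz_ineq2[of "V x" "a - U s"] aU norm_V[OF good(1)] by simp
    then have Vxa: "3 * c / 4 \<le> \<bar>V x \<bullet> a\<bar>" using VxUs unfolding inner_diff_right by linarith
    have "c \<le> 1" using VxU Cauchy_Schwarz_ineq2[of "V x" "U (s @ z)"] norm_V[OF good(1)] norm_U[OF good(4)] by simp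
    then have na: "norm a \<le> 2" using aU norm_triangle_sub[of a "U s"] norm_U[OF good(2)] by simp
    define \<sigma> where "\<sigma> = opn (P x)"
    have \<sigma>: "\<sigma> > 0" using opn_ge_1[OF good(1)] by (simp add: \<sigma>_def)
    define \<eta> where "\<eta> = 2 * K * q ^ length x"
    have \<eta>: "0 \<le> \<eta>" "\<eta> \<le> c / 4" using h2[of "length x"] lx K q by (simp_all add: \<eta>_def h_def)
    define y where "y = P x *v a"
    have "norm (y - (\<sigma> * (V x \<bullet> a)) *\<^sub>R U x) \<le> (\<sigma> * (K * q ^ length x)) * norm a"
      using gap[OF good(1)] by (simp add: near_rank_one_def y_def \<sigma>_def)
    also have "\<dots> \<le> (\<sigma> * (K * q ^ length x)) * 2" using \<sigma> K q na by (intro mult_left_mono) auto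
    finally have y: "norm (y - (\<sigma> * (V x \<bullet> a)) *\<^sub>R U x) \<le> \<sigma> * \<eta>" by (simp add: \<eta>_def)
    have "norm ((\<sigma> * (V x \<bullet> a)) *\<^sub>R U x) \<le> norm y + \<sigma> * \<eta>"
      using y norm_triangle_sub[of "(\<sigma> * (V x \<bullet> a)) *\<^sub>R U x" y] by (simp add: norm_minus_commute)
    then have "\<sigma> * \<bar>V x \<bullet> a\<bar> \<le> norm y + \<sigma> * \<eta>"
      using \<sigma> norm_U[OF good(1)] by (simp add: abs_mult)
    moreover have "\<sigma> * (3 * c / 4) \<le> \<sigma> * \<bar>V x \<bullet> a\<bar>" "\<sigma> * \<eta> \<le> \<sigma> * (c / 4)"
      using Vxa \<eta> \<sigma> by (intro mult_left_mono; simp)+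
    moreover have "\<sigma> * (3 * c / 4) = 3 * (\<sigma> * (c / 4))" "0 < \<sigma> * (c / 4)" using \<sigma> c by simp_all
    ultimately have ny: "\<sigma> * (c / 4) \<le> norm y" by linarith
    then have ny0: "norm y > 0" using mult_pos_pos[OF \<sigma>, of "c / 4"] c by linarith
    define b where "b = inverse (norm y) *\<^sub>R y"
    have nb: "norm b = 1" using ny0 by (simp add: b_def)
    have "b - (\<sigma> * (V x \<bullet> a) / norm y) *\<^sub>R U x = inverse (norm y) *\<^sub>R (y - (\<sigma> * (V x \<bullet> a)) *\<^sub>R U x)"
      by (simp add: b_def scaleR_diff_right divide_inverse mult.commute)
    then have "norm (b - (\<sigma> * (V x \<bullet> a) / norm y) *\<^sub>R U x) = norm (y - (\<sigma> * (V x \<bullet> a)) *\<^sub>R U x) / norm y"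
      by (simp add: divide_inverse mult.commute)
    also have "\<dots> \<le> (\<sigma> * \<eta>) / (\<sigma> * (c / 4))"
      using y ny \<sigma> c \<eta> by (intro frac_le) auto
    also have "\<dots> = \<eta> * 4 / c" using \<sigma> by simp
    finally have "pdist (U x) b \<le> 2 * (\<eta> * 4 / c)"
      using pdist_near_multiple norm_U[OF good(1)] nb by blast
    moreover have "pdist (U x) (U w) \<le> C1 * q ^ length x"
      using U_prefix[of x "s @ z"] w by (simp add: wxsz)
    moreover have "2 * (\<eta> * 4 / c) + C1 * q ^ length x \<le> d"
      using h1[of "length x"] lx by (simp add: h_def \<eta>_def algebra_simps)
    ultimately have "pdist b (U w) \<le> d"
      using pdist_triangle[of b "U w" "U x"] pdist_commute[of b "U x"] by linarith
    moreover have "span {b} = span {P x *v a}"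
      using ny0 span_image_scale[of "{y}" "\<lambda>_. inverse (norm y)"] by (simp add: b_def y_def)
    ultimately show "\<exists>x s z a \<phi> b. w = x @ s @ z \<and> dominant_eigenpair (P s) a \<phi> \<and>
      norm b = 1 \<and> span {b} = span {P x *v a} \<and> pdist b (U w) \<le> d"
      using wxsz dom nb by blast
  qed
qed

end

section \<open>Singular values\<close>

lemma inner_gram: "x \<bullet> ((transpose A ** A) *v y) = (A *v x) \<bullet> (A *v y)" for A :: "real^'n^'n"
proof -
  have "((A *v y) v* A) \<bullet> x = (A *v y) \<bullet> (A *v x)" by (rule dot_lmul_matrix)
  then show ?thesis by (simp add: matrix_vector_mul_assoc[symmetric] inner_commute)
qed

lemma orthogonal_to_nonzero:
  fixes v :: "real^'n"
  assumes "CARD('n) > 1"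
  obtains w where "w \<noteq> 0" "v \<bullet> w = 0"
proof -
  have "dim {v} < DIM(real^'n)"
    using dim_le_card'[of "{v}"] assms by simp
  then show thesis
  proof (rule orthogonal_to_subspace_exists)
    fix w assume "w \<noteq> 0" "\<And>y. y \<in> span {v} \<Longrightarrow> orthogonal w y"
    moreover have "v \<in> span {v}" by (simp add: span_base)
    ultimately show thesis using that[of w] by (simp add: orthogonal_def inner_commute)
  qed
qed

text \<open>A maximiser of the norm of \<open>A\<close> on the unit sphere of an invariant subspace is critical for
  the Rayleigh quotient.\<close>

lemma gram_maximal_eigenvector:
  fixes A :: "real^'n^'n"
  assumes T: "subspace T" "T \<noteq> {0}" and inv: "\<And>x. x \<in> T \<Longrightarrow> (transpose A ** A) *v x \<in> T"
  obtains v where "v \<in> T" "norm v = 1" "(transpose A ** A) *v v = (norm (A *v v))\<^sup>2 *\<^sub>R v"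
    "\<And>x. x \<in> T \<Longrightarrow> norm (A *v x) \<le> norm (A *v v) * norm x"
proof -
  let ?S = "T \<inter> sphere 0 1"
  obtain x0 where x0: "x0 \<in> T" "x0 \<noteq> 0" using T subspace_0 by blast
  have "inverse (norm x0) *\<^sub>R x0 \<in> ?S" using x0 T by (simp add: subspace_scale)
  then have ne: "?S \<noteq> {}" by blast
  have "compact ?S" using closed_subspace[OF T(1)] by (simp add: closed_Int_compact)
  moreover have "continuous_on ?S (\<lambda>x. norm (A *v x))" by (intro continuous_intros)
  ultimately obtain v where v: "v \<in> ?S" and max: "\<And>x. x \<in> ?S \<Longrightarrow> norm (A *v x) \<le> norm (A *v v)"
    using continuous_attains_sup[OF _ ne] by blast
  define s where "s = norm (A *v v)"
  have bound: "norm (A *v x) \<le> s * norm x" if "x \<in> T" for x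
  proof (cases "x = 0")
    case False
    have "norm (A *v (inverse (norm x) *\<^sub>R x)) \<le> s"
      unfolding s_def by (rule max) (use that False T in \<open>simp add: subspace_scale\<close>)
    then show ?thesis using False by (simp add: matrix_vector_mult_scaleR field_simps)
  qed simp
  \<comment> \<open>Half the gradient of the Rayleigh quotient at \<open>v\<close>. It lies in
    \<open>T\<close> and is orthogonal to \<open>v\<close>, so \<open>v + t z\<close> is an
    admissible variation.\<close>
  define z where "z = (transpose A ** A) *v v - s\<^sup>2 *\<^sub>R v"
  have vT: "v \<in> T" and nv: "norm v = 1" using v by auto
  have zT: "z \<in> T" unfolding z_def using inv vT T by (intro subspace_diff subspace_scale) auto
  have vz: "v \<bullet> z = 0"
  proof -
    have "v \<bullet> v = 1" "(A *v v) \<bullet> (A *v v) = s\<^sup>2"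
      using nv by (simp_all add: s_def power2_norm_eq_inner norm_eq_1)
    then show ?thesis unfolding z_def inner_diff_right inner_gram by simp
  qed
  have Avz: "(A *v v) \<bullet> (A *v z) = z \<bullet> z"
  proof -
    have "(A *v v) \<bullet> (A *v z) = (A *v z) \<bullet> (A *v v)" by (rule inner_commute)
    also have "\<dots> = z \<bullet> ((transpose A ** A) *v v)" by (rule inner_gram[symmetric])
    also have "(transpose A ** A) *v v = z + s\<^sup>2 *\<^sub>R v" by (simp add: z_def)
    also have "z \<bullet> (z + s\<^sup>2 *\<^sub>R v) = z \<bullet> z + s\<^sup>2 * (v \<bullet> z)" by (simp add: inner_add_right inner_commute)
    finally show ?thesis using vz by simp
  qed
  have ineq: "2 * t * (z \<bullet> z) \<le> t\<^sup>2 * (s\<^sup>2 * (z \<bullet> z))" for t :: real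
  proof -
    have "(norm (A *v (v + t *\<^sub>R z)))\<^sup>2 \<le> (s * norm (v + t *\<^sub>R z))\<^sup>2"
      using bound[of "v + t *\<^sub>R z"] vT zT T by (intro power_mono) (auto intro: subspace_add subspace_scale)
    moreover have "(norm (A *v (v + t *\<^sub>R z)))\<^sup>2 = s\<^sup>2 + 2 * t * (z \<bullet> z) + t\<^sup>2 * (norm (A *v z))\<^sup>2"
      unfolding s_def power2_norm_eq_inner matrix_vector_right_distrib matrix_vector_mult_scaleR
      by (simp add: inner_add_left inner_add_right inner_commute[of "A *v z" "A *v v"] Avz power2_eq_square algebra_simps)
    moreover have "(s * norm (v + t *\<^sub>R z))\<^sup>2 = s\<^sup>2 * (1 + t\<^sup>2 * (z \<bullet> z))"
      using nv vz by (simp add: power_mult_distrib power2_norm_eq_inner inner_add_left inner_add_right inner_commute[of z v]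
        power2_eq_square[of t] norm_eq_1)
    moreover have "s\<^sup>2 * (1 + t\<^sup>2 * (z \<bullet> z)) = s\<^sup>2 + t\<^sup>2 * (s\<^sup>2 * (z \<bullet> z))" "0 \<le> t\<^sup>2 * (norm (A *v z))\<^sup>2"
      by (simp_all add: algebra_simps)
    ultimately show ?thesis by linarith
  qed
  have "z \<bullet> z = 0"
  proof (rule ccontr)
    assume "z \<bullet> z \<noteq> 0"
    then have pos: "z \<bullet> z > 0" by simp
    \<comment> \<open>The step \<open>t = 1 / (1 + s\<^sup>2)\<close> is small enough for the first
      order gain to exceed the second order term, which contradicts maximality.\<close>
    define r where "r = 1 + s\<^sup>2"
    have r: "r > 0" by (simp add: r_def add_pos_nonneg)
    define c where "c = inverse r"
    have c: "c * r = 1" using r by (simp add: c_def)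
    have "(2 * c) * (z \<bullet> z) \<le> (c\<^sup>2 * s\<^sup>2) * (z \<bullet> z)" using ineq[of c] by (simp only: mult.assoc)
    then have "2 * c \<le> c\<^sup>2 * s\<^sup>2" using pos by (simp only: mult_le_cancel_right_pos)
    then have "(2 * c) * (r * r) \<le> (c\<^sup>2 * s\<^sup>2) * (r * r)" using r by (intro mult_right_mono) auto
    moreover have "(2 * c) * (r * r) = 2 * (c * r) * r" by simp
    moreover have "(c\<^sup>2 * s\<^sup>2) * (r * r) = (c * r)\<^sup>2 * s\<^sup>2" by (simp add: power2_eq_square)
    ultimately have "2 * r \<le> s\<^sup>2" using c by simp
    then show False using r by (simp add: r_def)
  qed
  then have "(transpose A ** A) *v v = s\<^sup>2 *\<^sub>R v" by (simp add: z_def)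
  then show thesis using that[OF vT nv] bound by (simp add: s_def)
qed

text \<open>Distinct nonnegative \<open>s\<close> have distinct squares, so their eigenvectors are
  orthogonal and there are at most as many as the dimension. Without finiteness the sum in
  \<open>singular_values\<close> would collapse to the empty multiset.\<close>

lemma gram_eigenvalues_finite:
  fixes A :: "real^'n^'n"
  shows "finite {s. s \<ge> 0 \<and> {v. (transpose A ** A) *v v = s\<^sup>2 *\<^sub>R v} \<noteq> {0}}"
proof -
  define I where "I = {s. s \<ge> 0 \<and> {v. (transpose A ** A) *v v = s\<^sup>2 *\<^sub>R v} \<noteq> {0}}"
  have I0: "s \<ge> 0" if "s \<in> I" for s using that by (simp add: I_def)
  have ex: "\<exists>v. v \<noteq> 0 \<and> (transpose A ** A) *v v = s\<^sup>2 *\<^sub>R v" if "s \<in> I" for s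
  proof -
    have "0 \<in> {v. (transpose A ** A) *v v = s\<^sup>2 *\<^sub>R v}" by simp
    then show ?thesis using that unfolding I_def by blast
  qed
  define f where "f s = (SOME v. v \<noteq> 0 \<and> (transpose A ** A) *v v = s\<^sup>2 *\<^sub>R v)" for s
  have f: "f s \<noteq> 0" "(transpose A ** A) *v f s = s\<^sup>2 *\<^sub>R f s" if "s \<in> I" for s
    using someI_ex[OF ex[OF that]] unfolding f_def by blast+
  have orth: "f s \<bullet> f t = 0" if "s \<in> I" "t \<in> I" "s \<noteq> t" for s t
  proof -
    have "t\<^sup>2 * (f s \<bullet> f t) = f s \<bullet> ((transpose A ** A) *v f t)"
      unfolding f(2)[OF that(2)] by simp
    also have "\<dots> = (A *v f t) \<bullet> (A *v f s)" unfolding inner_gram by (rule inner_commute)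
    also have "\<dots> = f t \<bullet> ((transpose A ** A) *v f s)" by (rule inner_gram[symmetric])
    also have "\<dots> = s\<^sup>2 * (f s \<bullet> f t)" unfolding f(2)[OF that(1)] by (simp add: inner_commute)
    finally have "(t\<^sup>2 - s\<^sup>2) * (f s \<bullet> f t) = 0" by (simp add: left_diff_distrib)
    moreover have "t\<^sup>2 \<noteq> s\<^sup>2" using that(3) I0[OF that(1)] I0[OF that(2)] by (simp add: power2_eq_iff_nonneg)
    ultimately show ?thesis by simp
  qed
  have "pairwise orthogonal (f ` I)"
  proof (rule pairwiseI)
    fix x y assume x: "x \<in> f ` I" and y: "y \<in> f ` I" and "x \<noteq> y"
    from x obtain s where s: "s \<in> I" "x = f s" by (rule imageE)
    from y obtain t where t: "t \<in> I" "y = f t" by (rule imageE)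
    show "orthogonal x y"
      unfolding orthogonal_def s(2) t(2) by (rule orth) (use s t \<open>x \<noteq> y\<close> in auto)
  qed
  moreover have "0 \<notin> f ` I"
  proof
    assume "0 \<in> f ` I"
    then obtain s where "s \<in> I" "0 = f s" by (rule imageE)
    then show False using f(1)[of s] by simp
  qed
  ultimately have "independent (f ` I)" by (rule pairwise_orthogonal_independent)
  then have "finite (f ` I)" by (rule independent_imp_finite)
  moreover have "inj_on f I"
  proof (rule inj_onI, rule ccontr)
    fix s t assume "s \<in> I" "t \<in> I" "f s = f t" "s \<noteq> t"
    then show False using orth[of s t] f(1)[of t] by simp
  qed
  ultimately have "finite I" by (rule finite_imageD)
  then show ?thesis by (simp only: I_def)
qed

text \<open>If the second largest entry were below both \<open>a\<close> and \<open>b\<close>, only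
  one member of the multiset could reach their minimum, yet \<open>a\<close> and \<open>b\<close>
  are two.\<close>

lemma sorted_desc_nth_1_ge:
  fixes M :: "real multiset"
  assumes "{#a, b#} \<subseteq># M"
  shows "min a b \<le> rev (sorted_list_of_multiset M) ! 1"
    "rev (sorted_list_of_multiset M) ! 1 \<le> rev (sorted_list_of_multiset M) ! 0"
proof -
  define L where "L = rev (sorted_list_of_multiset M)"
  have mL: "mset L = M" by (simp add: L_def)
  have len: "2 \<le> length L" using size_mset_mono[OF assms] by (simp add: mL[symmetric])
  have sorted: "sorted (rev L)" by (simp add: L_def)
  then have dec: "L ! j \<le> L ! i" if "i \<le> j" "j < length L" for i j
    using sorted_rev_nth_mono that by blast
  show "rev (sorted_list_of_multiset M) ! 1 \<le> rev (sorted_list_of_multiset M) ! 0"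
    using dec[of 0 1] len by (simp add: L_def)
  show "min a b \<le> rev (sorted_list_of_multiset M) ! 1"
  proof (rule ccontr)
    assume "\<not> min a b \<le> rev (sorted_list_of_multiset M) ! 1"
    then have lt: "L ! 1 < min a b" unfolding L_def by (simp only: not_le)
    have "filter_mset (\<lambda>x. min a b \<le> x) M = mset (filter (\<lambda>x. min a b \<le> x) L)" by (simp add: mL[symmetric])
    also have "filter (\<lambda>x. min a b \<le> x) L = filter (\<lambda>x. min a b \<le> x) [L ! 0]"
    proof -
      have L: "L = L ! 0 # drop 1 L" using len by (cases L) auto
      have "filter (\<lambda>x. min a b \<le> x) (drop 1 L) = []"
      proof -
        have "x < min a b" if "x \<in> set (drop 1 L)" for x
        proof -
          obtain i where "i < length (drop 1 L)" "x = drop 1 L ! i" using \<open>x \<in> _\<close> by (metis in_set_conv_nth)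
          then have "x = L ! (1 + i)" "1 + i < length L" by auto
          then show ?thesis using dec[of 1 "1 + i"] lt by simp
        qed
        then show ?thesis by (force simp: filter_empty_conv)
      qed
      then show ?thesis by (subst L) simp
    qed
    finally have "size (filter_mset (\<lambda>x. min a b \<le> x) M) \<le> 1" by simp
    moreover have "{#a, b#} \<subseteq># filter_mset (\<lambda>x. min a b \<le> x) M"
      using multiset_filter_mono[OF assms, of "\<lambda>x. min a b \<le> x"] by simp
    from size_mset_mono[OF this] have "2 \<le> size (filter_mset (\<lambda>x. min a b \<le> x) M)" by simp
    ultimately show False by simp
  qed
qed

text \<open>One-sided bounds suffice: they bound the logarithmic gap from above by
  \<open>ln s - ln t\<close>, and the Anosov condition bounds that gap from below.\<close>

lemma singular_values_bounds:
  fixes A :: "real^'n^'n"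
  assumes v: "norm v = 1" "(transpose A ** A) *v v = s\<^sup>2 *\<^sub>R v" "s \<ge> 0"
    and w: "norm w = 1" "(transpose A ** A) *v w = t\<^sup>2 *\<^sub>R w" "t \<ge> 0" and "v \<bullet> w = 0"
    and max: "\<And>x. norm (A *v x) \<le> s * norm x"
  shows "singular_values A ! 0 \<le> s" "t \<le> singular_values A ! 1" "singular_values A ! 1 \<le> singular_values A ! 0"
proof -
  define E where "E r = {v. (transpose A ** A) *v v = r\<^sup>2 *\<^sub>R v}" for r
  define I where "I = {r. r \<ge> 0 \<and> E r \<noteq> {0}}"
  define M where "M = (\<Sum>r\<in>I. replicate_mset (dim (E r)) r)"
  have fin: "finite I" unfolding I_def E_def by (rule gram_eigenvalues_finite)
  have sv: "singular_values A = rev (sorted_list_of_multiset M)"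
    by (simp add: singular_values_def Let_def M_def I_def E_def)
  have count: "count M r = (if r \<in> I then dim (E r) else 0)" for r
  proof -
    have "count M r = (\<Sum>x\<in>I. if r = x then dim (E x) else 0)" by (simp add: M_def count_sum)
    also have "\<dots> = (if r \<in> I then dim (E r) else 0)" using fin by (rule sum.delta')
    finally show ?thesis .
  qed
  have sub: "subspace (E r)" for r
    by (auto simp: subspace_def E_def matrix_vector_right_distrib matrix_vector_mult_scaleR scaleR_right_distrib)
  have EI: "r \<in> I" "dim (E r) \<ge> 1" if "x \<in> E r" "x \<noteq> 0" "r \<ge> 0" for x r
  proof -
    show "r \<in> I" using that by (auto simp: I_def)
    show "dim (E r) \<ge> 1"
    proof -
      have "\<not> E r \<subseteq> {0}" using that by blast
      then show ?thesis using dim_eq_0[of "E r"] by linarith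
    qed
  qed
  have vE: "v \<in> E s" "v \<noteq> 0" and wE: "w \<in> E t" "w \<noteq> 0" using v w by (auto simp: E_def)
  have "\<forall>r\<in>#M. r \<le> s"
  proof
    fix r assume "r \<in># M"
    then have "count M r > 0" by simp
    then have r: "r \<in> I" by (simp add: count split: if_splits)
    then obtain x where "x \<in> E r" and x0: "x \<noteq> 0"
      using subspace_0[OF sub[of r]] unfolding I_def by blast
    then have x: "(transpose A ** A) *v x = r\<^sup>2 *\<^sub>R x" by (simp add: E_def)
    have "(norm (A *v x))\<^sup>2 = r\<^sup>2 * (norm x)\<^sup>2"
      using x inner_gram[of x A x] by (simp add: power2_norm_eq_inner)
    then have "norm (A *v x) = r * norm x" using r by (simp add: I_def power_mult_distrib[symmetric] power2_eq_iff_nonneg)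
    then show "r \<le> s" using max[of x] x0 by simp
  qed
  moreover have "singular_values A ! 0 \<in># M"
  proof -
    have "count M s > 0" unfolding count using EI[OF vE v(3)] by simp
    then have "s \<in> set (singular_values A)" by (simp add: sv)
    then have "singular_values A ! 0 \<in> set (singular_values A)" by (cases "singular_values A") auto
    then show ?thesis by (simp add: sv)
  qed
  ultimately show "singular_values A ! 0 \<le> s" by blast
  have ts: "t \<le> s"
  proof -
    have "(norm (A *v w))\<^sup>2 = t\<^sup>2" using w inner_gram[of w A w] by (simp add: power2_norm_eq_inner norm_eq_1)
    then have "norm (A *v w) = t" using w by (simp add: power2_eq_iff_nonneg)
    then show ?thesis using max[of w] w by simp
  qed
  \<comment> \<open>When \<open>s = t\<close> both copies come from one eigenspace, which has
    dimension at least two because it contains the orthogonal pair \<open>v\<close>,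
    \<open>w\<close>.\<close>
  have "{#s, t#} \<subseteq># M"
  proof (cases "s = t")
    case True
    have "independent {v, w}"
      using vE wE \<open>v \<bullet> w = 0\<close> by (intro pairwise_orthogonal_independent) (auto simp: pairwise_def orthogonal_def inner_commute)
    moreover have "v \<noteq> w" using vE \<open>v \<bullet> w = 0\<close> by auto
    ultimately have "2 \<le> dim (E s)"
      using independent_card_le_dim[of "{v, w}" "E s"] vE wE True by simp
    then show ?thesis using True EI(1)[OF vE v(3)] by (auto simp: subseteq_mset_def count)
  next
    case False
    then show ?thesis using EI[OF vE v(3)] EI[OF wE w(3)] by (auto simp: subseteq_mset_def count)
  qed
  from sorted_desc_nth_1_ge[OF this] ts
  show "t \<le> singular_values A ! 1" "singular_values A ! 1 \<le> singular_values A ! 0" by (simp_all add: sv)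
qed

text \<open>The orthogonal complement of a top eigenvector \<open>v\<close> is invariant under the
  Gram matrix, so the maximisation can be repeated there. Its maximum \<open>t\<close> is the norm
  of what remains of \<open>A\<close> after removing the rank one part, with \<open>u\<close> the
  normalised image of \<open>v\<close>.\<close>

lemma singular_gap:
  fixes A :: "real^'n^'n"
  assumes "CARD('n) > 1" and det: "det A \<noteq> 0"
  shows "\<exists>u v s t. norm u = 1 \<and> norm v = 1 \<and> 0 < s \<and> 0 < t \<and> s = onorm ((*v) A) \<and>
    (\<forall>x. norm (A *v x - (s * (v \<bullet> x)) *\<^sub>R u) \<le> t * norm x) \<and>
    ln (singular_values A ! 0) - ln (singular_values A ! 1) \<le> ln s - ln t"
proof -
  have inj: "A *v x \<noteq> 0" if "x \<noteq> 0" for x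
    using det that by (metis det_nz_iff_inj invertible_det_nz invertible_left_inverse matrix_left_invertible_ker)
  have "(1 :: real^'n) \<noteq> 0" by (simp add: vec_eq_iff)
  then have U: "(UNIV :: (real^'n) set) \<noteq> {0}" by blast
  obtain v where v: "norm v = 1" "(transpose A ** A) *v v = (norm (A *v v))\<^sup>2 *\<^sub>R v"
    and max: "\<And>x. norm (A *v x) \<le> norm (A *v v) * norm x"
    using gram_maximal_eigenvector[OF subspace_UNIV U, of A] by auto
  define s where "s = norm (A *v v)"
  define T where "T = {x. v \<bullet> x = 0}"
  have subT: "subspace T" unfolding T_def by (rule subspace_hyperplane)
  obtain w0 where "w0 \<noteq> 0" "v \<bullet> w0 = 0" using orthogonal_to_nonzero[OF assms(1)] .
  then have T0: "T \<noteq> {0}" by (auto simp: T_def)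
  have inv: "(transpose A ** A) *v x \<in> T" if "x \<in> T" for x
  proof -
    have "v \<bullet> ((transpose A ** A) *v x) = (A *v x) \<bullet> (A *v v)" unfolding inner_gram by (rule inner_commute)
    also have "\<dots> = x \<bullet> ((transpose A ** A) *v v)" by (rule inner_gram[symmetric])
    finally show ?thesis using that unfolding v(2) T_def by (simp add: inner_commute)
  qed
  obtain w where w: "w \<in> T" "norm w = 1" "(transpose A ** A) *v w = (norm (A *v w))\<^sup>2 *\<^sub>R w"
    and maxw: "\<And>x. x \<in> T \<Longrightarrow> norm (A *v x) \<le> norm (A *v w) * norm x"
    using gram_maximal_eigenvector[OF subT T0 inv] by blast
  define t where "t = norm (A *v w)"
  have s: "s > 0" and t: "t > 0" using inj[of v] inj[of w] v(1) w(2) unfolding s_def t_def by fastforce+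
  define u where "u = inverse s *\<^sub>R (A *v v)"
  have sv: "singular_values A ! 0 \<le> s" "t \<le> singular_values A ! 1" "singular_values A ! 1 \<le> singular_values A ! 0"
    using singular_values_bounds[of v A s w t] v w s t max by (simp_all add: s_def t_def T_def)
  show ?thesis
  proof (rule exI[of _ u], rule exI[of _ v], rule exI[of _ s], rule exI[of _ t], intro conjI allI)
    show "norm u = 1" using s by (simp add: u_def s_def)
    show "norm v = 1" by (rule v)
    show "0 < s" "0 < t" using s t by auto
    show "s = onorm ((*v) A)"
    proof (rule antisym)
      show "s \<le> onorm ((*v) A)"
        using onorm[OF matrix_vector_mul_bounded_linear, of A v] v by (simp add: s_def)
      show "onorm ((*v) A) \<le> s" using max by (intro onorm_le) (simp add: s_def)
    qed
    show "norm (A *v x - (s * (v \<bullet> x)) *\<^sub>R u) \<le> t * norm x" for x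
    proof -
      define y where "y = x - (v \<bullet> x) *\<^sub>R v"
      have "A *v x - (s * (v \<bullet> x)) *\<^sub>R u = A *v y"
        using s by (simp add: y_def u_def matrix_vector_mult_diff_distrib matrix_vector_mult_scaleR)
      moreover have yT: "y \<in> T" using v by (simp add: y_def T_def inner_diff_right norm_eq_1)
      moreover have "norm y \<le> norm x"
      proof -
        have "(norm x)\<^sup>2 = (norm (y + (v \<bullet> x) *\<^sub>R v))\<^sup>2" by (simp add: y_def)
        also have "\<dots> = (norm y)\<^sup>2 + (v \<bullet> x)\<^sup>2"
          using v yT unfolding power2_norm_eq_inner
          by (simp add: T_def inner_add_left inner_add_right inner_commute[of y v] norm_eq_1 power2_eq_square[of "v \<bullet> x"])
        finally have "(norm y)\<^sup>2 \<le> (norm x)\<^sup>2" by simp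
        then show ?thesis by (rule power2_le_imp_le) simp
      qed
      ultimately show ?thesis using maxw[OF yT] t by (metis t_def mult_left_mono less_imp_le order_trans)
    qed
    have "ln (singular_values A ! 0) \<le> ln s" using sv s t by simp
    moreover have "ln t \<le> ln (singular_values A ! 1)" using sv t by simp
    ultimately show "ln (singular_values A ! 0) - ln (singular_values A ! 1) \<le> ln s - ln t" by linarith
  qed
qed

section \<open>The group PSL\<close>

lemma mat_mult_left: "mat c ** A = c *\<^sub>R A" for A :: "real^'n^'m"
  by (simp add: vec_eq_iff matrix_matrix_mult_def mat_def if_distrib[of "\<lambda>y. y * _"] cong: if_cong)

lemma mat_mult_right: "A ** mat c = c *\<^sub>R A" for A :: "real^'n^'m"
  by (simp add: vec_eq_iff matrix_matrix_mult_def mat_def if_distrib[of "\<lambda>y. _ * y"] cong: if_cong)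

lemma det_mat_eq_1:
  assumes "det (mat c :: real^'n^'n) = 1"
  shows "\<bar>c\<bar> = 1"
proof -
  have "det (mat c :: real^'n^'n) = c ^ CARD('n)"
    by (subst det_diagonal) (simp_all add: mat_def)
  then have "\<bar>c\<bar> ^ CARD('n) = 1 ^ CARD('n)" using assms by (simp add: power_abs[symmetric])
  then show ?thesis by (rule power_eq_imp_eq_base) simp_all
qed

lemma group_SL: "group (SL :: (real^'n^'n) monoid)"
proof (rule groupI)
  fix A :: "real^'n^'n" assume "A \<in> carrier SL"
  then have d: "det A = 1" by (simp add: SL_def)
  then obtain B where B: "B ** A = mat 1"
    using invertible_det_nz[of A] invertible_left_inverse[of A] by auto
  have "det B * det A = 1" using arg_cong[OF B, of det] by (simp add: det_mul)
  then show "\<exists>B\<in>carrier SL. B \<otimes>\<^bsub>SL\<^esub> A = \<one>\<^bsub>SL\<^esub>" using B d by (auto simp: SL_def)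
qed (auto simp: SL_def det_mul matrix_mul_assoc)

lemma scalars_mem: "A \<in> SL_scalars \<longleftrightarrow> (\<exists>c. det (mat c :: real^'n^'n) = 1 \<and> A = mat c)" for A :: "real^'n^'n"
  by (auto simp: SL_scalars_def SL_def)

lemma normal_SL_scalars: "normal SL_scalars (SL :: (real^'n^'n) monoid)"
proof -
  interpret group "SL :: (real^'n^'n) monoid" by (rule group_SL)
  have mult: "A \<otimes>\<^bsub>SL\<^esub> B = A ** B" and one: "\<one>\<^bsub>SL\<^esub> = mat 1" for A B :: "real^'n^'n" by (simp_all add: SL_def)
  have sub: "subgroup SL_scalars (SL :: (real^'n^'n) monoid)"
  proof (rule subgroupI)
    show "SL_scalars \<subseteq> carrier (SL :: (real^'n^'n) monoid)" by (auto simp: SL_scalars_def)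
    have "mat 1 \<in> (SL_scalars :: (real^'n^'n) set)" unfolding scalars_mem by (rule exI[of _ 1]) simp
    then show "(SL_scalars :: (real^'n^'n) set) \<noteq> {}" by blast
    fix A :: "real^'n^'n" assume A: "A \<in> SL_scalars"
    then obtain c where c: "det (mat c :: real^'n^'n) = 1" "A = mat c" by (auto simp: scalars_mem)
    have "c * c = 1" using det_mat_eq_1[OF c(1)] by (metis abs_mult_self_eq mult_1)
    then have AA: "A ** A = mat 1" by (simp add: c(2) mat_mult_left) (simp add: vec_eq_iff mat_def)
    have "A \<in> carrier SL" using A by (simp add: SL_scalars_def)
    then have "inv\<^bsub>SL\<^esub> A = A" using AA by (intro inv_equality) (simp_all add: mult one)
    then show "inv\<^bsub>SL\<^esub> A \<in> SL_scalars" using A by simp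
    fix B :: "real^'n^'n" assume "B \<in> SL_scalars"
    then obtain b where b: "det (mat b :: real^'n^'n) = 1" "B = mat b" by (auto simp: scalars_mem)
    have "A ** B = mat (c * b)" by (simp add: c b mat_mult_left) (simp add: vec_eq_iff mat_def)
    moreover have "det (A ** B) = 1" using b c by (simp add: det_mul)
    ultimately show "A \<otimes>\<^bsub>SL\<^esub> B \<in> SL_scalars" by (auto simp: mult scalars_mem)
  qed
  moreover have "x \<otimes>\<^bsub>SL\<^esub> h \<otimes>\<^bsub>SL\<^esub> inv\<^bsub>SL\<^esub> x \<in> SL_scalars"
    if x: "x \<in> carrier SL" and h: "h \<in> SL_scalars" for x h :: "real^'n^'n"
  proof -
    obtain c where c: "h = mat c" using h by (auto simp: scalars_mem)
    have h': "h \<in> carrier SL" using h by (simp add: SL_scalars_def)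
    have "x \<otimes>\<^bsub>SL\<^esub> h = h \<otimes>\<^bsub>SL\<^esub> x" by (simp add: mult c mat_mult_left mat_mult_right)
    then have "x \<otimes>\<^bsub>SL\<^esub> h \<otimes>\<^bsub>SL\<^esub> inv\<^bsub>SL\<^esub> x = h" using x h' by (simp add: m_assoc)
    then show ?thesis using h by simp
  qed
  ultimately show ?thesis using normal_inv_iff by blast
qed

lemma group_PSL: "group (PSL :: (real^'n^'n) set monoid)"
  unfolding PSL_def by (rule normal.factorgroup_is_group[OF normal_SL_scalars])

lemma mem_proj_class:
  "B \<in> proj_class A \<longleftrightarrow> (\<exists>c. det (mat c :: real^'n^'n) = 1 \<and> B = c *\<^sub>R A)" for A B :: "real^'n^'n"
proof -
  have "B \<in> proj_class A \<longleftrightarrow> (\<exists>h\<in>SL_scalars. B = h ** A)"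
    by (auto simp: proj_class_def r_coset_def SL_def)
  then show ?thesis unfolding Bex_def scalars_mem by (metis mat_mult_left)
qed

lemma proj_class_self: "A \<in> proj_class A" for A :: "real^'n^'n"
  unfolding mem_proj_class by (rule exI[of _ 1]) simp

lemma proj_class_sign:
  fixes A B :: "real^'n^'n"
  assumes "B \<in> proj_class A"
  shows "B = A \<or> B = - A"
proof -
  obtain c where "det (mat c :: real^'n^'n) = 1" "B = c *\<^sub>R A" using assms by (auto simp: mem_proj_class)
  moreover from this have "c = 1 \<or> c = -1" using det_mat_eq_1 by (metis abs_1 abs_eq_iff)
  ultimately show ?thesis by auto
qed

lemma proj_class_mult:
  fixes A B :: "real^'n^'n"
  assumes "det A = 1" "det B = 1"
  shows "proj_class A \<otimes>\<^bsub>PSL\<^esub> proj_class B = proj_class (A ** B)"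
  using normal.rcos_sum[OF normal_SL_scalars, of A B] assms
  by (simp add: PSL_def FactGroup_def proj_class_def SL_def)

text \<open>Products of arbitrarily chosen representatives can be followed inside the classes, with
  no record of their signs.\<close>

lemma PSL_mult_mem: "A \<in> g \<Longrightarrow> B \<in> h \<Longrightarrow> A ** B \<in> g \<otimes>\<^bsub>PSL\<^esub> h"
  by (auto simp: PSL_def FactGroup_def set_mult_def SL_def)

lemma PSL_one_mem: "mat 1 \<in> \<one>\<^bsub>PSL\<^esub>"
  unfolding PSL_def FactGroup_def by (simp add: scalars_mem) (rule exI[of _ 1], simp)

lemma PSL_repr:
  fixes A :: "real^'n^'n"
  assumes "g \<in> carrier PSL" "A \<in> g"
  shows "det A = 1" "g = proj_class A"
proof -
  obtain B where B: "det B = 1" "g = proj_class B"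
    using assms(1) by (auto simp: PSL_def FactGroup_def RCOSETS_def proj_class_def SL_def)
  obtain c where c: "det (mat c :: real^'n^'n) = 1" "A = c *\<^sub>R B" using assms B by (auto simp: mem_proj_class)
  have "A = mat c ** B" by (simp add: c mat_mult_left)
  then show "det A = 1" using B c by (simp add: det_mul)
  interpret group "SL :: (real^'n^'n) monoid" by (rule group_SL)
  have "SL_scalars #>\<^bsub>SL\<^esub> B = SL_scalars #>\<^bsub>SL\<^esub> A"
    using assms B normal_imp_subgroup[OF normal_SL_scalars]
    by (intro repr_independence) (simp_all add: proj_class_def, simp add: SL_def)
  then show "g = proj_class A" using B by (simp add: proj_class_def)
qed

lemma PSL_nonempty:
  fixes g :: "(real^'n^'n) set"
  assumes "g \<in> carrier PSL"
  shows "\<exists>A. A \<in> g"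
proof -
  obtain B :: "real^'n^'n" where "g = proj_class B"
    using assms by (auto simp: PSL_def FactGroup_def RCOSETS_def proj_class_def)
  then show ?thesis using proj_class_self by blast
qed

lemma singular_values_uminus: "singular_values (- A) = singular_values A"
proof -
  have "transpose (- A) ** (- A) = transpose A ** A"
    by (simp add: vec_eq_iff matrix_matrix_mult_def transpose_def)
  then show ?thesis by (simp add: singular_values_def)
qed

lemma log_sv_eq:
  fixes A :: "real^'n^'n"
  assumes "g \<in> carrier PSL" "A \<in> g"
  shows "log_sv i g = ln (singular_values A ! (i - 1))"
proof -
  have "singular_values B = singular_values A" if "B \<in> g" for B
    using proj_class_sign[of B A] that PSL_repr[OF assms] singular_values_uminus[of A] by auto
  then have "(\<lambda>A. ln (singular_values A ! (i - 1))) ` g = (\<lambda>_. ln (singular_values A ! (i - 1))) ` g"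
    by (intro image_cong) simp_all
  also have "\<dots> = {ln (singular_values A ! (i - 1))}" using assms(2) by (rule image_constant)
  finally have "(\<lambda>A. ln (singular_values A ! (i - 1))) ` g = {ln (singular_values A ! (i - 1))}" .
  then show ?thesis by (simp add: log_sv_def)
qed

section \<open>Isometries of the form\<close>

lemma sum_Plus_UNIV: "(\<Sum>k\<in>(UNIV :: ('p::finite + 'q::finite) set). f k) = (\<Sum>i\<in>UNIV. f (Inl i)) + (\<Sum>j\<in>UNIV. f (Inr j))"
  by (simp add: UNIV_Plus_UNIV[symmetric] sum.Plus del: UNIV_Plus_UNIV)

text \<open>The signature matrix as a map. It turns the form into the standard inner product, and
  the adjoint for the form into a conjugate of the transpose.\<close>

definition pq_flip :: "real^('p::finite + 'q::finite) \<Rightarrow> real^('p + 'q)" where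
  "pq_flip x = (\<chi> k. case k of Inl _ \<Rightarrow> x $ k | Inr _ \<Rightarrow> - x $ k)"

lemma pq_form_eq_inner: "pq_form x y = x \<bullet> pq_flip y"
  by (simp add: pq_form_def inner_vec_def pq_flip_def sum_Plus_UNIV sum_negf)

lemma pq_flip_flip [simp]: "pq_flip (pq_flip x) = x"
  by (simp add: vec_eq_iff pq_flip_def split: sum.split)

lemma linear_pq_flip: "linear pq_flip"
  by (rule linearI) (simp_all add: vec_eq_iff pq_flip_def split: sum.split)

lemma norm_pq_flip [simp]: "norm (pq_flip x) = norm x"
proof -
  have "pq_flip x \<bullet> pq_flip x = x \<bullet> x"
    by (simp add: inner_vec_def pq_flip_def sum_Plus_UNIV)
  then show ?thesis by (simp add: norm_eq_sqrt_inner)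
qed

lemma pq_form_commute: "pq_form x y = pq_form y x"
  by (simp add: pq_form_def mult.commute)

lemma pq_form_linear [simp]:
  "pq_form (x + x') y = pq_form x y + pq_form x' y" "pq_form x (y + y') = pq_form x y + pq_form x y'"
  "pq_form (x - x') y = pq_form x y - pq_form x' y" "pq_form x (y - y') = pq_form x y - pq_form x y'"
  "pq_form (c *\<^sub>R x) y = c * pq_form x y" "pq_form x (c *\<^sub>R y) = c * pq_form x y"
  "pq_form (- x) y = - pq_form x y" "pq_form x (- y) = - pq_form x y"
  "pq_form 0 y = 0" "pq_form x 0 = 0"
  by (simp_all add: pq_form_eq_inner inner_add_left inner_add_right inner_diff_left inner_diff_right
    linear_add[OF linear_pq_flip] linear_diff[OF linear_pq_flip] linear_cmul[OF linear_pq_flip]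
    linear_neg[OF linear_pq_flip] linear_0[OF linear_pq_flip])

lemma pq_form_nondegenerate: "(\<And>y. pq_form x y = 0) \<Longrightarrow> x = 0"
  using pq_form_eq_inner[of x "pq_flip x"] by simp

lemma pq_form_nondegenerate_eq: "(\<And>y. pq_form x y = pq_form x' y) \<Longrightarrow> x = x'"
  using pq_form_nondegenerate[of "x - x'"] by simp

lemma subspace_pq_orth: "subspace (pq_orth V)"
  by (auto simp: subspace_def pq_orth_def)

definition pq_isometry :: "real^('p::finite + 'q::finite)^('p + 'q) \<Rightarrow> bool" where
  "pq_isometry A \<longleftrightarrow> (\<forall>x y. pq_form (A *v x) (A *v y) = pq_form x y)"

lemma pq_isometry_mult: "pq_isometry A \<Longrightarrow> pq_isometry B \<Longrightarrow> pq_isometry (A ** B)"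
  by (simp add: pq_isometry_def matrix_vector_mul_assoc[symmetric])

lemma pq_isometry_id: "pq_isometry (mat 1)"
  by (simp add: pq_isometry_def)

lemma pq_isometry_inverse:
  assumes "pq_isometry A" "A ** B = mat 1"
  shows "pq_isometry B"
  unfolding pq_isometry_def
proof (intro allI)
  fix x y
  have "pq_form (A *v (B *v x)) (A *v (B *v y)) = pq_form (B *v x) (B *v y)"
    using assms(1) unfolding pq_isometry_def by blast
  then show "pq_form (B *v x) (B *v y) = pq_form x y"
    by (simp add: matrix_vector_mul_assoc assms(2))
qed

text \<open>The signature matrix conjugates the transpose of an isometry into its inverse; since it
  preserves the Euclidean norm, the inverse is no larger than the isometry itself.\<close>

lemma pq_isometry_transpose:
  assumes "pq_isometry A"
  shows "pq_flip (transpose A *v (pq_flip (A *v x))) = x"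
proof (rule pq_form_nondegenerate_eq)
  fix y
  have "pq_form (pq_flip (transpose A *v (pq_flip (A *v x)))) y = y \<bullet> (transpose A *v (pq_flip (A *v x)))"
    by (subst pq_form_commute) (simp add: pq_form_eq_inner)
  also have "\<dots> = (pq_flip (A *v x) v* A) \<bullet> y"
    by (simp add: inner_commute)
  also have "\<dots> = pq_flip (A *v x) \<bullet> (A *v y)" by (rule dot_lmul_matrix)
  also have "\<dots> = pq_form (A *v y) (A *v x)" by (simp add: pq_form_eq_inner inner_commute)
  also have "\<dots> = pq_form x y" using assms by (simp add: pq_isometry_def pq_form_commute)
  finally show "pq_form (pq_flip (transpose A *v (pq_flip (A *v x)))) y = pq_form x y" .
qed

lemma det_pq_isometry:
  fixes A :: "real^('p::finite + 'q::finite)^('p + 'q)"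
  assumes "pq_isometry A"
  shows "det A = 1 \<or> det A = -1"
proof -
  let ?F = "matrix pq_flip :: real^('p + 'q)^('p + 'q)"
  have F: "?F *v x = pq_flip x" for x by (rule matrix_works) (simp add: linear_matrix_vector_mul_eq linear_pq_flip)
  have "(?F ** transpose A ** ?F ** A) *v x = mat 1 *v x" for x
    by (simp only: F matrix_vector_mul_assoc[symmetric] pq_isometry_transpose[OF assms] matrix_vector_mul_lid)
  then have "?F ** transpose A ** ?F ** A = mat 1" unfolding matrix_eq by blast
  from arg_cong[OF this, of det] have "(det ?F * det ?F) * (det A * det A) = 1" by (simp add: det_mul ac_simps)
  moreover have "det ?F * det ?F = 1"
  proof -
    have "(?F ** ?F) *v x = mat 1 *v x" for x
      by (simp only: F matrix_vector_mul_assoc[symmetric] pq_flip_flip matrix_vector_mul_lid)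
    then have "?F ** ?F = mat 1" unfolding matrix_eq by blast
    from arg_cong[OF this, of det] show ?thesis by (simp add: det_mul)
  qed
  ultimately have "(det A)\<^sup>2 = 1" by (simp add: power2_eq_square)
  then show ?thesis by (simp add: power2_eq_1_iff)
qed

lemma PSO_iff: "g \<in> PSO \<longleftrightarrow> (\<exists>A. det A = 1 \<and> pq_isometry A \<and> g = proj_class A)"
  by (auto simp: PSO_def pq_isometry_def SL_def)

lemma PSO_repr:
  assumes "g \<in> PSO" "A \<in> g"
  shows "det A = 1" "pq_isometry A" "g = proj_class A"
proof -
  obtain B where B: "det B = 1" "pq_isometry B" "g = proj_class B" using assms by (auto simp: PSO_iff)
  have "g \<in> carrier PSL"
    using B by (auto simp: PSL_def FactGroup_def RCOSETS_def proj_class_def SL_def)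
  then show "det A = 1" "g = proj_class A" using PSL_repr assms by blast+
  have "A = B \<or> A = - B" using assms B proj_class_sign by blast
  moreover have "(- B) *v x = - (B *v x)" for x
    by (simp add: vec_eq_iff matrix_vector_mult_def sum_negf)
  ultimately show "pq_isometry A" using B by (auto simp: pq_isometry_def)
qed

section \<open>Reflections and their determinant\<close>

lemma det_row_replaced: "det (\<chi> i. if i = k then \<phi> else axis i 1 :: real^'n^'n) = \<phi> $ k"
proof -
  have comb: "(\<Sum>i\<in>UNIV. \<phi> $ i *s row i (mat 1 :: real^'n^'n)) = \<phi>"
    by (simp add: vec_eq_iff row_def mat_def if_distrib[of "\<lambda>y. _ * y"] cong: if_cong)
  have row: "row i (mat 1 :: real^'n^'n) = axis i 1" for i
    by (auto simp: vec_eq_iff row_def mat_def axis_def)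
  show ?thesis using cramer_lemma_transpose[of k \<phi> "mat 1"] unfolding comb unfolding row by simp
qed

text \<open>The combination of the rows with coefficients \<phi> is
  \<open>(1 + \<phi> \<bullet> x)\<close> times \<phi>. Putting it into row \<open>k\<close> splits
  off that factor, and what is left is the product of a matrix of determinant 1 with one of
  determinant \<open>\<phi> $ k\<close>.\<close>

lemma det_mat_1_plus_rank_one:
  fixes x \<phi> :: "real^'n"
  shows "det (\<chi> i. axis i 1 + x $ i *\<^sub>R \<phi>) = 1 + \<phi> \<bullet> x"
proof (cases "\<phi> = 0")
  case True
  have "(\<chi> i. axis i 1) = (mat 1 :: real^'n^'n)" by (auto simp: vec_eq_iff mat_def axis_def)
  then show ?thesis using True by simp
next
  case False
  then obtain k where k: "\<phi> $ k \<noteq> 0" by (metis vec_eq_iff zero_index)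
  let ?M = "(\<chi> i. axis i 1 + x $ i *\<^sub>R \<phi>) :: real^'n^'n"
  let ?Q = "(\<chi> i. if i = k then \<phi> else axis i 1) :: real^'n^'n"
  let ?x = "(\<chi> i. if i = k then 1 else x $ i) :: real^'n"
  let ?N = "transpose (\<chi> i. if i = k then ?x else axis i 1) :: real^'n^'n"
  have comb: "(\<Sum>i\<in>UNIV. \<phi> $ i *s row i ?M) = (1 + \<phi> \<bullet> x) *s \<phi>"
    by (simp add: vec_eq_iff row_def axis_def inner_vec_def distrib_left distrib_right sum.distrib
      sum_distrib_right mult.assoc if_distrib[of "\<lambda>y. _ * y"] cong: if_cong)
  have "\<phi> $ k * det ?M = det (\<chi> i. if i = k then (\<Sum>i\<in>UNIV. \<phi> $ i *s row i ?M) else row i ?M)"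
    by (rule cramer_lemma_transpose[symmetric])
  also have "\<dots> = (1 + \<phi> \<bullet> x) * det (\<chi> i. if i = k then \<phi> else row i ?M)"
    unfolding comb by (rule det_row_mul)
  also have "(\<chi> i. if i = k then \<phi> else row i ?M) = ?N ** ?Q"
  proof -
    have "(?N ** ?Q) $ i $ j = (if i = k then \<phi> else row i ?M) $ j" for i j
    proof -
      have "(?N ** ?Q) $ i $ j = (\<Sum>l\<in>UNIV. (if l = k then ?x $ i * \<phi> $ j else if l = i \<and> l = j then 1 else 0))"
        by (auto simp: matrix_matrix_mult_def transpose_def axis_def intro!: sum.cong)
      also have "\<dots> = (\<Sum>l\<in>UNIV. (if l = k then ?x $ i * \<phi> $ j else 0) + (if l = i then (if i = j \<and> i \<noteq> k then 1 else 0) else 0))"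
        by (intro sum.cong) auto
      also have "\<dots> = ?x $ i * \<phi> $ j + (if i = j \<and> i \<noteq> k then 1 else 0)"
        by (simp add: sum.distrib)
      also have "\<dots> = (if i = k then \<phi> else row i ?M) $ j"
        by (auto simp: row_def axis_def)
      finally show ?thesis .
    qed
    then show ?thesis by (simp add: vec_eq_iff)
  qed
  also have "det (?N ** ?Q) = \<phi> $ k"
    by (simp add: det_mul det_row_replaced)
  finally show ?thesis using k by simp
qed

text \<open>The reflection in the hyperplane orthogonal to \<open>z\<close>, written as the identity
  plus a rank one matrix so that the determinant formula applies.\<close>

definition pq_reflection :: "real^('p::finite + 'q::finite) \<Rightarrow> real^('p + 'q)^('p + 'q)" where
  "pq_reflection z = (\<chi> i. axis i 1 + z $ i *\<^sub>R ((- 2 / pq_form z z) *\<^sub>R pq_flip z))"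

lemma pq_reflection_apply: "pq_reflection z *v x = x - (2 * pq_form x z / pq_form z z) *\<^sub>R z"
proof -
  have "(pq_reflection z *v x) $ i = (x - (2 * pq_form x z / pq_form z z) *\<^sub>R z) $ i" for i
    by (simp add: pq_reflection_def matrix_vector_mul_component inner_add_left inner_diff_left inner_axis' pq_form_eq_inner[of x]
      inner_commute[of "pq_flip z"])
  then show ?thesis by (simp add: vec_eq_iff)
qed

lemma det_pq_reflection: "pq_form z z \<noteq> 0 \<Longrightarrow> det (pq_reflection z) = -1"
  unfolding pq_reflection_def det_mat_1_plus_rank_one
  by (simp add: pq_form_eq_inner inner_commute[of "pq_flip z"])

lemma pq_isometry_reflection:
  assumes "pq_form z z \<noteq> 0"
  shows "pq_isometry (pq_reflection z)"
  unfolding pq_isometry_def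
proof (intro allI)
  fix x y
  define a b n where "a = pq_form x z" and "b = pq_form y z" and "n = pq_form z z"
  have "pq_form (pq_reflection z *v x) (pq_reflection z *v y)
      = pq_form x y - (2 * b / n) * a - ((2 * a / n) * b - (2 * a / n) * ((2 * b / n) * n))"
    using pq_form_commute[of z y] by (simp add: pq_reflection_apply a_def b_def n_def right_diff_distrib)
  also have "\<dots> = pq_form x y" using assms by (simp add: n_def[symmetric] field_simps)
  finally show "pq_form (pq_reflection z *v x) (pq_reflection z *v y) = pq_form x y" .
qed

lemma pq_reflection_swap:
  assumes "pq_form a a = pq_form b b" "pq_form (a - b) (a - b) \<noteq> 0"
  shows "pq_reflection (a - b) *v a = b"
proof -
  have "2 * pq_form a (a - b) = pq_form (a - b) (a - b)"
    using assms(1) by (simp add: pq_form_commute[of b a])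
  then show ?thesis using assms(2) by (simp add: pq_reflection_apply)
qed

section \<open>Negative definite subspaces\<close>

lemma X_G_D:
  fixes \<tau> :: "(real^('p::finite + 'q::finite)) set"
  assumes "\<tau> \<in> X_G"
  shows "subspace \<tau>" "dim \<tau> = CARD('q)" "x \<in> \<tau> \<Longrightarrow> x \<noteq> 0 \<Longrightarrow> pq_form x x < 0"
  using assms by (simp_all add: X_G_def)

text \<open>The complement has complementary dimension because the form is nondegenerate, and it
  meets \<tau> trivially because \<tau> is definite.\<close>

lemma X_G_decomp:
  fixes \<tau> :: "(real^('p::finite + 'q::finite)) set"
  assumes \<tau>: "\<tau> \<in> X_G"
  shows "\<exists>a\<in>\<tau>. x - a \<in> pq_orth \<tau>"
proof -
  have "linear (pq_flip :: real^('p + 'q) \<Rightarrow> _)" by (rule linear_pq_flip)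
  moreover have "inj (pq_flip :: real^('p + 'q) \<Rightarrow> _)" by (rule inj_on_inverseI[of _ pq_flip]) simp
  ultimately have "dim (pq_flip ` \<tau>) = dim \<tau>" by (intro dim_image_eq) (auto intro: inj_on_subset)
  moreover have "pq_orth \<tau> = {y \<in> UNIV. \<forall>x\<in>pq_flip ` \<tau>. orthogonal x y}"
    by (auto simp: pq_orth_def orthogonal_def pq_form_eq_inner inner_commute)
  moreover have "dim {y \<in> UNIV. \<forall>x\<in>pq_flip ` \<tau>. orthogonal x y} + dim (pq_flip ` \<tau>) = dim (UNIV :: (real^('p + 'q)) set)"
    using dim_subspace_orthogonal_to_vectors[of "pq_flip ` \<tau>" UNIV]
      linear_subspace_image[OF linear_pq_flip X_G_D(1)[OF \<tau>]] by simp
  ultimately have dims: "dim (pq_orth \<tau>) + dim \<tau> = dim (UNIV :: (real^('p + 'q)) set)" by simp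
  have "\<tau> \<inter> pq_orth \<tau> \<subseteq> {0}"
    using X_G_D(3)[OF \<tau>] by (force simp: pq_orth_def)
  then have "dim (\<tau> \<inter> pq_orth \<tau>) = 0" using dim_eq_0 by blast
  then have "dim {x + y |x y. x \<in> \<tau> \<and> y \<in> pq_orth \<tau>} = dim (UNIV :: (real^('p + 'q)) set)"
    using dim_sums_Int[OF X_G_D(1)[OF \<tau>] subspace_pq_orth[of \<tau>]] dims by linarith
  then have "span {x + y |x y. x \<in> \<tau> \<and> y \<in> pq_orth \<tau>} = UNIV"
    using dim_eq_full[of "{x + y |x y. x \<in> \<tau> \<and> y \<in> pq_orth \<tau>}"] by simp
  moreover have "span {x + y |x y. x \<in> \<tau> \<and> y \<in> pq_orth \<tau>} = {x + y |x y. x \<in> \<tau> \<and> y \<in> pq_orth \<tau>}"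
    unfolding span_eq_iff by (rule subspace_sums[OF X_G_D(1)[OF \<tau>] subspace_pq_orth])
  ultimately have "x \<in> {x + y |x y. x \<in> \<tau> \<and> y \<in> pq_orth \<tau>}" by blast
  then obtain a b where "a \<in> \<tau>" "b \<in> pq_orth \<tau>" "x = a + b" by blast
  then show ?thesis by (intro bexI[of _ a]) simp_all
qed

definition pq_proj :: "(real^('p::finite + 'q::finite)) set \<Rightarrow> real^('p + 'q) \<Rightarrow> real^('p + 'q)" where
  "pq_proj \<tau> x = (THE a. a \<in> \<tau> \<and> x - a \<in> pq_orth \<tau>)"

lemma pq_proj_unique:
  assumes \<tau>: "\<tau> \<in> X_G" and "a \<in> \<tau>" "x - a \<in> pq_orth \<tau>"
  shows "pq_proj \<tau> x = a"
  unfolding pq_proj_def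
proof (rule the_equality)
  fix b assume b: "b \<in> \<tau> \<and> x - b \<in> pq_orth \<tau>"
  have "b - a \<in> \<tau>" using b assms X_G_D(1) subspace_diff by blast
  moreover have "(x - a) - (x - b) \<in> pq_orth \<tau>" using b assms(3) subspace_diff[OF subspace_pq_orth] by blast
  then have "b - a \<in> pq_orth \<tau>" by simp
  ultimately have "pq_form (b - a) (b - a) = 0" by (simp only: pq_orth_def mem_Collect_eq)
  then show "b = a" using X_G_D(3)[OF \<tau> \<open>b - a \<in> \<tau>\<close>] by fastforce
qed (use assms in auto)

lemma pq_proj:
  assumes "\<tau> \<in> X_G"
  shows "pq_proj \<tau> x \<in> \<tau>" "x - pq_proj \<tau> x \<in> pq_orth \<tau>"
  using X_G_decomp[OF assms, of x] pq_proj_unique[OF assms] by auto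

lemma pq_proj_in: "\<tau> \<in> X_G \<Longrightarrow> x \<in> \<tau> \<Longrightarrow> pq_proj \<tau> x = x"
  by (rule pq_proj_unique) (auto simp: subspace_0[OF subspace_pq_orth])

lemma pq_proj_orth: "\<tau> \<in> X_G \<Longrightarrow> x \<in> pq_orth \<tau> \<Longrightarrow> pq_proj \<tau> x = 0"
  by (rule pq_proj_unique) (auto simp: subspace_0 X_G_D(1))

lemma linear_pq_proj:
  assumes \<tau>: "\<tau> \<in> X_G"
  shows "linear (pq_proj \<tau>)"
proof (rule linearI)
  fix x y
  have "(x - pq_proj \<tau> x) + (y - pq_proj \<tau> y) \<in> pq_orth \<tau>"
    by (intro subspace_add subspace_pq_orth pq_proj \<tau>)
  then show "pq_proj \<tau> (x + y) = pq_proj \<tau> x + pq_proj \<tau> y"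
    by (intro pq_proj_unique \<tau> subspace_add X_G_D(1)[OF \<tau>] pq_proj) (simp add: algebra_simps)
next
  fix c x
  have "c *\<^sub>R (x - pq_proj \<tau> x) \<in> pq_orth \<tau>"
    by (intro subspace_scale subspace_pq_orth pq_proj \<tau>)
  then show "pq_proj \<tau> (c *\<^sub>R x) = c *\<^sub>R pq_proj \<tau> x"
    by (intro pq_proj_unique \<tau> subspace_scale X_G_D(1)[OF \<tau>] pq_proj) (simp add: algebra_simps)
qed

lemma pq_form_orthD: "x \<in> \<tau> \<Longrightarrow> y \<in> pq_orth \<tau> \<Longrightarrow> pq_form x y = 0"
  "x \<in> \<tau> \<Longrightarrow> y \<in> pq_orth \<tau> \<Longrightarrow> pq_form y x = 0"
  by (auto simp: pq_orth_def pq_form_commute)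

text \<open>Bilinearity and the prescribed values on the blocks of \<tau> and its complement
  determine the form, which makes the definite description in \<open>tau_inner\<close>
  usable.\<close>

lemma tau_inner_eq:
  assumes \<tau>: "\<tau> \<in> X_G"
  shows "tau_inner \<tau> x y = pq_form (x - pq_proj \<tau> x) (y - pq_proj \<tau> y) - pq_form (pq_proj \<tau> x) (pq_proj \<tau> y)"
proof -
  define B0 where "B0 x y = pq_form (x - pq_proj \<tau> x) (y - pq_proj \<tau> y) - pq_form (pq_proj \<tau> x) (pq_proj \<tau> y)" for x y
  let ?P = "\<lambda>B. bilinear B \<and>
     (\<forall>x\<in>\<tau>. \<forall>y\<in>\<tau>. B x y = - pq_form x y) \<and>
     (\<forall>x\<in>pq_orth \<tau>. \<forall>y\<in>pq_orth \<tau>. B x y = pq_form x y) \<and>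
     (\<forall>x\<in>\<tau>. \<forall>y\<in>pq_orth \<tau>. B x y = 0 \<and> B y x = 0)"
  note lin = linear_add[OF linear_pq_proj[OF \<tau>]] linear_cmul[OF linear_pq_proj[OF \<tau>]]
  have B0: "?P B0"
  proof (intro conjI ballI)
    show "bilinear B0"
      unfolding bilinear_def by (intro conjI allI linearI; simp add: B0_def lin algebra_simps)
  qed (simp_all add: B0_def pq_proj_in[OF \<tau>] pq_proj_orth[OF \<tau>] pq_form_orthD)
  have "tau_inner \<tau> = B0"
    unfolding tau_inner_def
  proof (rule the_equality[of ?P, OF B0])
    fix B assume B: "?P B"
    then have bil: "bilinear B" by blast
    show "B = B0"
    proof (intro ext)
      fix x y
      let ?a = "pq_proj \<tau> x" and ?b = "x - pq_proj \<tau> x" and ?c = "pq_proj \<tau> y" and ?d = "y - pq_proj \<tau> y"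
      have "B x y = B (?a + ?b) (?c + ?d)" by simp
      also have "\<dots> = B ?a ?c + B ?a ?d + (B ?b ?c + B ?b ?d)"
        by (simp only: bilinear_ladd[OF bil] bilinear_radd[OF bil])
      also have "\<dots> = - pq_form ?a ?c + 0 + (0 + pq_form ?b ?d)"
        using B pq_proj[OF \<tau>] by metis
      finally show "B x y = B0 x y" by (simp add: B0_def)
    qed
  qed
  then show ?thesis by (simp add: B0_def)
qed

text \<open>Sylvester's argument: otherwise \<open>y\<close> and \<tau> would span a nonpositive
  subspace of dimension \<open>CARD('q) + 1\<close>, which must meet the positive definite space
  where the last \<open>CARD('q)\<close> coordinates vanish.\<close>

lemma pq_form_pos:
  fixes \<tau> :: "(real^('p::finite + 'q::finite)) set"
  assumes \<tau>: "\<tau> \<in> X_G" and y: "y \<in> pq_orth \<tau>" "y \<noteq> 0"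
  shows "pq_form y y > 0"
proof (rule ccontr)
  assume neg: "\<not> ?thesis"
  define N :: "real^('p + 'q) \<Rightarrow> real^'q" where "N x = (\<chi> j. x $ Inr j)" for x
  have linN: "linear N" by (rule linearI) (simp_all add: N_def vec_eq_iff)
  have "y \<notin> \<tau>" using y X_G_D(3)[OF \<tau>] by (force simp: pq_orth_def)
  then have dimW: "dim (span (insert y \<tau>)) = CARD('q) + 1"
    using X_G_D[OF \<tau>] by (simp add: dim_insert span_eq_iff[THEN iffD2])
  have "\<not> inj_on N (span (insert y \<tau>))"
  proof
    assume "inj_on N (span (insert y \<tau>))"
    then have "dim (N ` span (insert y \<tau>)) = CARD('q) + 1"
      using dim_image_eq[OF linN, of "span (insert y \<tau>)"] dimW by (simp add: span_span)
    moreover have "dim (N ` span (insert y \<tau>)) \<le> CARD('q)" by (rule order_trans[OF dim_subset_UNIV]) simp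
    ultimately show False by simp
  qed
  then obtain w where w: "w \<in> span (insert y \<tau>)" "w \<noteq> 0" "N w = 0"
    using linear_inj_on_iff_eq_0[OF linN subspace_span, of "insert y \<tau>"] by blast
  have Inr: "w $ Inr j = 0" for j using w(3) by (simp add: N_def vec_eq_iff)
  have "pq_form w w = w \<bullet> w" by (simp add: pq_form_def inner_vec_def sum_Plus_UNIV Inr)
  then have "pq_form w w > 0" using w(2) by simp
  moreover have "pq_form w w \<le> 0"
  proof -
    obtain c where c: "w - c *\<^sub>R y \<in> span \<tau>" using w(1) unfolding span_insert by blast
    define a where "a = w - c *\<^sub>R y"
    have a: "a \<in> \<tau>" using c X_G_D(1)[OF \<tau>] by (simp add: a_def span_eq_iff[THEN iffD2])
    have "w = a + c *\<^sub>R y" by (simp add: a_def)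
    then have "pq_form w w = pq_form a a + c\<^sup>2 * pq_form y y"
      using pq_form_orthD[OF a y(1)] by (simp add: power2_eq_square)
    moreover have "pq_form a a \<le> 0" using X_G_D(3)[OF \<tau> a] by (cases "a = 0") auto
    moreover have "c\<^sup>2 * pq_form y y \<le> 0" using neg by (simp add: mult_nonneg_nonpos)
    ultimately show ?thesis by simp
  qed
  ultimately show False by simp
qed

text \<open>A positive continuous function has a positive minimum on the sphere. This converts
  bounds for the \<tau>-norm into Euclidean ones.\<close>

lemma tau_inner_coercive:
  fixes \<tau> :: "(real^('p::finite + 'q::finite)) set"
  assumes \<tau>: "\<tau> \<in> X_G"
  shows "\<exists>c>0. \<forall>x. c * (norm x)\<^sup>2 \<le> tau_inner \<tau> x x"
proof -
  define Q where "Q x = tau_inner \<tau> x x" for x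
  have lin: "linear (pq_proj \<tau>)" by (rule linear_pq_proj[OF \<tau>])
  have Q: "Q x = (x - pq_proj \<tau> x) \<bullet> pq_flip (x - pq_proj \<tau> x) - pq_proj \<tau> x \<bullet> pq_flip (pq_proj \<tau> x)" for x
    by (simp add: Q_def tau_inner_eq[OF \<tau>] pq_form_eq_inner)
  have "continuous_on (sphere 0 1) Q"
    unfolding Q
    by (intro continuous_intros linear_continuous_on_compose[OF _ lin]
      linear_continuous_on_compose[OF _ linear_pq_flip])
  moreover have "axis undefined 1 \<in> sphere (0 :: real^('p + 'q)) 1" by simp
  ultimately obtain x0 where x0: "norm x0 = 1" and min: "\<And>x. norm x = 1 \<Longrightarrow> Q x0 \<le> Q x"
    using continuous_attains_inf[OF compact_sphere, of 0 1 Q] by fastforce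
  have "Q x0 > 0"
  proof -
    let ?a = "pq_proj \<tau> x0" and ?b = "x0 - pq_proj \<tau> x0"
    have "?a \<noteq> 0 \<or> ?b \<noteq> 0" using x0 by auto
    moreover have "?a \<noteq> 0 \<Longrightarrow> pq_form ?a ?a < 0" using X_G_D(3)[OF \<tau>] pq_proj[OF \<tau>] by blast
    moreover have "?b \<noteq> 0 \<Longrightarrow> pq_form ?b ?b > 0" using pq_form_pos[OF \<tau>] pq_proj[OF \<tau>] by blast
    moreover have "?a = 0 \<Longrightarrow> pq_form ?a ?a = 0" "?b = 0 \<Longrightarrow> pq_form ?b ?b = 0" by simp_all
    ultimately show ?thesis unfolding Q_def tau_inner_eq[OF \<tau>] by linarith
  qed
  moreover have "Q x0 * (norm x)\<^sup>2 \<le> Q x" for x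
  proof (cases "x = 0")
    case True
    then show ?thesis using linear_0[OF lin] by (simp add: Q linear_0[OF linear_pq_flip])
  next
    case False
    have scale: "Q (c *\<^sub>R x) = c\<^sup>2 * Q x" for c
      unfolding Q_def tau_inner_eq[OF \<tau>] linear_cmul[OF lin] scaleR_diff_right[symmetric]
      by (simp add: power2_eq_square algebra_simps)
    have "Q x0 \<le> Q (inverse (norm x) *\<^sub>R x)" using False by (intro min) simp
    then show ?thesis unfolding scale using False by (simp add: field_simps power2_eq_square)
  qed
  ultimately show ?thesis unfolding Q_def by blast
qed

text \<open>The reflections in \<open>a - a'\<close> and \<open>b - b'\<close> move \<open>a + b\<close> to \<open>a' + b'\<close>; the determinant is corrected
  by a reflection fixing \<open>a'\<close> and \<open>b'\<close>, which exists because the dimension is at least three.\<close>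

lemma transitive_pq_isometry:
  fixes \<tau> :: "(real^('p::finite + 'q::finite)) set"
  assumes d: "CARD('p) + CARD('q) > 2" and \<tau>: "\<tau> \<in> X_G"
    and a: "a \<in> \<tau>" "a' \<in> \<tau>" "pq_form a a = pq_form a' a'"
    and b: "b \<in> pq_orth \<tau>" "b' \<in> pq_orth \<tau>" "pq_form b b = pq_form b' b'"
  obtains A where "pq_isometry A" "det A = 1" "\<And>x. x \<in> \<tau> \<Longrightarrow> A *v x \<in> \<tau>" "A *v (a + b) = a' + b'"
proof -
  have st: "subspace \<tau>" by (rule X_G_D(1)[OF \<tau>])
  define good where "good A \<longleftrightarrow> pq_isometry A \<and> (\<forall>x\<in>\<tau>. A *v x \<in> \<tau>)" for A :: "real^('p + 'q)^('p + 'q)"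
  have good_mult: "good (A ** B)" if "good A" "good B" for A B
    using that by (simp add: good_def pq_isometry_mult matrix_vector_mul_assoc[symmetric])
  have good_id: "good (mat 1)" by (simp add: good_def pq_isometry_id)
  have refl1: "good (pq_reflection z)" "pq_form z z \<noteq> 0" if "z \<in> \<tau>" "z \<noteq> 0" for z
    using X_G_D(3)[OF \<tau> that] that st
    by (auto simp: good_def pq_isometry_reflection pq_reflection_apply intro!: subspace_diff subspace_scale)
  have refl2: "good (pq_reflection z)" "pq_form z z \<noteq> 0" if "z \<in> pq_orth \<tau>" "z \<noteq> 0" for z
    using pq_form_pos[OF \<tau> that] that
    by (auto simp: good_def pq_isometry_reflection pq_reflection_apply pq_form_orthD)
  have fixed: "pq_reflection z *v x = x" if "pq_form x z = 0" for z x :: "real^('p + 'q)"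
    using that by (simp add: pq_reflection_apply)
  obtain R1 where R1: "good R1" "R1 *v a = a'" "\<And>x. x \<in> pq_orth \<tau> \<Longrightarrow> R1 *v x = x"
  proof (cases "a = a'")
    case True
    then show thesis using that[of "mat 1"] good_id by simp
  next
    case False
    have z: "a - a' \<in> \<tau>" "a - a' \<noteq> 0" using a False st by (auto intro: subspace_diff)
    show thesis
      using that[of "pq_reflection (a - a')"] refl1[OF z] pq_reflection_swap[OF a(3)] fixed pq_form_orthD(2)[OF z(1)]
      by blast
  qed
  obtain R2 where R2: "good R2" "R2 *v b = b'" "\<And>x. x \<in> \<tau> \<Longrightarrow> R2 *v x = x"
  proof (cases "b = b'")
    case True
    then show thesis using that[of "mat 1"] good_id by simp
  next
    case False
    have z: "b - b' \<in> pq_orth \<tau>" "b - b' \<noteq> 0" using b False subspace_pq_orth by (auto intro: subspace_diff)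
    show thesis
      using that[of "pq_reflection (b - b')"] refl2[OF z] pq_reflection_swap[OF b(3)] fixed pq_form_orthD(1)[OF _ z(1)]
      by blast
  qed
  define R where "R = R1 ** R2"
  have R: "good R" "R *v (a + b) = a' + b'"
    using R1 R2 a b by (simp_all add: R_def good_mult matrix_vector_right_distrib matrix_vector_mul_assoc[symmetric])
  have "\<exists>z. good (pq_reflection z) \<and> pq_form z z \<noteq> 0 \<and> pq_form a' z = 0 \<and> pq_form b' z = 0"
  proof -
    have "dim {pq_flip a', pq_flip b'} < DIM(real^('p + 'q))"
      using dim_le_card'[of "{pq_flip a', pq_flip b'}"] card_insert_le_m1[of 2 "{pq_flip b'}" "pq_flip a'"] d by simp
    then have "\<exists>y. y \<noteq> 0 \<and> orthogonal y (pq_flip a') \<and> orthogonal y (pq_flip b')"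
    proof (rule orthogonal_to_subspace_exists)
      fix y assume "y \<noteq> 0" and o: "\<And>x. x \<in> span {pq_flip a', pq_flip b'} \<Longrightarrow> orthogonal y x"
      moreover have "orthogonal y (pq_flip a')" "orthogonal y (pq_flip b')"
        by (rule o, rule span_base, simp)+
      ultimately show ?thesis by blast
    qed
    then obtain y where y: "y \<noteq> 0" and ya: "pq_form y a' = 0" "pq_form y b' = 0"
      by (auto simp: orthogonal_def pq_form_eq_inner)
    \<comment> \<open>The vector \<open>y\<close> may be isotropic, and its reflection need not
      preserve \<tau>. Its components in \<tau> and in the complement are each orthogonal to
      \<open>a'\<close> and \<open>b'\<close>, and a nonzero one gives a reflection preserving
      \<tau>.\<close>
    define y1 y2 where "y1 = pq_proj \<tau> y" and "y2 = y - pq_proj \<tau> y"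
    have y1: "y1 \<in> \<tau>" and y2: "y2 \<in> pq_orth \<tau>" and yy: "y = y1 + y2"
      using pq_proj[OF \<tau>] by (simp_all add: y1_def y2_def)
    have o: "pq_form a' y2 = 0" "pq_form y2 a' = 0" "pq_form b' y1 = 0" "pq_form y1 b' = 0"
      using pq_form_orthD[OF a(2) y2] pq_form_orthD[OF y1 b(2)] by simp_all
    have "pq_form y1 a' = 0" "pq_form y2 b' = 0" using ya o by (simp_all add: yy)
    then have p: "pq_form a' y1 = 0" "pq_form b' y2 = 0"
      using pq_form_commute[of a' y1] pq_form_commute[of b' y2] by simp_all
    show ?thesis
    proof (cases "y1 = 0")
      case True
      then have "y2 \<noteq> 0" using y yy by simp
      then show ?thesis using refl2[OF y2] o p by blast
    next
      case False
      then show ?thesis using refl1[OF y1] o p by blast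
    qed
  qed
  then obtain z where z: "good (pq_reflection z)" "pq_form z z \<noteq> 0" "pq_form a' z = 0" "pq_form b' z = 0" by blast
  show thesis
  proof (cases "det R = 1")
    case True
    then show thesis using that[of R] R by (simp add: good_def)
  next
    case False
    then have "det R = -1" using det_pq_isometry R(1) good_def by blast
    then have "det (pq_reflection z ** R) = 1" using det_pq_reflection[OF z(2)] by (simp add: det_mul)
    moreover have "(pq_reflection z ** R) *v (a + b) = pq_reflection z *v (a' + b')"
      by (simp only: matrix_vector_mul_assoc[symmetric] R(2))
    moreover have "pq_reflection z *v (a' + b') = a' + b'"
      by (simp only: matrix_vector_right_distrib fixed[OF z(3)] fixed[OF z(4)])
    ultimately show thesis using that[of "pq_reflection z ** R"] good_mult[OF z(1) R(1)] by (simp add: good_def)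
  qed
qed

lemma image_subspace_eq:
  fixes A :: "real^'n^'n"
  assumes "subspace V" "det A \<noteq> 0" "\<And>x. x \<in> V \<Longrightarrow> A *v x \<in> V"
  shows "(*v) A ` V = V"
proof -
  have inj: "inj ((*v) A)" using assms(2) by (simp add: inj_matrix_vector_mult invertible_det_nz)
  have lin: "linear ((*v) A)" by simp
  have "dim ((*v) A ` V) = dim V" using inj lin by (intro dim_image_eq) (auto intro: inj_on_subset)
  moreover have "(*v) A ` V \<subseteq> V" using assms(3) by blast
  ultimately show ?thesis
    using subspace_dim_equal[of "(*v) A ` V" V] linear_subspace_image[OF lin assms(1)] assms(1) by simp
qed

section \<open>The polar projection\<close>

text \<open>The closed form of the exponential of \<open>r Y\<close> when the cube of
  \<open>Y\<close> is \<open>Y\<close>: a hyperbolic rotation on the image of \<open>Y\<close>, the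
  identity on its kernel.\<close>

definition boost :: "real^'n^'n \<Rightarrow> real \<Rightarrow> real^'n^'n" where
  "boost Y r = mat 1 + sinh r *\<^sub>R Y + (cosh r - 1) *\<^sub>R (Y ** Y)"

lemma matrix_mult_scaleR_left: "(c *\<^sub>R A) ** B = c *\<^sub>R (A ** B)" for A B :: "real^'n^'n"
  by (simp add: vec_eq_iff matrix_matrix_mult_def sum_distrib_left mult.assoc)

lemma matrix_mult_scaleR_right: "A ** (c *\<^sub>R B) = c *\<^sub>R (A ** B)" for A B :: "real^'n^'n"
  by (simp add: vec_eq_iff matrix_matrix_mult_def sum_distrib_left algebra_simps)

lemma boost_apply: "boost Y r *v x = x + sinh r *\<^sub>R (Y *v x) + (cosh r - 1) *\<^sub>R (Y *v (Y *v x))"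
  unfolding boost_def matrix_vector_mult_add_rdistrib scaleR_matrix_vector_assoc[symmetric]
    matrix_vector_mul_assoc[symmetric] by simp

lemma matrix_exp_eq_boost:
  fixes Y :: "real^'n^'n"
  assumes Y3: "Y ** (Y ** Y) = Y"
  shows "matrix_exp (r *\<^sub>R Y) = boost Y r"
proof -
  have pow: "(((**) (r *\<^sub>R Y)) ^^ n) (mat 1) =
      (if n = 0 then mat 1 else r ^ n *\<^sub>R (if even n then Y ** Y else Y))" for n
  proof (induction n)
    case (Suc n)
    show ?case
    proof (cases "n = 0")
      case False
      then show ?thesis using Suc Y3
        by (simp add: matrix_mult_scaleR_left matrix_mult_scaleR_right)
    qed (simp add: Suc)
  qed simp
  \<comment> \<open>The even terms would sum to \<open>cosh r\<close> times \<open>Y ** Y\<close>,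
    except that the term for \<open>n = 0\<close> is \<open>mat 1\<close>; the difference is added
    separately.\<close>
  have summand: "(1 / fact n) *\<^sub>R (((**) (r *\<^sub>R Y)) ^^ n) (mat 1) =
      (if n = 0 then mat 1 - Y ** Y else 0) + (if even n then r ^ n /\<^sub>R fact n else 0) *\<^sub>R (Y ** Y)
      + (if even n then 0 else r ^ n /\<^sub>R fact n) *\<^sub>R Y" for n
    unfolding pow by (simp add: divide_inverse mult.commute)
  have "(\<lambda>n. (if n = 0 then mat 1 - Y ** Y else 0) + (if even n then r ^ n /\<^sub>R fact n else 0) *\<^sub>R (Y ** Y)
      + (if even n then 0 else r ^ n /\<^sub>R fact n) *\<^sub>R Y) sums ((mat 1 - Y ** Y) + cosh r *\<^sub>R (Y ** Y) + sinh r *\<^sub>R Y)"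
    using sums_single[of 0 "\<lambda>_. mat 1 - Y ** Y"]
    by (intro sums_add sums_scaleR_left cosh_converges sinh_converges) simp
  then have "(\<lambda>n. (1 / fact n) *\<^sub>R (((**) (r *\<^sub>R Y)) ^^ n) (mat 1)) sums
      ((mat 1 - Y ** Y) + cosh r *\<^sub>R (Y ** Y) + sinh r *\<^sub>R Y)" by (simp only: summand)
  then show ?thesis
    unfolding matrix_exp_def by (simp add: sums_iff boost_def algebra_simps)
qed

lemma boost_mult:
  fixes Y :: "real^'n^'n"
  assumes Y3: "Y ** (Y ** Y) = Y"
  shows "boost Y r ** boost Y s = boost Y (r + s)"
proof -
  have Y3v: "Y *v (Y *v (Y *v x)) = Y *v x" for x
    using Y3 by (metis matrix_vector_mul_assoc)
  have "(boost Y r ** boost Y s) *v x = boost Y (r + s) *v x" for x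
  proof -
    have "(boost Y r ** boost Y s) *v x = boost Y r *v (boost Y s *v x)"
      by (rule matrix_vector_mul_assoc[symmetric])
    also have "\<dots> = x + (sinh s + sinh r + sinh r * (cosh s - 1) + (cosh r - 1) * sinh s) *\<^sub>R (Y *v x)
        + ((cosh s - 1) + sinh r * sinh s + (cosh r - 1) + (cosh r - 1) * (cosh s - 1)) *\<^sub>R (Y *v (Y *v x))"
      unfolding boost_apply matrix_vector_right_distrib matrix_vector_mult_scaleR Y3v
      by (simp only: scaleR_left_distrib scaleR_right_distrib scaleR_scaleR ac_simps)
    also have "sinh s + sinh r + sinh r * (cosh s - 1) + (cosh r - 1) * sinh s = sinh (r + s)"
      by (simp add: sinh_add algebra_simps)
    also have "(cosh s - 1) + sinh r * sinh s + (cosh r - 1) + (cosh r - 1) * (cosh s - 1) = cosh (r + s) - 1"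
      by (simp add: cosh_add algebra_simps)
    finally show ?thesis by (simp add: boost_apply)
  qed
  then show ?thesis unfolding matrix_eq by blast
qed

lemma boost_0: "boost Y 0 = mat 1"
  by (simp add: boost_def)

text \<open>\<open>e\<close> is a unit vector of the line \<open>l\<close>, \<open>w\<close> one of
  the complement of \<tau>, and \<open>Y\<close> generates the boosts of their plane while killing
  its complement. The scale of \<open>Y\<close> makes \<open>q_size (r *\<^sub>R Y)\<close> equal to
  \<open>r\<^sup>2\<close>, so \<open>r\<close> is the quantity bounded in the theorem.\<close>

locale polar_frame =
  fixes l \<tau> :: "(real^('p::finite + 'q::finite)) set" and e w :: "real^('p + 'q)"
    and Y :: "real^('p + 'q)^('p + 'q)" and \<bb>p :: "(real^('p + 'q)^('p + 'q)) set"
  assumes card: "CARD('p) + CARD('q) > 2"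
    and \<tau>: "\<tau> \<in> X_G" and l: "l = span {e}" and e: "e \<in> \<tau>" "pq_form e e = -1"
    and w: "w \<in> pq_orth \<tau>" "pq_form w w = 1"
    and Y: "\<And>x. Y *v x = pq_form x w *\<^sub>R e - pq_form x e *\<^sub>R w"
    and \<bb>p: "\<bb>p = {r *\<^sub>R Y |r. r \<ge> 0}"
begin

lemma ew: "pq_form e w = 0" "pq_form w e = 0"
  using pq_form_orthD[OF e(1) w(1)] by simp_all

lemma Ye: "Y *v e = w" and Yw: "Y *v w = e"
  by (simp_all add: Y e w ew)

lemma Y3: "Y ** (Y ** Y) = Y"
proof -
  have "(Y ** (Y ** Y)) *v x = Y *v x" for x
    by (simp add: matrix_vector_mul_assoc[symmetric]) (simp add: Y e w ew)
  then show ?thesis unfolding matrix_eq by blast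
qed

lemma boost_e: "boost Y r *v e = cosh r *\<^sub>R e + sinh r *\<^sub>R w"
  by (simp add: boost_apply Ye Yw algebra_simps)

lemma boost_inverse: "boost Y (- r) ** boost Y r = mat 1" "boost Y r ** boost Y (- r) = mat 1"
  by (simp_all add: boost_mult[OF Y3] boost_0)

lemma boost_isometry: "pq_isometry (boost Y r)"
  unfolding pq_isometry_def
proof (intro allI)
  fix x y
  have skew: "pq_form (Y *v a) b = - pq_form a (Y *v b)" for a b
    using pq_form_commute[of a b] pq_form_commute[of w b] pq_form_commute[of e b] by (simp add: Y)
  have adj: "pq_form (boost Y r *v a) b = pq_form a (boost Y (- r) *v b)" for a b
    by (simp add: boost_apply skew)
  show "pq_form (boost Y r *v x) (boost Y r *v y) = pq_form x y"
    unfolding adj by (simp add: matrix_vector_mul_assoc boost_inverse)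
qed

text \<open>Halving the parameter exhibits a boost as a square, which excludes determinant
  -1.\<close>

lemma det_boost_frame: "det (boost Y r) = 1"
proof -
  have "boost Y r = boost Y (r / 2) ** boost Y (r / 2)" by (simp add: boost_mult[OF Y3])
  then have "det (boost Y r) = det (boost Y (r / 2)) * det (boost Y (r / 2))" by (simp add: det_mul)
  then show ?thesis using det_pq_isometry[OF boost_isometry, of "r / 2"] by auto
qed

lemma trace_Y2: "trace (Y ** Y) = 2"
proof -
  have YY: "(Y ** Y) *v x = pq_form x w *\<^sub>R w - pq_form x e *\<^sub>R e" for x
    by (simp add: matrix_vector_mul_assoc[symmetric]) (simp add: Y e w ew)
  have "(Y ** Y) $ i $ i = pq_flip w $ i * w $ i - pq_flip e $ i * e $ i" for i
  proof -
    have "(Y ** Y) $ i $ i = ((Y ** Y) *v axis i 1) $ i" by (simp add: matrix_vector_mult_basis column_def)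
    also have "\<dots> = pq_flip w $ i * w $ i - pq_flip e $ i * e $ i"
      unfolding YY by (simp add: pq_form_eq_inner inner_axis')
    finally show ?thesis .
  qed
  then have "trace (Y ** Y) = (\<Sum>i\<in>UNIV. pq_flip w $ i * w $ i) - (\<Sum>i\<in>UNIV. pq_flip e $ i * e $ i)"
    by (simp add: trace_def sum_subtractf)
  also have "\<dots> = pq_flip w \<bullet> w - pq_flip e \<bullet> e" by (simp add: inner_vec_def)
  also have "\<dots> = pq_form w w - pq_form e e" by (simp add: pq_form_eq_inner inner_commute)
  finally show ?thesis by (simp add: e w)
qed

lemma q_size_eq: "q_size (r *\<^sub>R Y) = r\<^sup>2"
proof -
  have tr: "trace ((r *\<^sub>R Y) ** (r *\<^sub>R Y)) = r\<^sup>2 * trace (Y ** Y)"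
    by (simp add: matrix_mult_scaleR_left matrix_mult_scaleR_right trace_def sum_distrib_left power2_eq_square mult.assoc)
  have "n * (r\<^sup>2 * 2) / (2 * n) = r\<^sup>2" if "n \<noteq> 0" for n :: real
    using that by simp
  moreover have "real CARD('p + 'q) - 2 \<noteq> 0" using card by simp
  ultimately show ?thesis unfolding q_size_def killing_def tr trace_Y2 by blast
qed

lemma line_eigen:
  assumes "h \<in> stabilizer l" "H \<in> h"
  shows "H *v e = e \<or> H *v e = - e"
proof -
  have "e \<in> l" by (simp add: l span_base)
  moreover have "(*v) H ` l = l" using assms by (simp add: stabilizer_def)
  ultimately have "H *v e \<in> l" by blast
  then obtain c where c: "H *v e = c *\<^sub>R e" using l by (auto simp: span_singleton)
  have "pq_form (H *v e) (H *v e) = pq_form e e"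
    using PSO_repr(2)[of h H] assms by (auto simp: stabilizer_def pq_isometry_def)
  then have "c\<^sup>2 = 1" by (simp add: c e power2_eq_square)
  then show ?thesis using c by (auto simp: power2_eq_1_iff)
qed

lemma tau_inner_stabilizer:
  assumes "k \<in> stabilizer \<tau>" "A \<in> k"
  shows "tau_inner \<tau> (A *v x) (A *v x) = tau_inner \<tau> x x"
proof -
  have iso: "pq_form (A *v x) (A *v y) = pq_form x y" for x y
    using PSO_repr(2)[of k A] assms by (auto simp: stabilizer_def pq_isometry_def)
  have img: "(*v) A ` \<tau> = \<tau>" using assms by (simp add: stabilizer_def)
  have "A *v (x - pq_proj \<tau> x) \<in> pq_orth \<tau>"
  proof -
    have "pq_form (A *v (x - pq_proj \<tau> x)) y = 0" if "y \<in> \<tau>" for y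
    proof -
      obtain y' where y': "y' \<in> \<tau>" "y = A *v y'" using img \<open>y \<in> \<tau>\<close> by blast
      show ?thesis unfolding y'(2) iso by (rule pq_form_orthD(2)[OF y'(1) pq_proj(2)[OF \<tau>]])
    qed
    then show ?thesis by (simp add: pq_orth_def)
  qed
  moreover have "A *v pq_proj \<tau> x \<in> \<tau>" using img pq_proj(1)[OF \<tau>] by blast
  ultimately have P: "pq_proj \<tau> (A *v x) = A *v pq_proj \<tau> x"
    by (intro pq_proj_unique \<tau>) (simp_all add: matrix_vector_mult_diff_distrib)
  show ?thesis unfolding tau_inner_eq[OF \<tau>] P
    by (simp only: matrix_vector_mult_diff_distrib[symmetric] iso)
qed

lemma tau_inner_boost: "tau_inner \<tau> (boost Y r *v e) (boost Y r *v e) = cosh (2 * r)"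
proof -
  have P: "pq_proj \<tau> (cosh r *\<^sub>R e + sinh r *\<^sub>R w) = cosh r *\<^sub>R e"
    using e w subspace_scale[OF X_G_D(1)[OF \<tau>]] subspace_scale[OF subspace_pq_orth]
    by (intro pq_proj_unique \<tau>) simp_all
  have "cosh (2 * r) = cosh r * cosh r + sinh r * sinh r" using cosh_add[of r r] by simp
  then show ?thesis unfolding boost_e tau_inner_eq[OF \<tau>] P by (simp add: e w)
qed

text \<open>The left factor preserves the \<tau>-norm and the right one fixes \<open>e\<close> up to
  sign, so the \<tau>-norm of the image of \<open>e\<close> depends only on the double
  coset.\<close>

lemma tau_inner_polar:
  assumes k: "k \<in> stabilizer \<tau>" and h: "h \<in> stabilizer l" and X: "X = r *\<^sub>R Y"
    and g: "g = k \<otimes>\<^bsub>PSL\<^esub> proj_class (matrix_exp X) \<otimes>\<^bsub>PSL\<^esub> h" and A: "A \<in> g"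
  shows "tau_inner \<tau> (A *v e) (A *v e) = cosh (2 * r)"
proof -
  have kP: "k \<in> PSO" and hP: "h \<in> PSO" using k h by (auto simp: stabilizer_def)
  obtain K H where K: "K \<in> k" and H: "H \<in> h"
    using kP hP proj_class_self by (auto simp: PSO_iff)
  have exp: "matrix_exp X = boost Y r" unfolding X by (rule matrix_exp_eq_boost[OF Y3])
  have "g = proj_class K \<otimes>\<^bsub>PSL\<^esub> proj_class (boost Y r) \<otimes>\<^bsub>PSL\<^esub> proj_class H"
    using g exp PSO_repr(3)[OF kP K] PSO_repr(3)[OF hP H] by simp
  then have "g = proj_class (K ** boost Y r ** H)"
    using PSO_repr(1)[OF kP K] PSO_repr(1)[OF hP H] by (simp add: proj_class_mult det_mul det_boost_frame)
  then have "A = K ** boost Y r ** H \<or> A = - (K ** boost Y r ** H)" using A proj_class_sign by blast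
  moreover have "(- M) *v e = - (M *v e)" for M :: "real^('p + 'q)^('p + 'q)"
    by (simp add: vec_eq_iff matrix_vector_mult_def sum_negf)
  moreover have "(K ** boost Y r ** H) *v e = K *v (boost Y r *v (H *v e))"
    by (simp only: matrix_vector_mul_assoc matrix_mul_assoc)
  moreover have "M *v (- x) = - (M *v x)" for x and M :: "real^('p + 'q)^('p + 'q)"
    by (simp add: vec_eq_iff matrix_vector_mult_def sum_negf)
  ultimately have "A *v e = K *v (boost Y r *v e) \<or> A *v e = - (K *v (boost Y r *v e))"
    using line_eigen[OF h H] by (metis minus_minus)
  moreover have "tau_inner \<tau> (- x) (- x) = tau_inner \<tau> x x" for x
    unfolding tau_inner_eq[OF \<tau>] linear_neg[OF linear_pq_proj[OF \<tau>]]
    by (simp only: minus_diff_minus pq_form_linear minus_minus)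
  ultimately have "tau_inner \<tau> (A *v e) (A *v e) = tau_inner \<tau> (K *v (boost Y r *v e)) (K *v (boost Y r *v e))"
    by metis
  then show ?thesis using tau_inner_stabilizer[OF k K] tau_inner_boost by simp
qed

lemma stabilizerI:
  assumes "subspace V" "pq_isometry A" "det A = 1" "\<And>x. x \<in> V \<Longrightarrow> A *v x \<in> V"
  shows "proj_class A \<in> stabilizer V"
  unfolding stabilizer_def
proof (intro CollectI conjI ballI)
  show "proj_class A \<in> PSO" using assms by (auto simp: PSO_iff)
  fix B assume B: "B \<in> proj_class A"
  have "(- A) *v x = - (A *v x)" for x
    by (simp add: vec_eq_iff matrix_vector_mult_def sum_negf)
  then have "B *v x \<in> V" if "x \<in> V" for x
    using proj_class_sign[OF B] assms(4)[OF that] subspace_neg[OF assms(1)] by auto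
  moreover have "det B \<noteq> 0"
    using PSO_repr(1)[OF \<open>proj_class A \<in> PSO\<close> B] by simp
  ultimately show "(*v) B ` V = V" using image_subspace_eq[OF assms(1)] by blast
qed

text \<open>The components of \<open>A *v e\<close> in \<tau> and in its complement have form values
  \<open>- (cosh r)\<^sup>2\<close> and \<open>(sinh r)\<^sup>2\<close> for a unique
  \<open>r \<ge> 0\<close>. Some \<open>K\<close> preserving \<tau> therefore carries the boosted
  \<open>e\<close> to \<open>A *v e\<close>, and the remaining factor \<open>H\<close> fixes
  \<open>e\<close>.\<close>

lemma polar_decomposition:
  assumes "g \<in> PSO"
  obtains r k h where "r \<ge> 0" "k \<in> stabilizer \<tau>" "h \<in> stabilizer l"
    "g = k \<otimes>\<^bsub>PSL\<^esub> proj_class (matrix_exp (r *\<^sub>R Y)) \<otimes>\<^bsub>PSL\<^esub> h"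
proof -
  obtain A where A: "det A = 1" "pq_isometry A" "g = proj_class A" using assms by (auto simp: PSO_iff)
  define a b where "a = pq_proj \<tau> (A *v e)" and "b = A *v e - pq_proj \<tau> (A *v e)"
  have a: "a \<in> \<tau>" and b: "b \<in> pq_orth \<tau>" and ab: "a + b = A *v e"
    using pq_proj[OF \<tau>] by (simp_all add: a_def b_def)
  have "pq_form (a + b) (a + b) = -1"
    using A(2) e unfolding ab pq_isometry_def by simp
  then have sum: "pq_form a a + pq_form b b = -1" using pq_form_orthD[OF a b] by simp
  have bb: "pq_form b b \<ge> 0" using pq_form_pos[OF \<tau> b] by (cases "b = 0") auto
  define r where "r = arsinh (sqrt (pq_form b b))"
  have r: "r \<ge> 0" using bb sinh_real_nonneg_iff[of r] by (simp add: r_def)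
  have sinh: "(sinh r)\<^sup>2 = pq_form b b" using bb by (simp add: r_def)
  have cosh: "(cosh r)\<^sup>2 = - pq_form a a" using cosh_square_eq[of r] sinh sum by simp
  obtain K where K: "pq_isometry K" "det K = 1" "\<And>x. x \<in> \<tau> \<Longrightarrow> K *v x \<in> \<tau>"
    "K *v (cosh r *\<^sub>R e + sinh r *\<^sub>R w) = a + b"
  proof (rule transitive_pq_isometry[OF card \<tau>])
    show "cosh r *\<^sub>R e \<in> \<tau>" using e X_G_D(1)[OF \<tau>] by (simp add: subspace_scale)
    show "sinh r *\<^sub>R w \<in> pq_orth \<tau>" using w by (simp add: subspace_scale[OF subspace_pq_orth])
    show "pq_form (cosh r *\<^sub>R e) (cosh r *\<^sub>R e) = pq_form a a"
      using cosh by (simp add: e power2_eq_square)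
    show "pq_form (sinh r *\<^sub>R w) (sinh r *\<^sub>R w) = pq_form b b"
      using sinh by (simp add: w power2_eq_square)
  qed (use a b in auto)
  obtain Ki where Ki: "K ** Ki = mat 1" "Ki ** K = mat 1"
    using K(2) invertible_det_nz[of K] by (auto simp: invertible_def)
  define H where "H = boost Y (- r) ** Ki ** A"
  have Ki': "pq_isometry Ki" by (rule pq_isometry_inverse[OF K(1) Ki(1)])
  have "det Ki = 1" using arg_cong[OF Ki(1), of det] K(2) by (simp add: det_mul)
  then have detH: "det H = 1" using A(1) by (simp add: H_def det_mul det_boost_frame)
  have isoH: "pq_isometry H" unfolding H_def by (intro pq_isometry_mult boost_isometry Ki' A(2))
  have KE: "K *v (boost Y r *v e) = A *v e" using K(4) by (simp only: boost_e ab)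
  have "Ki *v (A *v e) = boost Y r *v e"
    by (simp only: KE[symmetric]) (simp only: matrix_vector_mul_assoc Ki matrix_mul_assoc matrix_mul_lid)
  then have He: "H *v e = e"
    unfolding H_def by (simp only: matrix_vector_mul_assoc[symmetric])
      (simp only: matrix_vector_mul_assoc boost_inverse matrix_vector_mul_lid)
  have "K ** boost Y r ** H = K ** (boost Y r ** boost Y (- r)) ** Ki ** A"
    by (simp only: H_def matrix_mul_assoc)
  then have KH: "K ** boost Y r ** H = A" by (simp add: boost_inverse Ki)
  show thesis
  proof (rule that[OF r])
    show "proj_class K \<in> stabilizer \<tau>" using K X_G_D(1)[OF \<tau>] by (intro stabilizerI)
    show "proj_class H \<in> stabilizer l"
    proof (rule stabilizerI[OF _ isoH detH])
      show "subspace l" by (simp add: l)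
      fix x assume "x \<in> l"
      then obtain c where "x = c *\<^sub>R e" using l by (auto simp: span_singleton)
      then show "H *v x \<in> l" using He l by (simp add: matrix_vector_mult_scaleR span_scale span_base)
    qed
    show "g = proj_class K \<otimes>\<^bsub>PSL\<^esub> proj_class (matrix_exp (r *\<^sub>R Y)) \<otimes>\<^bsub>PSL\<^esub> proj_class H"
      unfolding matrix_exp_eq_boost[OF Y3] using A K detH
      by (simp add: proj_class_mult det_mul det_boost_frame KH)
  qed
qed

text \<open>The group element determines \<open>cosh (2 * r)\<close>, which is injective on
  \<open>r \<ge> 0\<close>; this gives the uniqueness that the definite description of the polar
  projection requires.\<close>

lemma polar_projection_tau_inner:
  assumes g: "g \<in> PSO" and A: "A \<in> g"
  shows "tau_inner \<tau> (A *v e) (A *v e) = cosh (2 * sqrt (q_size (polar_projection l \<tau> \<bb>p g)))"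
    and "0 \<le> sqrt (q_size (polar_projection l \<tau> \<bb>p g))"
proof -
  obtain r k h where r: "r \<ge> 0" and kh: "k \<in> stabilizer \<tau>" "h \<in> stabilizer l"
    "g = k \<otimes>\<^bsub>PSL\<^esub> proj_class (matrix_exp (r *\<^sub>R Y)) \<otimes>\<^bsub>PSL\<^esub> h"
    using polar_decomposition[OF g] .
  have "polar_projection l \<tau> \<bb>p g = r *\<^sub>R Y"
    unfolding polar_projection_def
  proof (rule the_equality)
    show "r *\<^sub>R Y \<in> \<bb>p \<and> (\<exists>k\<in>stabilizer \<tau>. \<exists>h\<in>stabilizer l.
        g = k \<otimes>\<^bsub>PSL\<^esub> proj_class (matrix_exp (r *\<^sub>R Y)) \<otimes>\<^bsub>PSL\<^esub> h)"
      using r kh \<bb>p by blast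
  next
    fix X assume X: "X \<in> \<bb>p \<and> (\<exists>k\<in>stabilizer \<tau>. \<exists>h\<in>stabilizer l.
        g = k \<otimes>\<^bsub>PSL\<^esub> proj_class (matrix_exp X) \<otimes>\<^bsub>PSL\<^esub> h)"
    then obtain r' where r': "r' \<ge> 0" "X = r' *\<^sub>R Y" using \<bb>p by blast
    obtain k' h' where kh': "k' \<in> stabilizer \<tau>" "h' \<in> stabilizer l"
      "g = k' \<otimes>\<^bsub>PSL\<^esub> proj_class (matrix_exp X) \<otimes>\<^bsub>PSL\<^esub> h'" using X by blast
    have "cosh (2 * r) = cosh (2 * r')"
      using tau_inner_polar[OF kh(1,2) refl kh(3) A] tau_inner_polar[OF kh'(1,2) r'(2) kh'(3) A] by simp
    then have "r = r'" using r r'(1) by (simp add: cosh_real_nonneg_less_iff order_eq_iff cosh_real_nonneg_le_iff)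
    then show "X = r *\<^sub>R Y" using r' by simp
  qed
  then have "sqrt (q_size (polar_projection l \<tau> \<bb>p g)) = r" using r by (simp add: q_size_eq)
  then show "tau_inner \<tau> (A *v e) (A *v e) = cosh (2 * sqrt (q_size (polar_projection l \<tau> \<bb>p g)))"
    "0 \<le> sqrt (q_size (polar_projection l \<tau> \<bb>p g))"
    using tau_inner_polar[OF kh(1,2) refl kh(3) A] r by simp_all
qed

end

section \<open>Polar frames from Weyl chambers\<close>

lemma pseudo_hyperbolic_unit:
  fixes l :: "(real^('p::finite + 'q::finite)) set"
  assumes "l \<in> pseudo_hyperbolic"
  obtains e where "l = span {e}" "pq_form e e = -1"
proof -
  obtain v where v: "l = span {v}" "v \<noteq> 0" using assms by (auto simp: pseudo_hyperbolic_def proj_space_def)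
  have "v \<in> l" by (simp add: v span_base)
  then have neg: "pq_form v v < 0" using assms v(2) by (auto simp: pseudo_hyperbolic_def)
  define c where "c = inverse (sqrt (- pq_form v v))"
  have c: "c \<noteq> 0" "c * c * pq_form v v = -1"
    using neg real_sqrt_mult_self[of "- pq_form v v"] by (simp_all add: c_def field_simps)
  show thesis
  proof (rule that)
    show "l = span {c *\<^sub>R v}"
      using c(1) span_image_scale[of "{v}" "\<lambda>_. c"] by (simp add: v)
    show "pq_form (c *\<^sub>R v) (c *\<^sub>R v) = -1" using c(2) by (simp add: mult.assoc)
  qed
qed

lemma involution_apply:
  fixes e :: "real^('p::finite + 'q::finite)"
  assumes e: "pq_form e e = -1"
  shows "involution (span {e}) *v x = - x - (2 * pq_form x e) *\<^sub>R e"
proof -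
  define J where "J = matrix (\<lambda>x. - x - (2 * pq_form x e) *\<^sub>R e)"
  have lin: "linear (\<lambda>x. - x - (2 * pq_form x e) *\<^sub>R e)"
    by (rule linearI) (simp_all add: algebra_simps)
  have J: "J *v x = - x - (2 * pq_form x e) *\<^sub>R e" for x
    unfolding J_def by (rule matrix_works) (simp add: linear_matrix_vector_mul_eq lin)
  have "involution (span {e}) = J"
    unfolding involution_def
  proof (rule the_equality)
    show "(\<forall>x\<in>span {e}. J *v x = x) \<and> (\<forall>x\<in>pq_orth (span {e}). J *v x = - x)"
    proof (intro conjI ballI)
      fix x assume "x \<in> span {e}"
      then obtain c where x: "x = c *\<^sub>R e" by (auto simp: span_singleton)
      then have "J *v x = - x - (2 * - c) *\<^sub>R e" using e by (simp add: J)
      then show "J *v x = x" by (simp add: x vec_eq_iff)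
    next
      fix x assume "x \<in> pq_orth (span {e})"
      then have "pq_form x e = 0" by (simp add: pq_orth_def span_base)
      then show "J *v x = - x" by (simp add: J)
    qed
  next
    fix M assume M: "(\<forall>x\<in>span {e}. M *v x = x) \<and> (\<forall>x\<in>pq_orth (span {e}). M *v x = - x)"
    have "M *v x = J *v x" for x
    proof -
      \<comment> \<open>Since \<open>pq_form e e = -1\<close>, the projection to the complement of
        \<open>e\<close> adds the multiple of \<open>e\<close> instead of subtracting it.\<close>
      let ?y = "x + pq_form x e *\<^sub>R e"
      have "pq_form ?y z = 0" if "z \<in> span {e}" for z
        using that e by (auto simp: span_singleton)
      then have "M *v ?y = - ?y" using M by (simp add: pq_orth_def)
      moreover have "M *v e = e" using M by (simp add: span_base)
      ultimately have "M *v x + pq_form x e *\<^sub>R e = - x - pq_form x e *\<^sub>R e"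
        by (simp add: matrix_vector_right_distrib matrix_vector_mult_scaleR)
      then show ?thesis by (simp add: J vec_eq_iff algebra_simps)
    qed
    then show "M = J" unfolding matrix_eq by blast
  qed
  then show ?thesis by (simp add: J)
qed

text \<open>Anticommuting with the involution makes \<open>X\<close> exchange the line of
  \<open>e\<close> and its complement, and skewness then expresses \<open>X\<close> on the
  complement through the single vector \<open>X *v e\<close>.\<close>

lemma q_space_apply:
  fixes e :: "real^('p::finite + 'q::finite)"
  assumes e: "pq_form e e = -1" and X: "X \<in> q_space (span {e})"
  shows "pq_form e (X *v e) = 0"
    and "X *v x = pq_form x (X *v e) *\<^sub>R e - pq_form x e *\<^sub>R (X *v e)"
proof -
  let ?J = "involution (span {e})"
  have skew: "pq_form (X *v a) b = - pq_form a (X *v b)" for a b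
    using X unfolding q_space_def so_pq_def by (simp add: eq_neg_iff_add_eq_0)
  show e0: "pq_form e (X *v e) = 0" using skew[of e e] pq_form_commute[of e "X *v e"] by simp
  have JXJ: "?J *v (X *v (?J *v x)) = - (X *v x)" for x
  proof -
    have "(?J ** X ** ?J) *v x = (- X) *v x" using X by (simp add: q_space_def)
    moreover have "(- X) *v x = - (X *v x)" by (simp add: vec_eq_iff matrix_vector_mult_def sum_negf)
    ultimately show ?thesis by (simp only: matrix_vector_mul_assoc matrix_mul_assoc)
  qed
  have neg: "X *v (- v) = - (X *v v)" for v by (simp add: vec_eq_iff matrix_vector_mult_def sum_negf)
  have orth: "X *v v = pq_form v (X *v e) *\<^sub>R e" if "pq_form v e = 0" for v
  proof -
    have "?J *v v = - v" using that by (simp add: involution_apply[OF e])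
    then have "?J *v (- (X *v v)) = - (X *v v)" using JXJ[of v] neg by simp
    then have "X *v v + (2 * pq_form (X *v v) e) *\<^sub>R e = - (X *v v)"
      by (simp add: involution_apply[OF e])
    moreover have "pq_form (X *v v) e = - pq_form v (X *v e)" by (rule skew)
    ultimately show ?thesis by (simp add: vec_eq_iff algebra_simps)
  qed
  have "X *v x = X *v (x + pq_form x e *\<^sub>R e) - pq_form x e *\<^sub>R (X *v e)"
    by (simp add: matrix_vector_right_distrib matrix_vector_mult_scaleR)
  also have "X *v (x + pq_form x e *\<^sub>R e) = pq_form x (X *v e) *\<^sub>R e"
    using orth[of "x + pq_form x e *\<^sub>R e"] e e0 by simp
  finally show "X *v x = pq_form x (X *v e) *\<^sub>R e - pq_form x e *\<^sub>R (X *v e)" .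
qed

text \<open>On \<tau> the form and the inner product differ by a sign, while \<open>X\<close> is
  skew for the one and symmetric for the other. For the component \<open>x\<close> of
  \<open>X *v e\<close> in \<tau> this gives \<open>pq_form x x = - pq_form x x\<close>, and
  definiteness makes it zero.\<close>

lemma p_space_maps_orth:
  fixes \<tau> :: "(real^('p::finite + 'q::finite)) set"
  assumes \<tau>: "\<tau> \<in> X_G" and e: "e \<in> \<tau>" and X: "X \<in> p_space \<tau>"
  shows "X *v e \<in> pq_orth \<tau>"
proof -
  let ?P = "pq_proj \<tau>"
  have skew: "pq_form (X *v a) b = - pq_form a (X *v b)" for a b
    using X unfolding p_space_def so_pq_def by (simp add: eq_neg_iff_add_eq_0)
  define x where "x = ?P (X *v e)"
  have x: "x \<in> \<tau>" unfolding x_def by (rule pq_proj(1)[OF \<tau>])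
  have "tau_inner \<tau> (X *v e) x = tau_inner \<tau> e (X *v x)"
    using X unfolding p_space_def by blast
  then have 1: "- pq_form x x = - pq_form e (?P (X *v x))"
    unfolding tau_inner_eq[OF \<tau>] pq_proj_in[OF \<tau> x] pq_proj_in[OF \<tau> e] by (simp add: x_def)
  have "pq_form e (X *v x - ?P (X *v x)) = 0"
    by (rule pq_form_orthD(1)[OF e pq_proj(2)[OF \<tau>]])
  then have 2: "pq_form e (?P (X *v x)) = pq_form e (X *v x)" by simp
  have "pq_form (X *v e - x) x = 0"
    unfolding x_def by (rule pq_form_orthD(2)[OF pq_proj(1)[OF \<tau>] pq_proj(2)[OF \<tau>]])
  then have 3: "pq_form (X *v e) x = pq_form x x" by simp
  have "pq_form x x = 0" using 1 2 3 skew[of e x] by simp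
  then have "x = 0" using X_G_D(3)[OF \<tau> x] by fastforce
  then show ?thesis using pq_proj(2)[OF \<tau>, of "X *v e"] by (simp add: x_def)
qed

lemma polar_frame_exists:
  fixes l \<tau> :: "(real^('p::finite + 'q::finite)) set"
  assumes card: "CARD('p) + CARD('q) > 2" and l: "l \<in> pseudo_hyperbolic" and \<tau>: "\<tau> \<in> S_set l"
    and X: "X \<in> p_space \<tau> \<inter> q_space l" "X \<noteq> 0"
  obtains e w Y where "polar_frame l \<tau> e w Y {t *\<^sub>R X |t. t \<ge> 0}"
proof -
  obtain e where e: "l = span {e}" "pq_form e e = -1" using pseudo_hyperbolic_unit[OF l] .
  have \<tau>G: "\<tau> \<in> X_G" and e\<tau>: "e \<in> \<tau>" using \<tau> by (auto simp: S_set_def e(1) span_base)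
  define v where "v = X *v e"
  have Xv: "X *v x = pq_form x v *\<^sub>R e - pq_form x e *\<^sub>R v" for x
    unfolding v_def by (rule q_space_apply(2)[OF e(2)]) (use X(1) e(1) in simp)
  have v: "v \<in> pq_orth \<tau>" unfolding v_def using p_space_maps_orth[OF \<tau>G e\<tau>] X(1) by blast
  have "v \<noteq> 0"
  proof
    assume "v = 0"
    then have "\<forall>x. X *v x = 0 *v x" by (simp add: Xv)
    then show False using X(2) unfolding matrix_eq[symmetric] by blast
  qed
  then have pos: "pq_form v v > 0" using pq_form_pos[OF \<tau>G v] by blast
  \<comment> \<open>Dividing by \<open>c\<close> turns \<open>v\<close> into a unit vector; being
    positive, it does not change the half-line.\<close>
  define c where "c = sqrt (pq_form v v)"
  have c: "c > 0" "c * c = pq_form v v" using pos by (simp_all add: c_def)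
  show thesis
  proof (rule that)
    show "polar_frame l \<tau> e (inverse c *\<^sub>R v) (inverse c *\<^sub>R X) {t *\<^sub>R X |t. t \<ge> 0}"
    proof
      show "inverse c *\<^sub>R v \<in> pq_orth \<tau>" by (rule subspace_scale[OF subspace_pq_orth v])
      show "pq_form (inverse c *\<^sub>R v) (inverse c *\<^sub>R v) = 1"
        using c(1) by (simp add: c(2)[symmetric] field_simps)
      show "(inverse c *\<^sub>R X) *v x = pq_form x (inverse c *\<^sub>R v) *\<^sub>R e - pq_form x e *\<^sub>R (inverse c *\<^sub>R v)" for x
        by (simp add: scaleR_matrix_vector_assoc[symmetric] Xv scaleR_diff_right mult.commute)
      show "{t *\<^sub>R X |t. t \<ge> 0} = {r *\<^sub>R (inverse c *\<^sub>R X) |r. r \<ge> 0}"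
      proof (intro equalityI subsetI)
        fix Z assume "Z \<in> {t *\<^sub>R X |t. t \<ge> 0}"
        then obtain t where "t \<ge> 0" "Z = t *\<^sub>R X" by blast
        then have "Z = (t * c) *\<^sub>R (inverse c *\<^sub>R X)" "t * c \<ge> 0" using c by simp_all
        then show "Z \<in> {r *\<^sub>R (inverse c *\<^sub>R X) |r. r \<ge> 0}" by blast
      next
        fix Z assume "Z \<in> {r *\<^sub>R (inverse c *\<^sub>R X) |r. r \<ge> 0}"
        then obtain r where "r \<ge> 0" "Z = r *\<^sub>R (inverse c *\<^sub>R X)" by blast
        then have "Z = (r * inverse c) *\<^sub>R X" "r * inverse c \<ge> 0" using c by simp_all
        then show "Z \<in> {t *\<^sub>R X |t. t \<ge> 0}" by blast
      qed
    qed (use card \<tau>G e e\<tau> in auto)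
  qed
qed

lemma (in polar_frame) orbit_bounded:
  "\<exists>C. \<forall>g\<in>PSO. \<forall>A\<in>g. sqrt (q_size (polar_projection l \<tau> \<bb>p g)) \<le> t \<longrightarrow> norm (A *v e) \<le> C"
proof -
  obtain c where c: "c > 0" "\<And>x. c * (norm x)\<^sup>2 \<le> tau_inner \<tau> x x"
    using tau_inner_coercive[OF \<tau>] by blast
  have "norm (A *v e) \<le> sqrt (cosh (2 * t) / c)"
    if g: "g \<in> PSO" "A \<in> g" and le: "sqrt (q_size (polar_projection l \<tau> \<bb>p g)) \<le> t" for g A
  proof (rule real_le_rsqrt)
    have "0 \<le> sqrt (q_size (polar_projection l \<tau> \<bb>p g))" by (rule polar_projection_tau_inner(2)[OF g])
    then have "cosh (2 * sqrt (q_size (polar_projection l \<tau> \<bb>p g))) \<le> cosh (2 * t)"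
      using le by (subst cosh_real_nonneg_le_iff) linarith+
    then have "c * (norm (A *v e))\<^sup>2 \<le> cosh (2 * t)"
      using c(2)[of "A *v e"] polar_projection_tau_inner(1)[OF g] by linarith
    then show "(norm (A *v e))\<^sup>2 \<le> cosh (2 * t) / c" using c(1) by (simp add: field_simps)
  qed
  then show ?thesis by blast
qed

section \<open>Geodesic words and the limit set\<close>

abbreviation word_value :: "('a, 'm) monoid_scheme \<Rightarrow> 'a list \<Rightarrow> 'a" where
  "word_value \<Gamma> w \<equiv> foldr (\<lambda>x y. x \<otimes>\<^bsub>\<Gamma>\<^esub> y) w \<one>\<^bsub>\<Gamma>\<^esub>"

definition geodesic_word :: "('a, 'm) monoid_scheme \<Rightarrow> 'a set \<Rightarrow> 'a list \<Rightarrow> bool" where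
  "geodesic_word \<Gamma> S w \<longleftrightarrow> set w \<subseteq> S \<and> word_length \<Gamma> S (word_value \<Gamma> w) = length w"

context group begin

lemma word_value_closed: "set w \<subseteq> carrier G \<Longrightarrow> word_value G w \<in> carrier G"
  by (induction w) auto

lemma word_value_append:
  "set x \<subseteq> carrier G \<Longrightarrow> set y \<subseteq> carrier G \<Longrightarrow> word_value G (x @ y) = word_value G x \<otimes> word_value G y"
  by (induction x) (auto simp: word_value_closed m_assoc)

lemma exists_word:
  assumes S: "sym_generating_set G S" and g: "g \<in> carrier G"
  shows "\<exists>w. set w \<subseteq> S \<and> word_value G w = g"
proof -
  have SG: "S \<subseteq> carrier G" and Sinv: "\<And>s. s \<in> S \<Longrightarrow> inv s \<in> S" and gen: "generate G S = carrier G"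
    using S by (auto simp: sym_generating_set_def)
  have "g \<in> generate G S" using g gen by simp
  then show ?thesis
  proof (induction g rule: generate.induct)
    case one
    show ?case by (rule exI[of _ "[]"]) simp
  next
    case (incl h)
    then show ?case using SG by (intro exI[of _ "[h]"]) auto
  next
    case (inv h)
    then show ?case using SG Sinv[of h] by (intro exI[of _ "[inv h]"]) auto
  next
    case (eng h1 h2)
    then obtain w1 w2 where "set w1 \<subseteq> S" "word_value G w1 = h1" "set w2 \<subseteq> S" "word_value G w2 = h2" by blast
    then show ?case using SG word_value_append[of w1 w2] by (intro exI[of _ "w1 @ w2"]) auto
  qed
qed

lemma word_length_le: "set w \<subseteq> S \<Longrightarrow> word_length G S (word_value G w) \<le> length w"
  unfolding word_length_def by (rule Least_le) blast

lemma exists_geodesic_word: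
  assumes S: "sym_generating_set G S" and g: "g \<in> carrier G"
  shows "\<exists>w. geodesic_word G S w \<and> word_value G w = g"
proof -
  have "\<exists>n w. length w = n \<and> set w \<subseteq> S \<and> word_value G w = g" using exists_word[OF assms] by blast
  from LeastI_ex[OF this] obtain w where "length w = word_length G S g" "set w \<subseteq> S" "word_value G w = g"
    unfolding word_length_def by blast
  then show ?thesis by (intro exI[of _ w]) (simp add: geodesic_word_def)
qed

text \<open>A shorter word for the factor, substituted in place, would shorten the whole
  word.\<close>

lemma geodesic_word_factor:
  assumes SG: "S \<subseteq> carrier G" and geo: "geodesic_word G S (x @ y @ z)"
  shows "geodesic_word G S y"
proof -
  have sets: "set x \<subseteq> S" "set y \<subseteq> S" "set z \<subseteq> S" using geo by (auto simp: geodesic_word_def)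
  have "\<exists>n w. length w = n \<and> set w \<subseteq> S \<and> word_value G w = word_value G y" using sets by blast
  from LeastI_ex[OF this] obtain w where w: "length w = word_length G S (word_value G y)" "set w \<subseteq> S"
    "word_value G w = word_value G y"
    unfolding word_length_def by blast
  have app: "word_value G (x @ y' @ z) = word_value G x \<otimes> (word_value G y' \<otimes> word_value G z)" if "set y' \<subseteq> S" for y'
  proof -
    have "set x \<subseteq> carrier G" "set y' \<subseteq> carrier G" "set z \<subseteq> carrier G" using sets that SG by auto
    then show ?thesis by (simp only: word_value_append set_append Un_subset_iff simp_thms)
  qed
  have "word_value G (x @ w @ z) = word_value G (x @ y @ z)"
    by (simp only: app[OF w(2)] app[OF sets(2)] w(3))
  then have "length (x @ y @ z) \<le> length (x @ w @ z)"
    using geo word_length_le[of "x @ w @ z" S] sets w(2) by (simp add: geodesic_word_def)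
  then have "length y \<le> word_length G S (word_value G y)" using w(1) by simp
  then show ?thesis using word_length_le[OF sets(2)] sets(2) by (simp add: geodesic_word_def)
qed

lemma finite_word_ball:
  assumes S: "sym_generating_set G S"
  shows "finite {g \<in> carrier G. word_length G S g \<le> n}"
proof (rule finite_subset)
  show "{g \<in> carrier G. word_length G S g \<le> n} \<subseteq> word_value G ` {w. set w \<subseteq> S \<and> length w \<le> n}"
  proof
    fix g assume g: "g \<in> {g \<in> carrier G. word_length G S g \<le> n}"
    then obtain w where "geodesic_word G S w" "word_value G w = g" using exists_geodesic_word[OF S] by blast
    then show "g \<in> word_value G ` {w. set w \<subseteq> S \<and> length w \<le> n}"
      using g by (force simp: geodesic_word_def)
  qed
  show "finite (word_value G ` {w. set w \<subseteq> S \<and> length w \<le> n})"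
    using S by (intro finite_imageI finite_lists_length_le) (simp add: sym_generating_set_def)
qed

end

section \<open>Norms of isometries and limits of lines\<close>

lemma PSL_one_eq: "\<one>\<^bsub>PSL\<^esub> = proj_class (mat 1 :: real^'n^'n)"
proof -
  interpret group "PSL :: (real^'n^'n) set monoid" by (rule group_PSL)
  show ?thesis by (rule PSL_repr(2)[OF one_closed PSL_one_mem])
qed

lemma PSL_inv_mem:
  fixes A B :: "real^'n^'n"
  assumes g: "g \<in> carrier PSL" "A \<in> g" and AB: "A ** B = mat 1"
  shows "B \<in> inv\<^bsub>PSL\<^esub> g"
proof -
  interpret group "PSL :: (real^'n^'n) set monoid" by (rule group_PSL)
  have A: "det A = 1" "g = proj_class A" using PSL_repr[OF g] by auto
  have detB: "det B = 1" using arg_cong[OF AB, of det] A by (simp add: det_mul)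
  have BA: "B ** A = mat 1" using AB matrix_left_right_inverse by blast
  have "proj_class B \<in> carrier PSL"
    using detB by (auto simp: PSL_def FactGroup_def RCOSETS_def proj_class_def SL_def)
  moreover have "proj_class B \<otimes>\<^bsub>PSL\<^esub> g = \<one>\<^bsub>PSL\<^esub>"
    using A detB BA by (simp add: proj_class_mult PSL_one_eq)
  ultimately have "inv\<^bsub>PSL\<^esub> g = proj_class B" using g(1) by (intro inv_equality)
  then show ?thesis using proj_class_self by blast
qed

text \<open>The inverse is the transpose conjugated by the signature matrix, so it has norm at most
  \<open>opn A\<close>; applied to a unit vector this bounds the square of \<open>opn A\<close>
  below by 1.\<close>

lemma opn_pq_isometry:
  fixes A :: "real^('p::finite + 'q::finite)^('p + 'q)"
  assumes "pq_isometry A"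
  shows "norm x \<le> opn A * norm (A *v x)" "1 \<le> opn A"
proof -
  show *: "norm x \<le> opn A * norm (A *v x)" for x
  proof -
    have "norm x = norm (transpose A *v (pq_flip (A *v x)))"
      using pq_isometry_transpose[OF assms, of x] norm_pq_flip by metis
    also have "\<dots> \<le> opn A * norm (pq_flip (A *v x))"
      by (rule norm_transpose_le) (rule opn_bound)
    finally show ?thesis by simp
  qed
  obtain y :: "real^('p + 'q)" where y: "norm y = 1" using vector_choose_size[of 1] by auto
  have "1 \<le> opn A * norm (A *v y)" using *[of y] y by simp
  also have "\<dots> \<le> opn A * (opn A * norm y)" by (intro mult_left_mono opn_bound opn_nonneg)
  finally have "1 \<le> (opn A)\<^sup>2" using y by (simp add: power2_eq_square)
  then show "1 \<le> opn A" using opn_nonneg[of A] power2_le_imp_le[of 1 "opn A"] by simp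
qed

text \<open>A vector orthogonal to \<open>v\<close> is shrunk to \<open>opn A * d\<close> times its
  length, but no vector is shrunk by more than \<open>1 / opn A\<close>. As \<open>d\<close> tends
  to 0 the norms are forced to infinity.\<close>

lemma opn_pq_isometry_lower:
  fixes A :: "real^('p::finite + 'q::finite)^('p + 'q)"
  assumes A: "pq_isometry A" and near: "near_rank_one A (opn A) u v d" and card: "CARD('p) + CARD('q) > 1"
  shows "1 / (opn A)\<^sup>2 \<le> d"
proof -
  obtain w where w: "w \<noteq> 0" "v \<bullet> w = 0" using orthogonal_to_nonzero[of v] card by auto
  have "norm w \<le> opn A * norm (A *v w)" by (rule opn_pq_isometry(1)[OF A])
  also have "\<dots> \<le> opn A * ((opn A * d) * norm w)"
  proof (intro mult_left_mono opn_nonneg)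
    have "norm (A *v w - (opn A * (v \<bullet> w)) *\<^sub>R u) \<le> (opn A * d) * norm w"
      using near by (simp only: near_rank_one_def)
    then show "norm (A *v w) \<le> (opn A * d) * norm w" using w by simp
  qed
  finally have "1 * norm w \<le> ((opn A)\<^sup>2 * d) * norm w" by (simp add: power2_eq_square mult.assoc)
  moreover have "0 < norm w" using w by simp
  ultimately have "1 \<le> (opn A)\<^sup>2 * d" using mult_le_cancel_right_pos by blast
  moreover have "0 < (opn A)\<^sup>2" using opn_pq_isometry(2)[OF A] by simp
  ultimately show ?thesis by (simp add: divide_le_eq mult.commute)
qed

lemma topspace_proj_topology: "topspace (proj_topology :: (real^'n) set topology) = proj_space"
proof -
  have "{v :: real^'n. v \<noteq> 0 \<and> span {v} \<in> proj_space} = - {0}" by (auto simp: proj_space_def)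
  then have "openin (proj_topology :: (real^'n) set topology) proj_space"
    by (simp add: openin_proj_topology open_Compl)
  then show ?thesis
    using openin_subset openin_topspace openin_proj_topology by (metis subset_antisym)
qed

lemma closure_proj_topology:
  fixes b :: "nat \<Rightarrow> real^'n"
  assumes lim: "b \<longlonglongrightarrow> \<xi>" and \<xi>: "\<xi> \<noteq> 0" and b: "\<And>n. span {b n} \<in> D"
  shows "span {\<xi>} \<in> proj_topology closure_of D"
  unfolding in_closure_of
proof (intro conjI allI impI)
  show "span {\<xi>} \<in> topspace proj_topology" using \<xi> by (auto simp: topspace_proj_topology proj_space_def)
  fix T assume T: "span {\<xi>} \<in> T \<and> openin proj_topology T"
  then have "open {v. v \<noteq> 0 \<and> span {v} \<in> T}" "\<xi> \<in> {v. v \<noteq> 0 \<and> span {v} \<in> T}"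
    using \<xi> by (simp_all add: openin_proj_topology)
  then have "\<forall>\<^sub>F n in sequentially. b n \<in> {v. v \<noteq> 0 \<and> span {v} \<in> T}"
    using lim topological_tendstoD by blast
  then obtain n where "b n \<in> {v. v \<noteq> 0 \<and> span {v} \<in> T}"
    by (auto simp: eventually_sequentially)
  then show "\<exists>y. y \<in> D \<and> y \<in> T" using b by blast
qed

lemma abs_pq_form_le: "\<bar>pq_form x y\<bar> \<le> norm x * norm y"
  using Cauchy_Schwarz_ineq2[of x "pq_flip y"] by (simp add: pq_form_eq_inner)

section \<open>Geodesic words under an Anosov representation\<close>

locale anosov_words = group \<Gamma> for \<Gamma> :: "('a, 'm) monoid_scheme" (structure) +
  fixes \<rho> :: "'a \<Rightarrow> (real^('p::finite + 'q::finite)^('p + 'q)) set" and S :: "'a set" and C \<alpha> :: real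
  assumes card: "CARD('p) + CARD('q) > 1"
    and \<rho>: "\<rho> \<in> hom \<Gamma> PSL" and PSO: "\<rho> ` carrier \<Gamma> \<subseteq> PSO" and S: "sym_generating_set \<Gamma> S" and \<alpha>: "\<alpha> > 0"
    and log_gap: "\<And>\<gamma>. \<gamma> \<in> carrier \<Gamma> \<Longrightarrow>
      \<alpha> * real (word_length \<Gamma> S \<gamma>) - C \<le> log_sv 1 (\<rho> \<gamma>) - log_sv 2 (\<rho> \<gamma>)"
begin

text \<open>A matrix is chosen for each letter. The products along words represent \<rho> only up to
  sign, which norms, lines and \<open>pdist\<close> ignore.\<close>

definition m :: "'a \<Rightarrow> real^('p + 'q)^('p + 'q)" where "m s = (SOME A. A \<in> \<rho> s)"
definition mi :: "'a \<Rightarrow> real^('p + 'q)^('p + 'q)" where "mi s = (SOME B. m s ** B = mat 1 \<and> B ** m s = mat 1)"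
definition "q = exp (- \<alpha>)"
definition "K = exp C"
definition "R = 1 + (\<Sum>s\<in>S. opn (m s) + opn (mi s))"

lemma hom: "group_hom \<Gamma> PSL \<rho>"
  using \<rho> group_PSL is_group by (simp add: group_hom_def group_hom_axioms_def)

lemma SG: "S \<subseteq> carrier \<Gamma>" and finS: "finite S"
  using S by (auto simp: sym_generating_set_def)

lemma \<rho>_carrier: "\<gamma> \<in> carrier \<Gamma> \<Longrightarrow> \<rho> \<gamma> \<in> carrier PSL"
  using \<rho> by (auto simp: hom_def)

lemma \<rho>_isometry: "\<gamma> \<in> carrier \<Gamma> \<Longrightarrow> A \<in> \<rho> \<gamma> \<Longrightarrow> pq_isometry A \<and> det A = 1"
  using PSO_repr PSO by blast

lemma m_mem: "s \<in> carrier \<Gamma> \<Longrightarrow> m s \<in> \<rho> s"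
  unfolding m_def using PSL_nonempty[OF \<rho>_carrier] by (rule someI_ex)

lemma m_inverse: "s \<in> carrier \<Gamma> \<Longrightarrow> m s ** mi s = mat 1 \<and> mi s ** m s = mat 1"
proof -
  assume "s \<in> carrier \<Gamma>"
  then have "det (m s) \<noteq> 0" using \<rho>_isometry m_mem by fastforce
  then have "\<exists>B. m s ** B = mat 1 \<and> B ** m s = mat 1"
    using invertible_det_nz[of "m s"] by (simp add: invertible_def)
  then show ?thesis unfolding mi_def by (rule someI_ex)
qed

lemma word_prod_mem: "set w \<subseteq> carrier \<Gamma> \<Longrightarrow> word_prod m w \<in> \<rho> (word_value \<Gamma> w)"
proof (induction w)
  case Nil
  show ?case using PSL_one_mem group_hom.hom_one[OF hom] by simp
next
  case (Cons s w)
  then have "\<rho> (s \<otimes> word_value \<Gamma> w) = \<rho> s \<otimes>\<^bsub>PSL\<^esub> \<rho> (word_value \<Gamma> w)"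
    using word_value_closed[of w] by (intro group_hom.hom_mult[OF hom]) auto
  then show ?case using Cons PSL_mult_mem[OF m_mem[of s]] by simp
qed

lemma geodesic_carrier: "geodesic_word \<Gamma> S w \<Longrightarrow> set w \<subseteq> carrier \<Gamma>"
  using SG by (auto simp: geodesic_word_def)

lemma geodesic_isometry:
  assumes "geodesic_word \<Gamma> S w"
  shows "pq_isometry (word_prod m w)" "det (word_prod m w) = 1"
  using \<rho>_isometry[OF word_value_closed word_prod_mem] geodesic_carrier[OF assms] by auto

text \<open>Exponentiating the Anosov inequality turns the difference of logarithms into the
  relative error \<open>K * q ^ length w\<close>, with \<open>K\<close> and \<open>q\<close> the
  exponentials of \<open>C\<close> and \<open>- \<alpha>\<close>.\<close>

lemma geodesic_gap:
  assumes w: "geodesic_word \<Gamma> S w"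
  shows "\<exists>u v. near_rank_one (word_prod m w) (opn (word_prod m w)) u v (K * q ^ length w)"
proof -
  define A where "A = word_prod m w"
  define \<gamma> where "\<gamma> = word_value \<Gamma> w"
  have \<gamma>: "\<gamma> \<in> carrier \<Gamma>" unfolding \<gamma>_def by (rule word_value_closed[OF geodesic_carrier[OF w]])
  have A\<gamma>: "A \<in> \<rho> \<gamma>" unfolding A_def \<gamma>_def by (rule word_prod_mem[OF geodesic_carrier[OF w]])
  have "CARD('p + 'q) > 1" using card by simp
  note sg = singular_gap[OF this]
  have "det A \<noteq> 0" using geodesic_isometry[OF w] by (simp add: A_def)
  from sg[OF this] obtain u v s t where uv: "norm u = 1" "norm v = 1" and st: "0 < s" "0 < t" "s = onorm ((*v) A)"
    and bound: "\<forall>x. norm (A *v x - (s * (v \<bullet> x)) *\<^sub>R u) \<le> t * norm x"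
    and ln: "ln (singular_values A ! 0) - ln (singular_values A ! 1) \<le> ln s - ln t"
    by blast
  have "\<alpha> * real (length w) - C \<le> ln s - ln t"
    using log_gap[OF \<gamma>] ln w log_sv_eq[OF \<rho>_carrier[OF \<gamma>] A\<gamma>]
    by (simp add: geodesic_word_def \<gamma>_def)
  then have "ln t \<le> ln s + (C - \<alpha> * real (length w))" by simp
  then have "ln t \<le> ln s + (C + - (real (length w) * \<alpha>))" by (simp add: mult.commute)
  then have "exp (ln t) \<le> exp (ln s + (C + - (real (length w) * \<alpha>)))" by (simp only: exp_le_cancel_iff)
  then have "t \<le> s * (exp C * exp (- (real (length w) * \<alpha>)))"
    unfolding exp_add exp_ln[OF st(1)] exp_ln[OF st(2)] .
  also have "exp (- (real (length w) * \<alpha>)) = q ^ length w"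
    using exp_of_nat_mult[of "length w" "- \<alpha>"] by (simp add: q_def)
  finally have t: "t \<le> s * (K * q ^ length w)" by (simp add: K_def)
  have "norm (A *v x - (s * (v \<bullet> x)) *\<^sub>R u) \<le> (s * (K * q ^ length w)) * norm x" for x
    by (rule order_trans[OF bound[rule_format] mult_right_mono[OF t]]) simp
  then have "near_rank_one A (opn A) u v (K * q ^ length w)"
    using uv st(3) by (simp add: near_rank_one_def opn_def)
  then show ?thesis unfolding A_def by blast
qed

text \<open>\<open>U\<close> is chosen first and \<open>V\<close> relative to it, since the signs of
  the two vectors are coupled.\<close>

definition U :: "'a list \<Rightarrow> real^('p + 'q)" where
  "U w = (SOME u. \<exists>v. near_rank_one (word_prod m w) (opn (word_prod m w)) u v (K * q ^ length w))"
definition V :: "'a list \<Rightarrow> real^('p + 'q)" where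
  "V w = (SOME v. near_rank_one (word_prod m w) (opn (word_prod m w)) (U w) v (K * q ^ length w))"

lemma geodesic_UV:
  assumes "geodesic_word \<Gamma> S w"
  shows "near_rank_one (word_prod m w) (opn (word_prod m w)) (U w) (V w) (K * q ^ length w)"
proof -
  have "\<exists>v. near_rank_one (word_prod m w) (opn (word_prod m w)) (U w) v (K * q ^ length w)"
    unfolding U_def by (rule someI_ex) (rule geodesic_gap[OF assms])
  then show ?thesis unfolding V_def by (rule someI_ex)
qed

sublocale dominated_words m mi S "{w. geodesic_word \<Gamma> S w}" q K R U V
proof
  fix w x y z s a
  show "w \<in> {w. geodesic_word \<Gamma> S w} \<Longrightarrow> set w \<subseteq> S" by (simp add: geodesic_word_def)
  show "x @ y @ z \<in> {w. geodesic_word \<Gamma> S w} \<Longrightarrow> y \<in> {w. geodesic_word \<Gamma> S w}"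
    using geodesic_word_factor[OF SG] by blast
  show "0 < q" "q < 1" "0 \<le> K" using \<alpha> by (simp_all add: q_def K_def)
  show "1 \<le> R" unfolding R_def by (simp add: sum_nonneg opn_nonneg)
  show "w \<in> {w. geodesic_word \<Gamma> S w} \<Longrightarrow>
    near_rank_one (word_prod m w) (opn (word_prod m w)) (U w) (V w) (K * q ^ length w)"
    using geodesic_UV by blast
  show "w \<in> {w. geodesic_word \<Gamma> S w} \<Longrightarrow> 1 \<le> opn (word_prod m w)"
    using opn_pq_isometry(2)[OF geodesic_isometry(1)] by blast
  assume s: "s \<in> S"
  then show "m s ** mi s = mat 1" "mi s ** m s = mat 1" using m_inverse SG by blast+
  have "opn (m s) + opn (mi s) \<le> (\<Sum>s\<in>S. opn (m s) + opn (mi s))"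
    using finS s by (intro member_le_sum) (auto simp: opn_nonneg)
  then have "opn (m s) \<le> R" "opn (mi s) \<le> R"
    using opn_nonneg[of "m s"] opn_nonneg[of "mi s"] unfolding R_def by linarith+
  then show "norm (m s *v a) \<le> R * norm a" "norm (mi s *v a) \<le> R * norm a"
    using opn_bound[of "m s" a] opn_bound[of "mi s" a] by (meson mult_right_mono norm_ge_zero order_trans)+
qed

lemma attractive_line_of_factor:
  assumes w: "geodesic_word \<Gamma> S (x @ s @ z)" and dom: "dominant_eigenpair (word_prod m s) a \<phi>"
  shows "\<exists>g\<in>\<rho> ` carrier \<Gamma>. \<exists>A\<in>g. attractive_line A (span {word_prod m x *v a})"
proof -
  have sets: "set x \<subseteq> carrier \<Gamma>" "set s \<subseteq> carrier \<Gamma>" using geodesic_carrier[OF w] by auto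
  let ?x = "word_value \<Gamma> x" and ?s = "word_value \<Gamma> s"
  have cx: "?x \<in> carrier \<Gamma>" and cs: "?s \<in> carrier \<Gamma>" using sets word_value_closed by auto
  have Px: "word_prod m x \<in> \<rho> ?x" and Ps: "word_prod m s \<in> \<rho> ?s" using sets word_prod_mem by auto
  have "det (word_prod m x) \<noteq> 0" using \<rho>_isometry[OF cx Px] by simp
  then obtain Q where Q: "word_prod m x ** Q = mat 1" "Q ** word_prod m x = mat 1"
    using invertible_det_nz[of "word_prod m x"] by (auto simp: invertible_def)
  have "Q \<in> \<rho> (inv ?x)"
    using PSL_inv_mem[OF \<rho>_carrier[OF cx] Px Q(1)] group_hom.hom_inv[OF hom cx] by simp
  then have "word_prod m x ** word_prod m s ** Q \<in> \<rho> ?x \<otimes>\<^bsub>PSL\<^esub> \<rho> ?s \<otimes>\<^bsub>PSL\<^esub> \<rho> (inv ?x)"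
    by (intro PSL_mult_mem Px Ps)
  also have "\<dots> = \<rho> (?x \<otimes> ?s \<otimes> inv ?x)"
    using cx cs by (simp add: group_hom.hom_mult[OF hom])
  finally have "word_prod m x ** word_prod m s ** Q \<in> \<rho> (?x \<otimes> ?s \<otimes> inv ?x)" .
  moreover have "attractive_line (word_prod m x ** word_prod m s ** Q) (span {word_prod m x *v a})"
    using attractive_line_dominant_eigenpair[OF dominant_eigenpair_conj[OF dom Q]] .
  moreover have "?x \<otimes> ?s \<otimes> inv ?x \<in> carrier \<Gamma>" using cx cs by simp
  ultimately show ?thesis by blast
qed

text \<open>The word spells the inverse of \<gamma>, so \<open>Q\<close> represents \<gamma> itself.
  Pairing \<open>A *v V w\<close> with \<open>e\<close> equals pairing \<open>V w\<close> with
  \<open>Q *v e\<close>, hence is at most \<open>B\<close>, while \<open>A *v V w\<close> is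
  \<sigma> times \<open>U w\<close> up to a small error. Dividing by \<sigma> leaves
  \<open>B / \<sigma>\<close>, and \<open>1 / \<sigma>\<close> is at most the square root of the gap
  error.\<close>

lemma pq_form_U_bound:
  assumes w: "geodesic_word \<Gamma> S w" and \<gamma>: "\<gamma> \<in> carrier \<Gamma>" "word_value \<Gamma> w = inv \<gamma>"
    and bounded: "\<And>A. A \<in> \<rho> \<gamma> \<Longrightarrow> norm (A *v e) \<le> B"
  shows "\<bar>pq_form (U w) e\<bar> \<le> B * sqrt (K * q ^ length w) + K * q ^ length w * norm e"
proof -
  define A where "A = word_prod m w"
  define d where "d = K * q ^ length w"
  define \<sigma> where "\<sigma> = opn A"
  have near: "near_rank_one A \<sigma> (U w) (V w) d" using geodesic_UV[OF w] by (simp add: A_def d_def \<sigma>_def)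
  have iso: "pq_isometry A" and detA: "det A = 1" using geodesic_isometry[OF w] by (simp_all add: A_def)
  have A\<rho>: "A \<in> \<rho> (inv \<gamma>)" using word_prod_mem[OF geodesic_carrier[OF w]] \<gamma> by (simp add: A_def)
  have "det A \<noteq> 0" using detA by simp
  then obtain Q where Q: "A ** Q = mat 1" "Q ** A = mat 1"
    using invertible_det_nz[of A] by (auto simp: invertible_def)
  have "Q \<in> \<rho> (inv (inv \<gamma>))"
    using PSL_inv_mem[OF \<rho>_carrier A\<rho> Q(1)] group_hom.hom_inv[OF hom, of "inv \<gamma>"] \<gamma> by simp
  then have Qe: "norm (Q *v e) \<le> B" using bounded \<gamma> by simp
  have B0: "0 \<le> B" using Qe norm_ge_zero order_trans by blast
  have V: "norm (V w) = 1" using near by (simp add: near_rank_one_def)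
  have \<sigma>: "1 \<le> \<sigma>" unfolding \<sigma>_def by (rule opn_pq_isometry(2)[OF iso])
  have "A *v (Q *v e) = e" by (simp only: matrix_vector_mul_assoc Q matrix_vector_mul_lid)
  moreover have "pq_form (A *v V w) (A *v (Q *v e)) = pq_form (V w) (Q *v e)"
    using iso unfolding pq_isometry_def by blast
  ultimately have "pq_form (A *v V w) e = pq_form (V w) (Q *v e)" by simp
  then have 1: "\<bar>pq_form (A *v V w) e\<bar> \<le> B" using abs_pq_form_le[of "V w" "Q *v e"] V Qe by simp
  have "V w \<bullet> V w = 1" using V by (simp add: norm_eq_1)
  moreover have "norm (A *v V w - (\<sigma> * (V w \<bullet> V w)) *\<^sub>R U w) \<le> (\<sigma> * d) * norm (V w)"
    using near unfolding near_rank_one_def by blast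
  ultimately have "norm (A *v V w - \<sigma> *\<^sub>R U w) \<le> \<sigma> * d" using V by simp
  then have 2: "\<bar>pq_form (A *v V w - \<sigma> *\<^sub>R U w) e\<bar> \<le> \<sigma> * d * norm e"
    by (rule order_trans[OF abs_pq_form_le mult_right_mono]) simp
  have "\<sigma> * \<bar>pq_form (U w) e\<bar> = \<bar>\<sigma> * pq_form (U w) e\<bar>" using \<sigma> by (simp add: abs_mult)
  also have "\<dots> \<le> B + \<sigma> * d * norm e" using 1 2 by simp
  finally have "\<sigma> * \<bar>pq_form (U w) e\<bar> / \<sigma> \<le> (B + \<sigma> * d * norm e) / \<sigma>" using \<sigma> by (intro divide_right_mono) auto
  then have "\<bar>pq_form (U w) e\<bar> \<le> B * (1 / \<sigma>) + d * norm e" using \<sigma> by (simp add: add_divide_distrib)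
  moreover have "1 / \<sigma> \<le> sqrt d"
    using opn_pq_isometry_lower[OF iso near[unfolded \<sigma>_def] card] \<sigma>
    by (intro real_le_rsqrt) (simp add: power_divide \<sigma>_def)
  ultimately show ?thesis using B0 mult_left_mono[of "1 / \<sigma>" "sqrt d" B] unfolding d_def by linarith
qed

lemma finite_bounded_orbit:
  assumes transverse: "\<And>\<xi>. \<xi> \<noteq> 0 \<Longrightarrow> span {\<xi>} \<in> limit_set (\<rho> ` carrier \<Gamma>) \<Longrightarrow> pq_form \<xi> e \<noteq> 0"
  shows "finite {\<gamma> \<in> carrier \<Gamma>. \<forall>A\<in>\<rho> \<gamma>. norm (A *v e) \<le> B}" (is "finite ?F")
proof (rule ccontr)
  assume inf: "infinite ?F"
  let ?D = "{l. \<exists>g\<in>\<rho> ` carrier \<Gamma>. \<exists>A\<in>g. attractive_line A l}"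
  have near: "\<exists>b. norm b = 1 \<and> span {b} \<in> ?D \<and> \<bar>pq_form b e\<bar> \<le> d" if d: "d > 0" for d
  proof -
    \<comment> \<open>Half of the tolerance pays for replacing \<open>U w\<close> by the attractive
      line, the other half for the pairing of \<open>U w\<close> with \<open>e\<close>; the added 1
      keeps the denominator positive.\<close>
    define d' where "d' = d / (2 * (norm e + 1))"
    have ne: "norm e + 1 > 0" by (simp add: add_nonneg_pos)
    then have d': "d' > 0" using d by (simp add: d'_def)
    obtain n0 where n0: "\<forall>w\<in>{w. geodesic_word \<Gamma> S w}. n0 \<le> length w \<longrightarrow>
      (\<exists>x s z a \<phi> b. w = x @ s @ z \<and> dominant_eigenpair (P s) a \<phi> \<and>
      norm b = 1 \<and> span {b} = span {P x *v a} \<and> pdist b (U w) \<le> d')"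
      using attractive_line_near_U[OF d'] by blast
    have "(\<lambda>n. B * sqrt (K * q ^ n) + K * q ^ n * norm e) \<longlonglongrightarrow> B * sqrt (K * 0) + K * 0 * norm e"
      using q by (intro tendsto_intros LIMSEQ_power_zero) auto
    then have "(\<lambda>n. B * sqrt (K * q ^ n) + K * q ^ n * norm e) \<longlonglongrightarrow> 0" by simp
    from order_tendstoD(2)[OF this, of "d / 2"]
    have "\<forall>\<^sub>F n in sequentially. B * sqrt (K * q ^ n) + K * q ^ n * norm e < d / 2" using d by simp
    then obtain n1 where n1: "\<And>n. n \<ge> n1 \<Longrightarrow> B * sqrt (K * q ^ n) + K * q ^ n * norm e < d / 2"
      by (auto simp: eventually_sequentially)
    \<comment> \<open>The estimate for \<open>U\<close> concerns words spelling inverses; these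
      again form an infinite set and so leave every ball of the word metric.\<close>
    have "infinite ((\<lambda>\<gamma>. inv \<gamma>) ` ?F)"
    proof
      assume "finite ((\<lambda>\<gamma>. inv \<gamma>) ` ?F)"
      moreover have "inj_on (\<lambda>\<gamma>. inv \<gamma>) ?F"
      proof (rule inj_onI)
        fix a b assume "a \<in> ?F" "b \<in> ?F" and eq: "inv a = inv b"
        then have "a \<in> carrier \<Gamma>" "b \<in> carrier \<Gamma>" by blast+
        then have "a = inv (inv a)" "inv (inv b) = b" by simp_all
        then show "a = b" unfolding eq by (rule trans)
      qed
      ultimately show False using inf finite_imageD by blast
    qed
    then have "\<not> (\<lambda>\<gamma>. inv \<gamma>) ` ?F \<subseteq> {g \<in> carrier \<Gamma>. word_length \<Gamma> S g \<le> max n0 n1}"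
      by (rule contrapos_nn) (rule finite_subset[OF _ finite_word_ball[OF S]])
    then obtain \<gamma> where "\<gamma> \<in> ?F" "inv \<gamma> \<notin> {g \<in> carrier \<Gamma>. word_length \<Gamma> S g \<le> max n0 n1}" by blast
    then have \<gamma>: "\<gamma> \<in> carrier \<Gamma>" "\<forall>A\<in>\<rho> \<gamma>. norm (A *v e) \<le> B"
      "max n0 n1 < word_length \<Gamma> S (inv \<gamma>)" by (simp_all add: not_le)
    obtain w where w: "geodesic_word \<Gamma> S w" "word_value \<Gamma> w = inv \<gamma>"
      using exists_geodesic_word[OF S] \<gamma>(1) by blast
    have len: "n0 \<le> length w" "n1 \<le> length w" using w \<gamma>(3) by (auto simp: geodesic_word_def)
    have "w \<in> {w. geodesic_word \<Gamma> S w}" using w(1) by simp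
    from n0[rule_format, OF this len(1)]
    obtain x s z a \<phi> b where b: "w = x @ s @ z" "dominant_eigenpair (P s) a \<phi>"
      "norm b = 1" "span {b} = span {P x *v a}" "pdist b (U w) \<le> d'"
      by (elim exE conjE)
    have D: "span {b} \<in> ?D" using attractive_line_of_factor[of x s z a \<phi>] b w(1) by simp
    have "\<bar>pq_form (U w) e\<bar> \<le> d / 2"
      using pq_form_U_bound[OF w(1) \<gamma>(1) w(2), of e B] \<gamma>(2) n1[OF len(2)] by fastforce
    moreover have "\<bar>\<bar>pq_form b e\<bar> - \<bar>pq_form (U w) e\<bar>\<bar> \<le> norm e * pdist b (U w)"
      using abs_inner_pdist[of "pq_flip e" b "U w"] by (simp add: pq_form_eq_inner inner_commute)
    moreover have "norm e * pdist b (U w) \<le> norm e * d'" by (rule mult_left_mono[OF b(5)]) simp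
    moreover have "norm e * d' \<le> d / 2"
      using ne d by (simp add: d'_def field_simps)
    ultimately have "\<bar>pq_form b e\<bar> \<le> d" by linarith
    then show ?thesis using b(3) D by blast
  qed
  \<comment> \<open>Attractive lines ever closer to being orthogonal to \<open>e\<close> subconverge
    on the unit sphere, and their limit is a line of the limit set orthogonal to
    \<open>e\<close>.\<close>
  have "\<forall>n. \<exists>b. norm b = 1 \<and> span {b} \<in> ?D \<and> \<bar>pq_form b e\<bar> \<le> inverse (real (Suc n))"
    by (intro allI near) simp
  from choice[OF this] obtain b where b: "\<forall>n. norm (b n) = 1 \<and> span {b n} \<in> ?D \<and> \<bar>pq_form (b n) e\<bar> \<le> inverse (real (Suc n))"
    by (rule exE)
  have "\<forall>n. b n \<in> sphere 0 1" using b by simp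
  moreover have "seq_compact (sphere (0 :: real^('p + 'q)) 1)"
    by (simp add: compact_eq_seq_compact_metric[symmetric])
  ultimately obtain \<xi> r where \<xi>: "\<xi> \<in> sphere 0 1" and r: "strict_mono (r :: nat \<Rightarrow> nat)" and lim: "(b \<circ> r) \<longlonglongrightarrow> \<xi>"
    by (elim seq_compactE[rotated])
  have \<xi>0: "\<xi> \<noteq> 0" using \<xi> by auto
  have "span {\<xi>} \<in> limit_set (\<rho> ` carrier \<Gamma>)"
    unfolding limit_set_def using b by (intro closure_proj_topology[OF lim \<xi>0]) simp
  moreover have "pq_form \<xi> e = 0"
  proof -
    have "(\<lambda>n. pq_form (b (r n)) e) \<longlonglongrightarrow> pq_form \<xi> e"
      using lim unfolding pq_form_eq_inner comp_def by (intro tendsto_intros)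
    moreover have "(\<lambda>n. pq_form (b (r n)) e) \<longlonglongrightarrow> 0"
    proof (rule Lim_null_comparison)
      have "norm (pq_form (b (r n)) e) \<le> inverse (real (Suc n))" for n
      proof -
        have "inverse (real (Suc (r n))) \<le> inverse (real (Suc n))"
          using seq_suble[OF r, of n] by (intro le_imp_inverse_le) auto
        moreover have "\<bar>pq_form (b (r n)) e\<bar> \<le> inverse (real (Suc (r n)))" using b by blast
        ultimately show ?thesis unfolding real_norm_def by (rule order_trans[rotated])
      qed
      then show "\<forall>\<^sub>F n in sequentially. norm (pq_form (b (r n)) e) \<le> inverse (real (Suc n))"
        by (intro always_eventually allI)
      show "(\<lambda>n. inverse (real (Suc n))) \<longlonglongrightarrow> 0" by (rule LIMSEQ_inverse_real_of_nat)
    qed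
    ultimately show ?thesis by (rule LIMSEQ_unique)
  qed
  ultimately show False using transverse \<xi>0 by blast
qed

end

theorem proposition6p7:
  fixes \<Gamma> :: "('a, 'm) monoid_scheme"
    and \<rho> :: "'a \<Rightarrow> (real ^ ('p::finite + 'q::finite) ^ ('p + 'q)) set"
    and l \<tau> :: "(real ^ ('p + 'q)) set"
    and \<bb> \<bb>p :: "(real ^ ('p + 'q) ^ ('p + 'q)) set"
    and t :: real
  assumes "CARD('p) + CARD('q) > 2"
    and "word_hyperbolic \<Gamma>" and "non_elementary \<Gamma>"
    and "P1_anosov \<Gamma> \<rho>"
    and "l \<in> Omega \<Gamma> \<rho>"
    and "\<tau> \<in> S_set l"
    and "maximal_subalgebra_in (p_space \<tau> \<inter> q_space l) \<bb>"
    and "closed_weyl_chamber \<bb> \<bb>p"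
    and "t \<ge> 0"
  shows "finite {\<gamma> \<in> carrier \<Gamma>. sqrt (q_size (polar_projection l \<tau> \<bb>p (\<rho> \<gamma>))) \<le> t}"
proof -
  obtain X where X: "X \<in> \<bb>" "X \<noteq> 0" "\<bb>p = {t *\<^sub>R X | t. t \<ge> 0}"
    using assms(8) by (auto simp: closed_weyl_chamber_def)
  have "X \<in> p_space \<tau> \<inter> q_space l" using X(1) assms(7) by (auto simp: maximal_subalgebra_in_def)
  moreover have "l \<in> pseudo_hyperbolic" using assms(5) by (simp add: Omega_def)
  ultimately obtain e w Y where frame: "polar_frame l \<tau> e w Y \<bb>p"
    using polar_frame_exists[OF assms(1) _ assms(6) _ X(2)] X(3) by metis
  interpret polar_frame l \<tau> e w Y \<bb>p by (rule frame)
  obtain C where C: "\<forall>g\<in>PSO. \<forall>A\<in>g. sqrt (q_size (polar_projection l \<tau> \<bb>p g)) \<le> t \<longrightarrow> norm (A *v e) \<le> C"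
    using orbit_bounded[of t] by blast
  have PSO: "\<rho> ` carrier \<Gamma> \<subseteq> PSO" using assms(4) by (simp add: P1_anosov_def)
  obtain S D \<alpha> where hom: "\<rho> \<in> hom \<Gamma> PSL" and S: "sym_generating_set \<Gamma> S" and \<alpha>: "\<alpha> > 0"
    and gap: "\<forall>\<gamma>\<in>carrier \<Gamma>. \<alpha> * real (word_length \<Gamma> S \<gamma>) - D \<le> log_sv 1 (\<rho> \<gamma>) - log_sv 2 (\<rho> \<gamma>)"
    using assms(4) unfolding P1_anosov_def projective_anosov_def by blast
  have "group \<Gamma>" using assms(2) by (simp add: word_hyperbolic_def)
  then interpret anosov_words \<Gamma> \<rho> S D \<alpha>
  proof (intro anosov_words.intro anosov_words_axioms.intro)
    show "CARD('p) + CARD('q) > 1" using assms(1) by simp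
  qed (use hom PSO S \<alpha> gap in blast)+
  have e0: "e \<noteq> 0" using e(2) by auto
  have "finite {\<gamma> \<in> carrier \<Gamma>. \<forall>A\<in>\<rho> \<gamma>. norm (A *v e) \<le> C}"
  proof (rule finite_bounded_orbit)
    fix \<xi> assume \<xi>: "\<xi> \<noteq> 0" "span {\<xi>} \<in> limit_set (\<rho> ` carrier \<Gamma>)"
    have "e \<in> l" "\<xi> \<in> span {\<xi>}" by (simp_all add: l span_base)
    then have "pq_form e \<xi> \<noteq> 0" using assms(5) \<xi> e0 unfolding Omega_def by blast
    then show "pq_form \<xi> e \<noteq> 0" using pq_form_commute[of e \<xi>] by simp
  qed
  then show ?thesis
    by (rule rev_finite_subset) (use C PSO in blast)
qed

end
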